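(* Assume that one of the following holds for the stiffness matrix $\mathbf A$: (a) $\mathbf A\in\mathcal D_a(\eta_L)$ with $\eta_L>d$ and $\mathbf A$ is invertible in $\ell^2(\mathbb Z^d)$; or (b) $\mathbf A\in\mathcal D_e(\eta_L)$ with a constant $c_L$ in the definition of $\mathcal D_e(\eta_L)$ satisfying $c_L<\frac12(e^{\eta_L}-1)\min_\ell a_{\ell,\ell}$. Let $\theta\in(0,1)$, $tol\in[0,1)$, and let $J\ge1$ be the smallest integer for which $\psi_{\mathbf A^{-1}}(J,\bar\eta_L)\le\sqrt{\frac{1-\theta^2}{\alpha_*\alpha^*}}$. Then the sequences of residuals $r_n$ and errors $u-u_n$ generated for $n\ge0$ by the algorithm PC-ADFOUR$(\theta,tol,J)$ satisfy $$\|r_{n+1}\|\le\rho\,\|r_n\|\qquad\text{and}\qquad |||u-u_{n+1}|||\le\rho\,|||u-u_n|||$$ for $\rho=3\,\frac{\alpha^*}{\alpha_*}\sqrt{1-\theta^2}$. In particular, if $\theta$ is chosen in such a way that $\rho<1$, then for any $tol>0$ the algorithm terminates in a finite number of iterations, whereas for $tol=0$ the sequence $u_n$ converges to $u$ in $H^1_p(\Omega)$ as $n\to\infty$.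
   Context: Let $d\ge1$, $\Omega=(0,2\pi)^d$, $\phi_k(x)=(2\pi)^{-d/2}e^{ik\cdot x}$ for $k\in\mathbb Z^d$, $\hat v_k=(v,\phi_k)_{L^2(\Omega)}$. $V=H^1_p(\Omega)$: $H^1$ functions $2\pi$-periodic in each direction, norm $\|v\|^2=\sum_k(1+|k|^2)|\hat v_k|^2$ ($|k|$ Euclidean). $H^{-1}_p(\Omega)$ is its (anti)dual, $\hat f_k=\langle f,\phi_k\rangle$, $\|f\|^2=\sum_k(1+|k|^2)^{-1}|\hat f_k|^2$ (same symbol for both norms). For $\Lambda\subset\mathbb Z^d$, $P_\Lambda$ keeps only the Fourier coefficients with index in $\Lambda$; $V_\Lambda=\mathrm{span}\{\phi_k:k\in\Lambda\}$. $Lu=-\nabla\cdot(\nu\nabla u)+\sigma u$ with sufficiently smooth real ($2\pi$-periodic) coefficients, $0<\nu_*\le\nu\le\nu^*<\infty$, $0<\sigma_*\le\sigma\le\sigma^*<\infty$; $\alpha_*=\min(\nu_*,\sigma_* )$, $\alpha^*=\max(\nu^*,\sigma^* )$; $a(u,v)=\int_\Omega\nu\nabla u\cdot\nabla\bar v+\int_\Omega\sigma u\bar v$; $|||v|||=\sqrt{a(v,v)}$; $f\in H^{-1}_p(\Omega)$; $u\in V$ solves $a(u,v)=\langle f,v\rangle$ for all $v\in V$. For finite $\Lambda$, $u_\Lambda\in V_\Lambda$ solves $a(u_\Lambda,v)=\langle f,v\rangle$ for all $v\in V_\Lambda$. Residual: $r(w)=f-Lw$. Stiffness matrix: $\mathbf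 A=(a_{\ell,k})_{\ell,k\in\mathbb Z^d}$, $a_{\ell,k}=\frac{a(\phi_k,\phi_\ell)}{c_\ell c_k}$, $c_k=\sqrt{1+|k|^2}$. A matrix is in $\mathcal D_a(\eta_L)$ (resp. $\mathcal D_e(\eta_L)$) if for some $c_L>0$, $|a_{\ell,k}|\le c_L(1+|\ell-k|)^{-\eta_L}$ (resp. $|a_{\ell,k}|\le c_Le^{-\eta_L|\ell-k|}$) for all $\ell,k$. For a matrix $\mathbf B$ and integer $J\ge0$, $(\mathbf B_J)_{\ell,k}=b_{\ell,k}$ if $|\ell-k|\le J$ and $0$ otherwise. In case (a), $\bar\eta_L=\eta_L$ and $\psi_{\mathbf A^{-1}}(J,\bar\eta_L)=C_{\mathbf A^{-1}}(J+1)^{-(\bar\eta_L-d)}$. In case (b), $\bar\eta_L\in(0,\eta_L]$ is such that $e^{-\bar\eta_L}$ is the unique zero in $(0,1)$ of $z^2-\frac{e^{2\eta_L}+2c_L+1}{e^{\eta_L}(c_L+1)}z+1$, and $\psi_{\mathbf A^{-1}}(J,\bar\eta_L)=C_{\mathbf A^{-1}}(J+1)^{d-1}e^{-\bar\eta_LJ}$. Here $C_{\mathbf A^{-1}}$ is a constant such that $\|\mathbf A^{-1}-(\mathbf A^{-1})_J\|_{\ell^2\to\ell^2}\le\psi_{\mathbf A^{-1}}(J,\bar\eta_L)$ for all $J\ge0$. DÖRFLER$(r,\theta)$ returns a finite set $\Lambda^*\subset\mathbb Z^d$ of minimal cardinality with $\|P_{\Lambda^*}r\|\ge\theta\|r\|$.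 ENRICH$(\Lambda,J)=\{k\in\mathbb Z^d:\exists\,\ell\in\Lambda,\ |k-\ell|\le J\}$. E-DÖRFLER$(r,\theta,J)=$ ENRICH(DÖRFLER$(r,\theta),J)$. COARSE$(w,\epsilon)$, for $w\in V_{\Lambda^*}$ with $\Lambda^*$ finite, returns a set $\Lambda\subseteq\Lambda^*$ of minimal cardinality such that $\|w-P_\Lambda w\|\le2\epsilon$ (it is used with $\epsilon$ known to satisfy $\|u-w\|\le\epsilon$). Algorithm PC-ADFOUR$(\theta,tol,J)$: set $\Lambda_0=\emptyset$, $u_0=0$, $r_0=f$. For $n=0,1,2,\dots$: $\widehat{\partial\Lambda}_n=$ E-DÖRFLER$(r_n,\theta,J)$; $\widehat\Lambda_{n+1}=\Lambda_n\cup\widehat{\partial\Lambda}_n$; $\widehat u_{n+1}=u_{\widehat\Lambda_{n+1}}$; $\Lambda_{n+1}=$ COARSE$\big(\widehat u_{n+1},\frac1{\alpha_*}\sqrt{1-\theta^2}\,\|r_n\|\big)$; $u_{n+1}=u_{\Lambda_{n+1}}$; $r_{n+1}=r(u_{n+1})$; continue while $\|r_{n+1}\|>tol$. *)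

theory Defs
  imports "HOL-Analysis.Analysis"
begin

text \<open>The dimension is $d = $ CARD('d); lattice points are of type int^'d.\<close>

definition lat :: "int^'d \<Rightarrow> real^'d" where
  "lat k = (\<chi> i. real_of_int (k $ i))"

definition cell :: "(real^'d) set" where
  "cell = box 0 (\<chi> i. 2 * pi)"

definition phi :: "int^'d \<Rightarrow> real^'d \<Rightarrow> complex" where
  "phi k x = complex_of_real ((2 * pi) powr (- real CARD('d) / 2)) * exp (\<i> * complex_of_real (lat k \<bullet> x))"

definition fcoeff :: "(real^'d \<Rightarrow> complex) \<Rightarrow> int^'d \<Rightarrow> complex" where
  "fcoeff v k = integral\<^sup>L (lebesgue_on cell) (\<lambda>x. v x * cnj (phi k x))"

definition periodic :: "(real^'d \<Rightarrow> 'b) \<Rightarrow> bool" where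
  "periodic v \<longleftrightarrow> (\<forall>x i. v (x + axis i (2 * pi)) = v x)"

definition square_int :: "(real^'d \<Rightarrow> complex) \<Rightarrow> bool" where
  "square_int v \<longleftrightarrow> v \<in> borel_measurable (lebesgue_on cell) \<and>
     integrable (lebesgue_on cell) (\<lambda>x. (cmod (v x))\<^sup>2)"

section \<open>The space $H^1_p$ and its antidual\<close>

definition partial :: "'d \<Rightarrow> (real^'d \<Rightarrow> complex) \<Rightarrow> real^'d \<Rightarrow> complex" where
  "partial i p x = frechet_derivative p (at x) (axis i 1)"

definition test_fun :: "(real^'d \<Rightarrow> complex) \<Rightarrow> bool" where
  "test_fun p \<longleftrightarrow> periodic p \<and> (\<forall>x. p differentiable (at x)) \<and>
     (\<forall>i. continuous_on UNIV (partial i p))"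

text \<open>Testing over one period against periodic $C^1$ functions that need not vanish on the
  boundary of the cell says that g is the weak gradient of v in the cell and, by Green's formula,
  that the traces of v on opposite faces agree. By density, testing with $C^\infty$ periodic functions
  would give the same notion.\<close>

definition weak_gradient :: "(real^'d \<Rightarrow> complex) \<Rightarrow> (real^'d \<Rightarrow> complex^'d) \<Rightarrow> bool" where
  "weak_gradient v g \<longleftrightarrow> (\<forall>i. square_int (\<lambda>x. g x $ i) \<and>
     (\<forall>p. test_fun p \<longrightarrow>
        integral\<^sup>L (lebesgue_on cell) (\<lambda>x. v x * partial i p x) =
        - integral\<^sup>L (lebesgue_on cell) (\<lambda>x. g x $ i * p x)))"

definition H1p :: "(real^'d \<Rightarrow> complex) set" where
  "H1p = {v. periodic v \<and> square_int v \<and> (\<exists>g. weak_gradient v g)}"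

text \<open>Unique up to null sets, hence only ever used under an integral.\<close>

definition grad :: "(real^'d \<Rightarrow> complex) \<Rightarrow> real^'d \<Rightarrow> complex^'d" where
  "grad v = (SOME g. weak_gradient v g)"

definition H1_norm :: "(real^'d \<Rightarrow> complex) \<Rightarrow> real" where
  "H1_norm v = sqrt (\<Sum>\<^sub>\<infinity>k. (1 + (norm (lat k))\<^sup>2) * (cmod (fcoeff v k))\<^sup>2)"

type_synonym 'd functional = "(real^'d \<Rightarrow> complex) \<Rightarrow> complex"

definition H1p_dual :: "('d::finite) functional set" where
  "H1p_dual = {f.
     (\<forall>v\<in>H1p. \<forall>w\<in>H1p. f (\<lambda>x. v x + w x) = f v + f w) \<and>
     (\<forall>c. \<forall>v\<in>H1p. f (\<lambda>x. c * v x) = cnj c * f v) \<and>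
     (\<exists>C. \<forall>v\<in>H1p. cmod (f v) \<le> C * H1_norm v)}"

definition dual_norm :: "('d::finite) functional \<Rightarrow> real" where
  "dual_norm f = sqrt (\<Sum>\<^sub>\<infinity>k. inverse (1 + (norm (lat k))\<^sup>2) * (cmod (f (phi k)))\<^sup>2)"

text \<open>The projection onto Fourier modes: on functions (used for finite index sets only), and on
  functionals.\<close>

definition proj :: "(int^'d) set \<Rightarrow> (real^'d \<Rightarrow> complex) \<Rightarrow> real^'d \<Rightarrow> complex" where
  "proj \<Lambda> v = (\<lambda>x. \<Sum>k\<in>\<Lambda>. fcoeff v k * phi k x)"

definition proj_dual :: "(int^'d) set \<Rightarrow> 'd functional \<Rightarrow> 'd functional" where
  "proj_dual \<Lambda> f = (\<lambda>v. \<Sum>\<^sub>\<infinity>k\<in>\<Lambda>. f (phi k) * cnj (fcoeff v k))"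

definition trig_space :: "(int^'d) set \<Rightarrow> (real^'d \<Rightarrow> complex) set" where
  "trig_space \<Lambda> = {(\<lambda>x. \<Sum>k\<in>S. c k * phi k x) | c S. finite S \<and> S \<subseteq> \<Lambda>}"

section \<open>The bilinear form, Galerkin solutions and residuals\<close>

definition form_a ::
  "(real^'d \<Rightarrow> real) \<Rightarrow> (real^'d \<Rightarrow> real) \<Rightarrow> (real^'d \<Rightarrow> complex) \<Rightarrow> (real^'d \<Rightarrow> complex) \<Rightarrow> complex" where
  "form_a \<nu> \<sigma> u v =
     integral\<^sup>L (lebesgue_on cell)
       (\<lambda>x. complex_of_real (\<nu> x) * (\<Sum>i\<in>UNIV. grad u x $ i * cnj (grad v x $ i))) +
     integral\<^sup>L (lebesgue_on cell) (\<lambda>x. complex_of_real (\<sigma> x) * u x * cnj (v x))"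

definition energy_norm :: "(real^'d \<Rightarrow> real) \<Rightarrow> (real^'d \<Rightarrow> real) \<Rightarrow> (real^'d \<Rightarrow> complex) \<Rightarrow> real" where
  "energy_norm \<nu> \<sigma> v = sqrt (Re (form_a \<nu> \<sigma> v v))"

definition weak_solution ::
  "(real^'d \<Rightarrow> real) \<Rightarrow> (real^'d \<Rightarrow> real) \<Rightarrow> 'd functional \<Rightarrow> (real^'d \<Rightarrow> complex) \<Rightarrow> bool" where
  "weak_solution \<nu> \<sigma> f u \<longleftrightarrow> u \<in> H1p \<and> (\<forall>v\<in>H1p. form_a \<nu> \<sigma> u v = f v)"

definition galerkin ::
  "(real^'d \<Rightarrow> real) \<Rightarrow> (real^'d \<Rightarrow> real) \<Rightarrow> 'd functional \<Rightarrow> (int^'d) set \<Rightarrow> (real^'d \<Rightarrow> complex) \<Rightarrow> bool" where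
  "galerkin \<nu> \<sigma> f \<Lambda> w \<longleftrightarrow> w \<in> trig_space \<Lambda> \<and> (\<forall>v\<in>trig_space \<Lambda>. form_a \<nu> \<sigma> w v = f v)"

text \<open>$Lw$ is the functional $v \mapsto a(w,v)$.\<close>

definition residual ::
  "(real^'d \<Rightarrow> real) \<Rightarrow> (real^'d \<Rightarrow> real) \<Rightarrow> 'd functional \<Rightarrow> (real^'d \<Rightarrow> complex) \<Rightarrow> 'd functional" where
  "residual \<nu> \<sigma> f w = (\<lambda>v. f v - form_a \<nu> \<sigma> w v)"

section \<open>Infinite matrices\<close>

type_synonym 'd bimatrix = "int^'d \<Rightarrow> int^'d \<Rightarrow> complex"

definition stiffness :: "(real^'d \<Rightarrow> real) \<Rightarrow> (real^'d \<Rightarrow> real) \<Rightarrow> 'd bimatrix" where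
  "stiffness \<nu> \<sigma> l k = form_a \<nu> \<sigma> (phi k) (phi l) /
     complex_of_real (sqrt (1 + (norm (lat l))\<^sup>2) * sqrt (1 + (norm (lat k))\<^sup>2))"

definition in_Da :: "('d::finite) bimatrix \<Rightarrow> real \<Rightarrow> bool" where
  "in_Da B \<eta> \<longleftrightarrow> (\<exists>c>0. \<forall>l k. cmod (B l k) \<le> c * (1 + norm (lat (l - k))) powr (- \<eta>))"

text \<open>Exponential decay with a prescribed constant c.\<close>

definition in_De :: "('d::finite) bimatrix \<Rightarrow> real \<Rightarrow> real \<Rightarrow> bool" where
  "in_De B \<eta> c \<longleftrightarrow> c > 0 \<and> (\<forall>l k. cmod (B l k) \<le> c * exp (- \<eta> * norm (lat (l - k))))"

definition truncate :: "('d::finite) bimatrix \<Rightarrow> nat \<Rightarrow> 'd bimatrix" where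
  "truncate B J l k = (if norm (lat (l - k)) \<le> real J then B l k else 0)"

definition ell2 :: "(int^'d \<Rightarrow> complex) set" where
  "ell2 = {x. (\<lambda>k. (cmod (x k))\<^sup>2) summable_on UNIV}"

definition ell2_norm :: "(int^'d \<Rightarrow> complex) \<Rightarrow> real" where
  "ell2_norm x = sqrt (\<Sum>\<^sub>\<infinity>k. (cmod (x k))\<^sup>2)"

definition mat_apply :: "('d::finite) bimatrix \<Rightarrow> (int^'d \<Rightarrow> complex) \<Rightarrow> int^'d \<Rightarrow> complex" where
  "mat_apply B x = (\<lambda>l. \<Sum>\<^sub>\<infinity>k. B l k * x k)"

text \<open>B defines an operator on $\ell^2$ whose norm is at most c.\<close>

definition opnorm_le :: "('d::finite) bimatrix \<Rightarrow> real \<Rightarrow> bool" where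
  "opnorm_le B c \<longleftrightarrow> (\<forall>x\<in>ell2. (\<forall>l. (\<lambda>k. B l k * x k) summable_on UNIV) \<and>
     mat_apply B x \<in> ell2 \<and> ell2_norm (mat_apply B x) \<le> c * ell2_norm x)"

definition ell2_invertible :: "('d::finite) bimatrix \<Rightarrow> bool" where
  "ell2_invertible B \<longleftrightarrow> (\<exists>c. opnorm_le B c) \<and> bij_betw (mat_apply B) ell2 ell2 \<and>
     (\<exists>c. \<forall>x\<in>ell2. ell2_norm x \<le> c * ell2_norm (mat_apply B x))"

text \<open>The matrix of the inverse operator: column k is the preimage of the k-th unit vector.
  Meaningful when B acts bijectively on $\ell^2$.\<close>

definition inverse_mat :: "('d::finite) bimatrix \<Rightarrow> 'd bimatrix" where
  "inverse_mat B l k = the_inv_into ell2 (mat_apply B) (\<lambda>j. if j = k then 1 else 0) l"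

definition psi_alg :: "nat \<Rightarrow> real \<Rightarrow> real \<Rightarrow> nat \<Rightarrow> real" where
  "psi_alg d C \<eta> J = C * (real J + 1) powr (- (\<eta> - real d))"

definition psi_exp :: "nat \<Rightarrow> real \<Rightarrow> real \<Rightarrow> nat \<Rightarrow> real" where
  "psi_exp d C \<eta> J = C * (real J + 1) ^ (d - 1) * exp (- \<eta> * real J)"

definition exp_rate :: "real \<Rightarrow> real \<Rightarrow> real \<Rightarrow> bool" where
  "exp_rate \<eta> c \<eta>bar \<longleftrightarrow> 0 < \<eta>bar \<and> \<eta>bar \<le> \<eta> \<and>
     (\<forall>z::real. 0 < z \<and> z < 1 \<longrightarrow>
        (z\<^sup>2 - (exp (2 * \<eta>) + 2 * c + 1) / (exp \<eta> * (c + 1)) * z + 1 = 0 \<longleftrightarrow> z = exp (- \<eta>bar)))"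

section \<open>The algorithm\<close>

text \<open>Minimal-cardinality sets are not unique, so the procedures DOERFLER and COARSE are relations
  that hold for every admissible output.\<close>

definition doerfler :: "('d::finite) functional \<Rightarrow> real \<Rightarrow> (int^'d) set \<Rightarrow> bool" where
  "doerfler r \<theta> S \<longleftrightarrow>
     is_arg_min card (\<lambda>T. finite T \<and> dual_norm (proj_dual T r) \<ge> \<theta> * dual_norm r) S"

definition enrich :: "(int^'d) set \<Rightarrow> nat \<Rightarrow> (int^'d) set" where
  "enrich \<Lambda> J = {k. \<exists>l\<in>\<Lambda>. norm (lat (k - l)) \<le> real J}"

definition e_doerfler :: "('d::finite) functional \<Rightarrow> real \<Rightarrow> nat \<Rightarrow> (int^'d) set \<Rightarrow> bool" where
  "e_doerfler r \<theta> J S \<longleftrightarrow> (\<exists>T. doerfler r \<theta> T \<and> S = enrich T J)"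

text \<open>Here w lies in the trigonometric space of the finite set \<open>\<Lambda>'\<close>.\<close>

definition coarse :: "(int^'d) set \<Rightarrow> (real^'d \<Rightarrow> complex) \<Rightarrow> real \<Rightarrow> (int^'d) set \<Rightarrow> bool" where
  "coarse \<Lambda>' w \<epsilon> S \<longleftrightarrow>
     is_arg_min card (\<lambda>T. T \<subseteq> \<Lambda>' \<and> H1_norm (\<lambda>x. w x - proj T w x) \<le> 2 * \<epsilon>) S"

definition pc_step ::
  "(real^'d \<Rightarrow> real) \<Rightarrow> (real^'d \<Rightarrow> real) \<Rightarrow> 'd functional \<Rightarrow> real \<Rightarrow> real \<Rightarrow> nat \<Rightarrow>
   (int^'d) set \<Rightarrow> 'd functional \<Rightarrow>
   (int^'d) set \<Rightarrow> (real^'d \<Rightarrow> complex) \<Rightarrow> 'd functional \<Rightarrow> bool" where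
  "pc_step \<nu> \<sigma> f \<alpha> \<theta> J \<Lambda> r \<Lambda>' w' r' \<longleftrightarrow>
     (\<exists>D \<Lambda>hat what. e_doerfler r \<theta> J D \<and> \<Lambda>hat = \<Lambda> \<union> D \<and> galerkin \<nu> \<sigma> f \<Lambda>hat what \<and>
        coarse \<Lambda>hat what (1 / \<alpha> * sqrt (1 - \<theta>\<^sup>2) * dual_norm r) \<Lambda>' \<and>
        galerkin \<nu> \<sigma> f \<Lambda>' w' \<and> r' = residual \<nu> \<sigma> f w')"

text \<open>Iteration n, which computes the iterate n + 1, is carried out iff no earlier iteration met the
  stopping test. The test is at the end of the loop, so iteration 0 is always carried out.\<close>

definition performed :: "real \<Rightarrow> (nat \<Rightarrow> ('d::finite) functional) \<Rightarrow> nat \<Rightarrow> bool" where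
  "performed tol r n \<longleftrightarrow> (\<forall>m. 1 \<le> m \<and> m \<le> n \<longrightarrow> dual_norm (r m) > tol)"

definition terminates :: "real \<Rightarrow> (nat \<Rightarrow> ('d::finite) functional) \<Rightarrow> bool" where
  "terminates tol r \<longleftrightarrow> (\<exists>n. \<not> performed tol r n)"

text \<open>A run of PC-ADFOUR; \<open>\<alpha>\<close> is the constant $\alpha_*$ in the call of COARSE. After termination
  the sequences are continued by their final values.\<close>

definition pc_adfour ::
  "(real^'d \<Rightarrow> real) \<Rightarrow> (real^'d \<Rightarrow> real) \<Rightarrow> 'd functional \<Rightarrow> real \<Rightarrow> real \<Rightarrow> real \<Rightarrow> nat \<Rightarrow>
   (nat \<Rightarrow> (int^'d) set) \<Rightarrow> (nat \<Rightarrow> real^'d \<Rightarrow> complex) \<Rightarrow> (nat \<Rightarrow> ('d::finite) functional) \<Rightarrow> bool" where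
  "pc_adfour \<nu> \<sigma> f \<alpha> \<theta> tol J \<Lambda> w r \<longleftrightarrow>
     \<Lambda> 0 = {} \<and> w 0 = (\<lambda>x. 0) \<and> r 0 = f \<and>
     (\<forall>n. if performed tol r n
          then pc_step \<nu> \<sigma> f \<alpha> \<theta> J (\<Lambda> n) (r n) (\<Lambda> (Suc n)) (w (Suc n)) (r (Suc n))
          else \<Lambda> (Suc n) = \<Lambda> n \<and> w (Suc n) = w n \<and> r (Suc n) = r n)"

end

theory Submission
  imports Defs
begin

text \<open>The errors of the iterates are studied through their Fourier coefficients. With the weights
$c_k = \sqrt{1 + |k|^2}$, the norm of $H^1_p$ is the $\ell^2$ norm of $(c_k \hat v_k)_k$, and the dual norm
of a functional $r$ is the $\ell^2$ norm of $(r(\phi_k) / c_k)_k$. In these coordinates the map from the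
error $e = u - w$ to the residual $r = a(e, \cdot)$ is the stiffness matrix $\mathbf A$. Parseval's identity
compares the integrals in $a$ with these norms: $a$ is Hermitian and
$\alpha_* \|v\|^2 \le a(v,v) \le \alpha^* \|v\|^2$. Hence
$\sqrt{\alpha_*}\, |||e||| \le \|r\| \le \sqrt{\alpha^*}\, |||e|||$, and $\mathbf A$ is a bijection of
$\ell^2$.

Consider one iteration, with $s = \sqrt{1 - \theta^2}$ and $\kappa = \alpha^* / \alpha_*$. Marking
yields a finite set $T$ that carries all of the residual but a part of norm at most $s \|r\|$. Let
$x = \mathbf A^{-1} (r|_T)$. Up to the truncation error $\psi(J)$ the inverse couples only indices at
distance at most $J$, so outside the enriched set $x$ has norm at most
$\psi(J) \|r\| \le s \|r\| / \sqrt{\alpha_* \alpha^*}$. Restricting $x$ to the enriched set gives a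
competitor for the Galerkin correction, and by optimality in the energy norm
$|||u - \hat u||| \le 2 s \|r\| / \sqrt{\alpha_*}$ (lemma \<open>predictor_error\<close>).

Coarsening allows a change of $\hat u$ by at most $2 s \|r\| / \alpha_*$ in $H^1_p$. Adding the two errors
by the triangle inequality would give the factor $2 \sqrt\kappa + 2 \kappa$, which exceeds $3 \kappa$
for $\kappa < 4$. But $u - \hat u$ is orthogonal to the larger trial space, which contains
$\hat u - u_{n+1}$, so the two errors add in squares (lemma \<open>coarsening_error\<close>), and the factor
becomes $2 \sqrt{\kappa + \kappa^2}\, s \le 2 \sqrt 2\, \kappa s \le 3 \kappa s = \rho$
(lemma \<open>contraction_arithmetic\<close>). Termination and convergence follow from geometric decay.

Three facts from analysis carry this. Parseval's identity (lemma \<open>parseval\<close>) follows from the density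
of trigonometric polynomials in $L^2$, which is obtained from one-dimensional polynomial approximation
and a Dynkin argument. Weak gradients act on Fourier coefficients by multiplication with $i k$, because
integration by parts on the torus has no boundary terms; this itself follows from translation invariance
of the integral over a period. Finally, the existence of $\mathbf A^{-1}$ on $\ell^2$ is obtained from a
Neumann series for a coercive bounded matrix (lemma \<open>coercive_matrix_bijective\<close>).\<close>

section \<open>The cell and translation invariance\<close>

abbreviation cellM :: "(real^'d) measure" where
  "cellM \<equiv> lebesgue_on cell"

lemma mem_cell: "x \<in> cell \<longleftrightarrow> (\<forall>i. 0 < x $ i \<and> x $ i < 2 * pi)"
  by (simp add: cell_def mem_box_cart)

lemma cell_subset: "cell \<subseteq> cbox 0 (\<chi> i. 4 * pi)"
proof
  fix x :: "real^'d" assume "x \<in> cell"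
  then have "0 \<le> x $ i \<and> x $ i \<le> 4 * pi" for i
    using pi_gt_zero by (auto simp: mem_cell less_imp_le intro: order_trans[of _ "2 * pi"])
  then show "x \<in> cbox 0 (\<chi> i. 4 * pi)" by (simp add: mem_box_cart)
qed

lemma cell_borel [measurable, simp]: "cell \<in> sets borel"
  by (simp add: cell_def)

lemma cell_lebesgue [simp]: "cell \<in> sets lebesgue"
  by (simp add: cell_def)

lemma space_cellM [simp]: "space cellM = cell"
  by (simp add: space_restrict_space)

lemma measurable_cellM_borel:
  "h \<in> borel_measurable borel \<Longrightarrow> h \<in> borel_measurable cellM"
  by (intro measurable_restrict_space1 measurable_completion) simp

lemma measure_cell: "measure lebesgue (cell :: (real^'d) set) = (2 * pi) ^ CARD('d)"
proof -
  have "measure lebesgue (cell :: (real^'d) set) = measure lborel (cell :: (real^'d) set)"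
    by (simp add: cell_def)
  also have "\<dots> = (\<Prod>b\<in>(Basis :: (real^'d) set). ((\<chi> i. 2 * pi) - 0) \<bullet> b)"
    unfolding cell_def
    by (rule measure_lborel_box) (auto simp: Basis_vec_def inner_axis)
  also have "\<dots> = (\<Prod>b\<in>(Basis :: (real^'d) set). 2 * pi)"
    by (rule prod.cong) (auto simp: Basis_vec_def inner_axis)
  finally show ?thesis by simp
qed

lemma finite_measure_cellM: "finite_measure (cellM :: (real^'d) measure)"
proof (rule finite_measureI)
  have "emeasure cellM (space (cellM :: (real^'d) measure)) = emeasure lborel (cell :: (real^'d) set)"
    by (simp add: emeasure_restrict_space)
  also have "\<dots> < \<infinity>" unfolding cell_def by (rule emeasure_lborel_box_finite)
  finally show "emeasure cellM (space (cellM :: (real^'d) measure)) \<noteq> \<infinity>" by simp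
qed

lemma integral_cellM:
  fixes h :: "real^'d \<Rightarrow> 'b::{banach, second_countable_topology}"
  assumes "h \<in> borel_measurable borel"
  shows "integral\<^sup>L cellM h = (LINT x:cell|lborel. h x)"
proof -
  have "integral\<^sup>L cellM h = (LINT x|lebesgue. indicator cell x *\<^sub>R h x)"
    by (subst integral_restrict_space) auto
  also have "\<dots> = (LINT x|lborel. indicator cell x *\<^sub>R h x)"
    using assms by (subst integral_completion) auto
  finally show ?thesis by (simp add: set_lebesgue_integral_def)
qed

lemma AE_component_neq: "AE x in lborel. (x :: real^'d) $ i \<noteq> c"
proof -
  have "negligible {x :: real^'d. x $ i = c}"
    by (simp add: cart_eq_inner_axis negligible_standard_hyperplane)
  then have "{x :: real^'d. x $ i = c} \<in> null_sets lborel"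
    by (simp add: negligible_iff_null_sets null_sets_def closed_Collect_eq borel_closed
        continuous_on_component)
  then show ?thesis by (auto intro: AE_I')
qed

lemma lborel_integral_shift:
  fixes F :: "real^'d \<Rightarrow> 'b::{banach, second_countable_topology}"
  assumes "F \<in> borel_measurable borel"
  shows "(LINT x|lborel. F (x + c)) = (LINT x|lborel. F x)"
proof -
  have "(LINT x|lborel. F x) = (LINT x|distr lborel borel ((+) c). F x)"
    by (simp add: lborel_distr_plus)
  also have "\<dots> = (LINT x|lborel. F (c + x))"
    by (rule integral_distr) (use assms in auto)
  finally show ?thesis by (simp add: add.commute)
qed

text \<open>Up to null sets, the shifted cell consists of a part of the cell and of a slab beyond the face
$x_i = 2\pi$; moved back by one period, the slab fills the rest of the cell, and $h$ has the same values
there. Orthogonality of the modes and integration by parts both rest on this lemma.\<close>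

lemma integral_cell_shift:
  fixes h :: "real^'d \<Rightarrow> complex"
  assumes cont: "continuous_on UNIV h" and per: "periodic h" and t: "0 \<le> t" "t < 2 * pi"
  shows "integral\<^sup>L cellM (\<lambda>x. h (x + axis i t)) = integral\<^sup>L cellM h"
proof -
  have hm [measurable]: "h \<in> borel_measurable borel"
    using cont by (rule borel_measurable_continuous_onI)
  define A1 where "A1 = {x \<in> (cell :: (real^'d) set). x $ i < t}"
  define A2 where "A2 = {x \<in> (cell :: (real^'d) set). t < x $ i}"
  \<comment> \<open>\<open>A3\<close> is the slab beyond the face, a translate of \<open>A1\<close>\<close>
  define A3 where "A3 = {x :: real^'d. x - axis i (2 * pi) \<in> A1}"
  \<comment> \<open>a box that contains the cell and its shifts by less than a period, where the continuous \<open>h\<close> is integrable\<close>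
  define K where "K = cbox (0 :: real^'d) (\<chi> j. 4 * pi)"
  have comp: "(\<lambda>x :: real^'d. x $ i) \<in> borel_measurable borel"
    by (intro borel_measurable_continuous_onI continuous_intros)
  have A1m [measurable]: "A1 \<in> sets borel" and A2m [measurable]: "A2 \<in> sets borel"
    unfolding A1_def A2_def using comp by measurable
  have "(\<lambda>x :: real^'d. x - axis i (2 * pi)) \<in> borel_measurable borel" by simp
  from measurable_sets[OF this A1m] have A3m [measurable]: "A3 \<in> sets borel"
    by (simp add: A3_def vimage_def)
  have Kint: "set_integrable lborel K h"
    unfolding set_integrable_def K_def
    by (rule borel_integrable_compact) (use cont continuous_on_subset in auto)
  have mem_cell_i: "z \<in> cell \<longleftrightarrow> (\<forall>j. j \<noteq> i \<longrightarrow> 0 < z $ j \<and> z $ j < 2 * pi) \<and> 0 < z $ i \<and> z $ i < 2 * pi" for z :: "real^'d"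
    unfolding mem_cell by metis
  have shift: "(y - axis i c) $ j = (if j = i then y $ i - c else y $ j)" for y :: "real^'d" and c j
    by (simp add: axis_def)
  have mem_A3: "y \<in> A3 \<longleftrightarrow>
      (\<forall>j. j \<noteq> i \<longrightarrow> 0 < y $ j \<and> y $ j < 2 * pi) \<and> 2 * pi < y $ i \<and> y $ i < 2 * pi + t" for y
    unfolding A3_def A1_def mem_Collect_eq mem_cell_i shift using t by auto
  have sub: "A1 \<subseteq> K" "A2 \<subseteq> K" "A3 \<subseteq> K"
  proof -
    show "A1 \<subseteq> K" "A2 \<subseteq> K" using cell_subset by (auto simp: A1_def A2_def K_def)
    show "A3 \<subseteq> K"
    proof
      fix x assume x: "x \<in> A3"
      have "0 \<le> x $ j \<and> x $ j \<le> 4 * pi" for j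
      proof (cases "j = i")
        case True
        then have "2 * pi < x $ j" "x $ j < 2 * pi + t" using x by (auto simp: mem_A3)
        then show ?thesis using t pi_gt_zero by linarith
      next
        case False
        then have "0 < x $ j" "x $ j < 2 * pi" using x by (auto simp: mem_A3)
        then show ?thesis using pi_gt_zero by linarith
      qed
      then show "x \<in> K" by (simp add: K_def mem_box_cart)
    qed
  qed
  have int: "set_integrable lborel A1 h" "set_integrable lborel A2 h" "set_integrable lborel A3 h"
    using set_integrable_subset[OF Kint] sub by auto
  have split0: "(LINT x:cell|lborel. h x) = (LINT x:A1|lborel. h x) + (LINT x:A2|lborel. h x)"
  proof -
    have "(LINT x:cell|lborel. h x) = (LINT x:A1 \<union> A2|lborel. h x)"
      unfolding set_lebesgue_integral_def
    proof (rule integral_cong_AE)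
      show "AE x in lborel. indicator cell x *\<^sub>R h x = indicator (A1 \<union> A2) x *\<^sub>R h x"
        using AE_component_neq[of i t] by eventually_elim (auto simp: A1_def A2_def indicator_def)
    qed auto
    also have "\<dots> = (LINT x:A1|lborel. h x) + (LINT x:A2|lborel. h x)"
      by (rule set_integral_Un) (use int in \<open>auto simp: A1_def A2_def\<close>)
    finally show ?thesis .
  qed
  have "integral\<^sup>L cellM (\<lambda>x. h (x + axis i t))
      = (LINT x|lborel. indicator cell ((x + axis i t) - axis i t) *\<^sub>R h (x + axis i t))"
    by (subst integral_cellM) (simp_all add: set_lebesgue_integral_def)
  also have "\<dots> = (LINT y|lborel. indicator cell (y - axis i t) *\<^sub>R h y)"
    by (rule lborel_integral_shift[where F="\<lambda>y. indicator cell (y - axis i t) *\<^sub>R h y"]) simp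
  also have "\<dots> = (LINT y:A2 \<union> A3|lborel. h y)"
    unfolding set_lebesgue_integral_def
  proof (rule integral_cong_AE)
    show "AE y in lborel. indicator cell (y - axis i t) *\<^sub>R h y = indicator (A2 \<union> A3) y *\<^sub>R h y"
      using AE_component_neq[of i "2 * pi"]
    proof eventually_elim
      case (elim y)
      have "y - axis i t \<in> cell \<longleftrightarrow>
          (\<forall>j. j \<noteq> i \<longrightarrow> 0 < y $ j \<and> y $ j < 2 * pi) \<and> t < y $ i \<and> y $ i < 2 * pi + t"
        unfolding mem_cell_i shift by auto
      moreover have "y \<in> A2 \<longleftrightarrow>
          (\<forall>j. j \<noteq> i \<longrightarrow> 0 < y $ j \<and> y $ j < 2 * pi) \<and> t < y $ i \<and> y $ i < 2 * pi"
        unfolding A2_def mem_Collect_eq mem_cell_i using t by auto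
      moreover note mem_A3[of y]
      ultimately have "y - axis i t \<in> cell \<longleftrightarrow> y \<in> A2 \<union> A3"
        using elim t by auto
      then show ?case by (simp add: indicator_def)
    qed
  qed auto
  also have "\<dots> = (LINT y:A2|lborel. h y) + (LINT y:A3|lborel. h y)"
    by (rule set_integral_Un) (use int in \<open>auto simp: mem_A3 A2_def mem_cell_i\<close>)
  also have "(LINT y:A3|lborel. h y) = (LINT z|lborel. indicator A3 (z + axis i (2*pi)) *\<^sub>R h (z + axis i (2*pi)))"
    unfolding set_lebesgue_integral_def
    by (rule lborel_integral_shift[symmetric]) simp
  also have "\<dots> = (LINT z:A1|lborel. h z)"
    using per by (simp add: A3_def indicator_def periodic_def set_lebesgue_integral_def)
  finally show ?thesis using split0 by (simp add: integral_cellM)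
qed

section \<open>Fourier modes\<close>

lemma lat_add: "lat (k + l) = lat k + lat l"
  by (simp add: lat_def vec_eq_iff)

lemma lat_minus: "lat (- k) = - lat k"
  by (simp add: lat_def vec_eq_iff)

lemma lat_zero [simp]: "lat 0 = 0"
  by (simp add: lat_def vec_eq_iff)

lemma lat_nth [simp]: "lat k $ i = real_of_int (k $ i)"
  by (simp add: lat_def)

lemma phi_shift: "phi k (x + axis i t) = exp (\<i> * of_real (real_of_int (k $ i) * t)) * phi k x"
  by (simp add: phi_def inner_add_right inner_axis distrib_left exp_add)

lemma periodic_phi [simp]: "periodic (phi k)"
proof -
  have "exp (\<i> * of_real (real_of_int n * (2 * pi))) = (1::complex)" for n
    using cis_multiple_2pi[of "real_of_int n"] by (simp add: cis_conv_exp mult.commute mult.left_commute)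
  then show ?thesis by (simp add: periodic_def phi_shift)
qed

lemma cnj_phi: "cnj (phi k x) = phi (- k) x"
  by (simp add: phi_def exp_cnj lat_minus)

lemma phi_mult: "phi k x * phi l x = of_real ((2 * pi) powr (- real CARD('d) / 2)) * phi (k + l) (x :: real^'d)"
  by (simp add: phi_def lat_add inner_add_left distrib_left exp_add)

lemma norm_phi: "cmod (phi k (x :: real^'d)) = (2 * pi) powr (- real CARD('d) / 2)"
  by (simp add: phi_def norm_mult)

lemma has_derivative_phi:
  "(phi (k :: int^'a) has_derivative (\<lambda>h. \<i> * of_real (lat k \<bullet> h) * phi k x)) (at x)"
proof -
  have lin: "((\<lambda>x. \<i> * complex_of_real (lat k \<bullet> x)) has_derivative (\<lambda>h. \<i> * of_real (lat k \<bullet> h))) (at x)"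
    by (auto intro!: derivative_eq_intros)
  have "((\<lambda>x. exp (\<i> * complex_of_real (lat k \<bullet> x))) has_derivative
      (\<lambda>h. exp (\<i> * complex_of_real (lat k \<bullet> x)) * (\<i> * of_real (lat k \<bullet> h)))) (at x)"
    by (rule has_derivative_compose[OF lin DERIV_exp[unfolded has_field_derivative_def]])
  from has_derivative_mult_right[OF this, of "complex_of_real ((2 * pi) powr (- real CARD('a) / 2))"]
  show ?thesis
    unfolding phi_def by (simp add: mult_ac)
qed

lemma partial_phi: "partial i (phi k) x = \<i> * of_int (k $ i) * phi k x"
  unfolding partial_def frechet_derivative_at[OF has_derivative_phi, symmetric]
  by (simp add: inner_axis)

lemma continuous_on_phi [continuous_intros]: "continuous_on A (phi k)"
  by (meson continuous_at_imp_continuous_on has_derivative_continuous has_derivative_phi)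

lemma phi_measurable [measurable]: "phi k \<in> borel_measurable borel"
  by (intro borel_measurable_continuous_onI continuous_on_phi)

lemma test_fun_phi [simp]: "test_fun (phi k)"
  unfolding test_fun_def differentiable_def using has_derivative_phi
  by (auto simp: partial_phi intro!: continuous_intros)

section \<open>The inner product of L2\<close>

lemma cnj_measurable [measurable (raw)]:
  "f \<in> borel_measurable M \<Longrightarrow> (\<lambda>x. cnj (f x)) \<in> borel_measurable M"
  by (rule borel_measurable_continuous_on[of cnj]) (auto intro: continuous_intros)

definition l2ip :: "(real^'d \<Rightarrow> complex) \<Rightarrow> (real^'d \<Rightarrow> complex) \<Rightarrow> complex" where
  "l2ip v w = integral\<^sup>L cellM (\<lambda>x. v x * cnj (w x))"

lemma fcoeff_l2ip: "fcoeff v k = l2ip v (phi k)"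
  by (simp add: fcoeff_def l2ip_def)

lemma square_int_measurable: "square_int v \<Longrightarrow> v \<in> borel_measurable cellM"
  by (simp add: square_int_def)

lemma square_int_mult_integrable:
  assumes "square_int v" "square_int w"
  shows "integrable cellM (\<lambda>x. v x * cnj (w x))"
proof (rule Bochner_Integration.integrable_bound)
  show "integrable cellM (\<lambda>x. (cmod (v x))\<^sup>2 + (cmod (w x))\<^sup>2)"
    using assms by (simp add: square_int_def)
  show "(\<lambda>x. v x * cnj (w x)) \<in> borel_measurable cellM"
    using assms[THEN square_int_measurable] by measurable
  have "cmod (v x) * cmod (w x) \<le> (cmod (v x))\<^sup>2 + (cmod (w x))\<^sup>2" for x
  proof -
    have "2 * (cmod (v x) * cmod (w x)) \<le> (cmod (v x))\<^sup>2 + (cmod (w x))\<^sup>2"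
      using sum_squares_bound[of "cmod (v x)" "cmod (w x)"] by (simp add: mult.assoc)
    moreover have "0 \<le> cmod (v x) * cmod (w x)" by simp
    ultimately show ?thesis by linarith
  qed
  then show "AE x in cellM. norm (v x * cnj (w x)) \<le> norm ((cmod (v x))\<^sup>2 + (cmod (w x))\<^sup>2)"
    by (auto simp: norm_mult)
qed

lemma square_int_iff:
  "square_int v \<longleftrightarrow> v \<in> borel_measurable cellM \<and> integrable cellM (\<lambda>x. v x * cnj (v x))"
proof -
  have "integrable cellM (\<lambda>x. v x * cnj (v x)) \<longleftrightarrow> integrable cellM (\<lambda>x. (cmod (v x))\<^sup>2)"
    by (simp only: complex_norm_square[symmetric] complex_of_real_integrable_eq)
  then show ?thesis by (simp add: square_int_def)
qed

lemma square_int_add: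
  assumes "square_int v" "square_int w"
  shows "square_int (\<lambda>x. v x + w x)"
proof -
  have "integrable cellM (\<lambda>x. (v x * cnj (v x) + v x * cnj (w x)) + (w x * cnj (v x) + w x * cnj (w x)))"
    by (intro Bochner_Integration.integrable_add square_int_mult_integrable assms)
  then show ?thesis
    using assms[THEN square_int_measurable] by (simp add: square_int_iff algebra_simps)
qed

lemma square_int_cmult:
  assumes "square_int v"
  shows "square_int (\<lambda>x. c * v x)"
  using assms by (auto simp add: square_int_def norm_mult power_mult_distrib)

lemma square_int_diff:
  assumes "square_int v" "square_int w"
  shows "square_int (\<lambda>x. v x - w x)"
  using square_int_add[OF assms(1) square_int_cmult[OF assms(2), of "-1"]] by simp

lemma square_int_bounded:
  assumes "v \<in> borel_measurable cellM" "\<And>x. x \<in> cell \<Longrightarrow> cmod (v x) \<le> B"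
  shows "square_int v"
  unfolding square_int_def
proof
  show "integrable cellM (\<lambda>x. (cmod (v x))\<^sup>2)"
  proof (rule finite_measure.integrable_const_bound[OF finite_measure_cellM, where B="B\<^sup>2"])
    show "AE x in cellM. norm ((cmod (v x))\<^sup>2) \<le> B\<^sup>2"
      using assms(2) by (auto intro!: power_mono)
  qed (use assms(1) in measurable)
qed (fact assms(1))

lemma square_int_zero [simp]: "square_int (\<lambda>x. 0)"
  by (simp add: square_int_def)

lemma square_int_sum:
  "(\<And>k. k \<in> S \<Longrightarrow> square_int (v k)) \<Longrightarrow> square_int (\<lambda>x. \<Sum>k\<in>S. v k x)"
  by (induction S rule: infinite_finite_induct) (auto intro: square_int_add)

lemma square_int_phi [simp]: "square_int (phi k)"
  by (rule square_int_bounded) (auto intro: measurable_cellM_borel simp: norm_phi)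

lemma square_int_bounded_mult:
  assumes "square_int v" "h \<in> borel_measurable cellM" "\<And>x. x \<in> cell \<Longrightarrow> cmod (h x) \<le> B"
  shows "square_int (\<lambda>x. h x * v x)"
  unfolding square_int_def
proof
  show m: "(\<lambda>x. h x * v x) \<in> borel_measurable cellM"
    using assms(2) square_int_measurable[OF assms(1)] by measurable
  show "integrable cellM (\<lambda>x. (cmod (h x * v x))\<^sup>2)"
  proof (rule Bochner_Integration.integrable_bound)
    show "integrable cellM (\<lambda>x. B\<^sup>2 * (cmod (v x))\<^sup>2)"
      using assms(1) by (simp add: square_int_def)
    show "(\<lambda>x. (cmod (h x * v x))\<^sup>2) \<in> borel_measurable cellM" using m by measurable
    show "AE x in cellM. norm ((cmod (h x * v x))\<^sup>2) \<le> norm (B\<^sup>2 * (cmod (v x))\<^sup>2)"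
      using assms(3) by (auto simp: norm_mult power_mult_distrib intro!: mult_right_mono power_mono)
  qed
qed

lemma l2ip_add_left:
  "square_int u \<Longrightarrow> square_int v \<Longrightarrow> square_int w \<Longrightarrow> l2ip (\<lambda>x. u x + v x) w = l2ip u w + l2ip v w"
  unfolding l2ip_def
  by (simp add: distrib_right square_int_mult_integrable)

lemma l2ip_cmult_left: "l2ip (\<lambda>x. c * v x) w = c * l2ip v w"
  by (simp add: l2ip_def mult.assoc)

lemma l2ip_cnj: "l2ip w v = cnj (l2ip v w)"
proof -
  have eq: "(\<lambda>x. w x * cnj (v x)) = (\<lambda>x. cnj (v x * cnj (w x)))"
    by (rule ext) simp
  show ?thesis unfolding l2ip_def eq by (rule Bochner_Integration.integral_cnj)
qed

lemma l2ip_zero_left [simp]: "l2ip (\<lambda>x. 0) w = 0"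
  by (simp add: l2ip_def)

lemma l2ip_sum_left:
  assumes "\<And>k. k \<in> S \<Longrightarrow> square_int (v k)" "square_int w"
  shows "l2ip (\<lambda>x. \<Sum>k\<in>S. v k x) w = (\<Sum>k\<in>S. l2ip (v k) w)"
  using assms(1)
  by (induction S rule: infinite_finite_induct)
     (auto simp: l2ip_add_left square_int_sum assms(2))

lemma l2ip_diff_left:
  "square_int u \<Longrightarrow> square_int v \<Longrightarrow> square_int w \<Longrightarrow> l2ip (\<lambda>x. u x - v x) w = l2ip u w - l2ip v w"
  unfolding l2ip_def
  by (simp add: left_diff_distrib square_int_mult_integrable)

lemma l2ip_diff_right:
  "square_int u \<Longrightarrow> square_int v \<Longrightarrow> square_int w \<Longrightarrow> l2ip w (\<lambda>x. u x - v x) = l2ip w u - l2ip w v"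
  unfolding l2ip_def
  by (simp add: right_diff_distrib square_int_mult_integrable)

lemma l2ip_self: "l2ip v v = of_real (integral\<^sup>L cellM (\<lambda>x. (cmod (v x))\<^sup>2))"
  unfolding l2ip_def by (simp only: complex_norm_square[symmetric] integral_complex_of_real)

text \<open>If $k_i \neq l_i$, a shift by $\pi / |k_i - l_i|$ in direction $i$ turns $\phi_{k-l}$ into its negative
and leaves the integral over the cell unchanged, so that this integral vanishes.\<close>

lemma l2ip_phi: "l2ip (phi (k :: int^'a)) (phi l) = (if k = l then 1 else 0)"
proof (cases "k = l")
  case True
  define \<kappa> where "\<kappa> = (2 * pi) powr (- real CARD('a) / 2)"
  have "\<kappa>\<^sup>2 = (2 * pi) powr (- real CARD('a) / 2 + - real CARD('a) / 2)"
    unfolding \<kappa>_def power2_eq_square by (rule powr_add[symmetric])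
  also have "\<dots> = (2 * pi) powr (- real CARD('a))" by simp
  also have "\<dots> = inverse ((2 * pi) ^ CARD('a))"
    by (subst powr_minus) (simp add: powr_realpow del: power_mult_distrib)
  finally have "\<kappa>\<^sup>2 = inverse ((2 * pi) ^ CARD('a))" .
  moreover have "(2 * pi) ^ CARD('a) \<noteq> 0" by simp
  ultimately have \<kappa>: "\<kappa>\<^sup>2 * (2 * pi) ^ CARD('a) = 1" by (metis left_inverse)
  have "integral\<^sup>L cellM (\<lambda>x. (cmod (phi k x))\<^sup>2) = integral\<^sup>L cellM (\<lambda>x :: real^'a. \<kappa>\<^sup>2)"
    by (simp only: norm_phi \<kappa>_def)
  also have "\<dots> = \<kappa>\<^sup>2 * (2 * pi) ^ CARD('a)"
    by (simp add: measure_restrict_space measure_cell del: power_mult_distrib)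
  finally have "integral\<^sup>L cellM (\<lambda>x. (cmod (phi k x))\<^sup>2) = 1" using \<kappa> by simp
  then show ?thesis using True by (simp add: l2ip_self)
next
  case False
  then obtain i where i: "(k - l) $ i \<noteq> 0" by (auto simp: vec_eq_iff)
  define m where "m = k - l"
  define t where "t = pi / \<bar>real_of_int (m $ i)\<bar>"
  have "m $ i \<noteq> 0" using i by (simp add: m_def)
  then have "1 \<le> \<bar>m $ i\<bar>" by linarith
  then have m1: "1 \<le> \<bar>real_of_int (m $ i)\<bar>" by linarith
  have "t \<le> pi / 1" unfolding t_def by (rule divide_left_mono) (use m1 in auto)
  then have "t \<le> pi" by simp
  moreover have "0 \<le> t" by (simp add: t_def)
  ultimately have t: "0 \<le> t" "t < 2 * pi" using pi_gt_zero by linarith+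
  have *: "exp (\<i> * of_real (real_of_int (m $ i) * t)) = - 1"
  proof -
    have "real_of_int (m $ i) * t = pi \<or> real_of_int (m $ i) * t = - pi"
      using m1 unfolding t_def by (cases "m $ i > 0") auto
    then have "cis (real_of_int (m $ i) * t) = - 1"
      by (auto simp: complex_eq_iff)
    then show ?thesis by (simp only: cis_conv_exp)
  qed
  have "integral\<^sup>L cellM (phi m) = integral\<^sup>L cellM (\<lambda>x. phi m (x + axis i t))"
    by (rule integral_cell_shift[symmetric]) (auto simp: t continuous_intros)
  also have "\<dots> = - integral\<^sup>L cellM (phi m)"
    by (simp only: phi_shift *) simp
  finally have "integral\<^sup>L cellM (phi m) = 0" by simp
  then show ?thesis using False
    by (simp add: l2ip_def cnj_phi phi_mult m_def)
qed

lemma fcoeff_phi: "fcoeff (phi k) l = (if k = l then 1 else 0)"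
  by (simp add: fcoeff_l2ip l2ip_phi)

lemma fcoeff_diff: "square_int v \<Longrightarrow> square_int w \<Longrightarrow> fcoeff (\<lambda>x. v x - w x) k = fcoeff v k - fcoeff w k"
  by (simp add: fcoeff_l2ip l2ip_diff_left)

lemma square_int_trig [simp]: "square_int (\<lambda>x. \<Sum>k\<in>S. c k * phi k x)"
  by (intro square_int_sum square_int_cmult square_int_phi)

lemma fcoeff_trig:
  assumes "finite S"
  shows "fcoeff (\<lambda>x. \<Sum>k\<in>S. c k * phi k x) l = (if l \<in> S then c l else 0)"
proof -
  have "fcoeff (\<lambda>x. \<Sum>k\<in>S. c k * phi k x) l = (\<Sum>k\<in>S. l2ip (\<lambda>x. c k * phi k x) (phi l))"
    unfolding fcoeff_l2ip
    by (rule l2ip_sum_left[where v="\<lambda>k x. c k * phi k x"])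
       (rule square_int_cmult square_int_phi)+
  also have "\<dots> = (\<Sum>k\<in>S. if k = l then c k else 0)"
    by (rule sum.cong) (auto simp: l2ip_cmult_left l2ip_phi)
  finally show ?thesis using assms by simp
qed

lemma l2ip_trig_right:
  assumes "square_int v"
  shows "l2ip v (\<lambda>x. \<Sum>k\<in>S. c k * phi k x) = (\<Sum>k\<in>S. fcoeff v k * cnj (c k))"
proof -
  have "l2ip v (\<lambda>x. \<Sum>k\<in>S. c k * phi k x) = cnj (l2ip (\<lambda>x. \<Sum>k\<in>S. c k * phi k x) v)"
    by (rule l2ip_cnj)
  also have "l2ip (\<lambda>x. \<Sum>k\<in>S. c k * phi k x) v = (\<Sum>k\<in>S. c k * l2ip (phi k) v)"
    by (subst l2ip_sum_left[where v="\<lambda>k x. c k * phi k x"])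
       (simp_all add: square_int_cmult l2ip_cmult_left assms)
  also have "\<dots> = (\<Sum>k\<in>S. c k * cnj (fcoeff v k))"
    unfolding fcoeff_l2ip by (subst l2ip_cnj[of "phi _" v]) (rule refl)
  finally show ?thesis
    by (simp add: mult.commute)
qed

text \<open>Completing the square. Choosing $c = \hat v$ gives Bessel's inequality; for arbitrary $c$ the identity
turns approximation by trigonometric polynomials into a lower bound for the sum of the squared
coefficients.\<close>

lemma best_approximation:
  assumes "square_int v" "finite S"
  shows "integral\<^sup>L cellM (\<lambda>x. (cmod (v x - (\<Sum>k\<in>S. c k * phi k x)))\<^sup>2)
       = integral\<^sup>L cellM (\<lambda>x. (cmod (v x))\<^sup>2) - (\<Sum>k\<in>S. (cmod (fcoeff v k))\<^sup>2)
         + (\<Sum>k\<in>S. (cmod (fcoeff v k - c k))\<^sup>2)"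
proof -
  let ?T = "\<lambda>x. \<Sum>k\<in>S. c k * phi k x"
  have "of_real (integral\<^sup>L cellM (\<lambda>x. (cmod (v x - ?T x))\<^sup>2)) = l2ip (\<lambda>x. v x - ?T x) (\<lambda>x. v x - ?T x)"
    by (simp only: l2ip_self)
  also have "\<dots> = l2ip v v - l2ip v ?T - (l2ip ?T v - l2ip ?T ?T)"
    using assms by (simp add: l2ip_diff_left l2ip_diff_right square_int_diff)
  also have "l2ip ?T v = cnj (l2ip v ?T)" by (rule l2ip_cnj)
  also have "l2ip v v = of_real (integral\<^sup>L cellM (\<lambda>x. (cmod (v x))\<^sup>2))"
    by (rule l2ip_self)
  also have "l2ip v ?T = (\<Sum>k\<in>S. fcoeff v k * cnj (c k))"
    by (rule l2ip_trig_right[OF assms(1)])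
  also have "l2ip ?T ?T = (\<Sum>k\<in>S. fcoeff ?T k * cnj (c k))"
    by (rule l2ip_trig_right[OF square_int_trig])
  also have "\<dots> = (\<Sum>k\<in>S. c k * cnj (c k))"
    by (rule sum.cong) (simp_all add: fcoeff_trig assms(2))
  also have "of_real (integral\<^sup>L cellM (\<lambda>x. (cmod (v x))\<^sup>2)) - (\<Sum>k\<in>S. fcoeff v k * cnj (c k))
        - (cnj (\<Sum>k\<in>S. fcoeff v k * cnj (c k)) - (\<Sum>k\<in>S. c k * cnj (c k)))
      = of_real (integral\<^sup>L cellM (\<lambda>x. (cmod (v x))\<^sup>2))
        + (\<Sum>k\<in>S. - (fcoeff v k * cnj (c k)) - cnj (fcoeff v k) * c k + c k * cnj (c k))"
    by (simp add: sum.distrib sum_subtractf sum_negf)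
  also have "(\<Sum>k\<in>S. - (fcoeff v k * cnj (c k)) - cnj (fcoeff v k) * c k + c k * cnj (c k))
      = (\<Sum>k\<in>S. of_real ((cmod (fcoeff v k - c k))\<^sup>2 - (cmod (fcoeff v k))\<^sup>2))"
  proof (rule sum.cong)
    fix k
    have "complex_of_real ((cmod (fcoeff v k - c k))\<^sup>2 - (cmod (fcoeff v k))\<^sup>2)
        = (fcoeff v k - c k) * cnj (fcoeff v k - c k) - fcoeff v k * cnj (fcoeff v k)"
      by (simp only: of_real_diff complex_norm_square)
    then show "- (fcoeff v k * cnj (c k)) - cnj (fcoeff v k) * c k + c k * cnj (c k)
        = of_real ((cmod (fcoeff v k - c k))\<^sup>2 - (cmod (fcoeff v k))\<^sup>2)"
      by (simp add: algebra_simps)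
  qed simp
  also have "of_real (integral\<^sup>L cellM (\<lambda>x. (cmod (v x))\<^sup>2))
      + (\<Sum>k\<in>S. of_real ((cmod (fcoeff v k - c k))\<^sup>2 - (cmod (fcoeff v k))\<^sup>2))
     = of_real (integral\<^sup>L cellM (\<lambda>x. (cmod (v x))\<^sup>2)
      + (\<Sum>k\<in>S. (cmod (fcoeff v k - c k))\<^sup>2 - (cmod (fcoeff v k))\<^sup>2))"
    by simp
  finally show ?thesis by (simp only: of_real_eq_iff sum_subtractf)
qed

section \<open>Trigonometric polynomials\<close>

lemma trig_spaceI: "finite S \<Longrightarrow> S \<subseteq> \<Lambda> \<Longrightarrow> (\<lambda>x. \<Sum>k\<in>S. c k * phi k x) \<in> trig_space \<Lambda>"
  unfolding trig_space_def by blast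

lemma trig_space_zero: "(\<lambda>x. 0) \<in> trig_space \<Lambda>"
  using trig_spaceI[of "{}"] by simp

lemma trig_space_phi: "k \<in> \<Lambda> \<Longrightarrow> phi k \<in> trig_space \<Lambda>"
  using trig_spaceI[of "{k}" \<Lambda> "\<lambda>_. 1"] by simp

lemma trig_space_cmult:
  assumes "v \<in> trig_space \<Lambda>"
  shows "(\<lambda>x. a * v x) \<in> trig_space \<Lambda>"
proof -
  obtain c S where S: "finite S" "S \<subseteq> \<Lambda>" and v: "v = (\<lambda>x. \<Sum>k\<in>S. c k * phi k x)"
    using assms unfolding trig_space_def by blast
  have "(\<lambda>x. a * v x) = (\<lambda>x. \<Sum>k\<in>S. (a * c k) * phi k x)"
    by (simp add: v sum_distrib_left mult.assoc)
  then show ?thesis using trig_spaceI[OF S, of "\<lambda>k. a * c k"] by simp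
qed

lemma trig_space_add:
  assumes "v \<in> trig_space \<Lambda>" "w \<in> trig_space \<Lambda>"
  shows "(\<lambda>x. v x + w x) \<in> trig_space \<Lambda>"
proof -
  obtain c S where S: "finite S" "S \<subseteq> \<Lambda>" and v: "v = (\<lambda>x. \<Sum>k\<in>S. c k * phi k x)"
    using assms(1) unfolding trig_space_def by blast
  obtain c' S' where S': "finite S'" "S' \<subseteq> \<Lambda>" and w: "w = (\<lambda>x. \<Sum>k\<in>S'. c' k * phi k x)"
    using assms(2) unfolding trig_space_def by blast
  let ?d = "\<lambda>k. (if k \<in> S then c k else 0) + (if k \<in> S' then c' k else 0)"
  have "v x + w x = (\<Sum>k\<in>S \<union> S'. ?d k * phi k x)" for x
  proof -
    have "v x = (\<Sum>k\<in>S \<union> S'. (if k \<in> S then c k else 0) * phi k x)"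
      unfolding v by (rule sum.mono_neutral_cong_left) (use S S' in auto)
    moreover have "w x = (\<Sum>k\<in>S \<union> S'. (if k \<in> S' then c' k else 0) * phi k x)"
      unfolding w by (rule sum.mono_neutral_cong_left) (use S S' in auto)
    ultimately show ?thesis by (simp add: sum.distrib distrib_right)
  qed
  then show ?thesis using trig_spaceI[of "S \<union> S'" \<Lambda> ?d] S S' by simp
qed

lemma trig_space_diff:
  assumes "v \<in> trig_space \<Lambda>" "w \<in> trig_space \<Lambda>"
  shows "(\<lambda>x. v x - w x) \<in> trig_space \<Lambda>"
  using trig_space_add[OF assms(1) trig_space_cmult[OF assms(2), of "-1"]] by simp

lemma trig_space_sum:
  "(\<And>i. i \<in> I \<Longrightarrow> v i \<in> trig_space \<Lambda>) \<Longrightarrow> (\<lambda>x. \<Sum>i\<in>I. v i x) \<in> trig_space \<Lambda>"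
  by (induction I rule: infinite_finite_induct) (auto intro: trig_space_zero trig_space_add)

lemma trig_space_mono: "\<Lambda> \<subseteq> \<Lambda>' \<Longrightarrow> trig_space \<Lambda> \<subseteq> trig_space \<Lambda>'"
  unfolding trig_space_def by blast

text \<open>$\phi_k \phi_l$ is a constant multiple of $\phi_{k+l}$. So polynomials in trigonometric polynomials are
again trigonometric polynomials, as needed for the polynomial approximation of indicator functions.\<close>

lemma trig_space_mult:
  assumes "v \<in> trig_space UNIV" "w \<in> trig_space UNIV"
  shows "(\<lambda>x. v x * w x :: complex) \<in> trig_space (UNIV :: (int^'d) set)"
proof -
  obtain c S where v: "v = (\<lambda>x. \<Sum>k\<in>S. c k * phi k x)"
    using assms(1) unfolding trig_space_def by blast
  obtain c' S' where w: "w = (\<lambda>x. \<Sum>k\<in>S'. c' k * phi k x)"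
    using assms(2) unfolding trig_space_def by blast
  let ?K = "complex_of_real ((2 * pi) powr (- real CARD('d) / 2))"
  have "v x * w x = (\<Sum>k\<in>S. \<Sum>l\<in>S'. (c k * c' l * ?K) * phi (k + l) x)" for x
  proof -
    have "v x * w x = (\<Sum>k\<in>S. \<Sum>l\<in>S'. (c k * phi k x) * (c' l * phi l x))"
      by (simp add: v w sum_product)
    also have "\<dots> = (\<Sum>k\<in>S. \<Sum>l\<in>S'. (c k * c' l) * (phi k x * phi l x))"
      by (intro sum.cong refl) (simp add: mult_ac)
    finally show ?thesis by (simp only: phi_mult mult.assoc)
  qed
  moreover have "(\<lambda>x. \<Sum>k\<in>S. \<Sum>l\<in>S'. (c k * c' l * ?K) * phi (k + l) x) \<in> trig_space UNIV"
    by (intro trig_space_sum trig_space_cmult trig_space_phi) simp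
  ultimately show ?thesis by simp
qed

lemma trig_space_const: "(\<lambda>x. a) \<in> trig_space (UNIV :: (int^'d) set)"
proof -
  let ?K = "complex_of_real ((2 * pi) powr (- real CARD('d) / 2))"
  have "(\<lambda>x. (a / ?K) * phi (0 :: int^'d) x) \<in> trig_space UNIV"
    by (intro trig_space_cmult trig_space_phi) simp
  then show ?thesis by (simp add: phi_def)
qed

lemma trig_space_power:
  "v \<in> trig_space (UNIV :: (int^'d) set) \<Longrightarrow> (\<lambda>x. v x ^ n) \<in> trig_space UNIV"
  by (induction n) (auto intro: trig_space_const trig_space_mult)

lemma trig_space_prod:
  "(\<And>i. i \<in> I \<Longrightarrow> v i \<in> trig_space (UNIV :: (int^'d) set)) \<Longrightarrow> (\<lambda>x. \<Prod>i\<in>I. v i x) \<in> trig_space UNIV"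
  by (induction I rule: infinite_finite_induct) (auto intro: trig_space_const trig_space_mult)

lemma trig_space_cos: "(\<lambda>x. of_real (cos (x $ i - a))) \<in> trig_space (UNIV :: (int^'d) set)"
proof -
  let ?K = "complex_of_real ((2 * pi) powr (- real CARD('d) / 2))"
  have lat1: "lat (axis i n) \<bullet> x = real_of_int n * x $ i" for n and x :: "real^'d"
  proof -
    have "lat (axis i n) = axis i (real_of_int n)" by (auto simp: vec_eq_iff axis_def)
    then show ?thesis by (simp add: inner_axis')
  qed
  have K: "?K \<noteq> 0" by simp
  have "of_real (cos (x $ i - a)) = (exp (- (\<i> * of_real a)) / (2 * ?K)) * phi (axis i 1) x
      + (exp (\<i> * of_real a) / (2 * ?K)) * phi (axis i (- 1)) x" for x :: "real^'d"
  proof -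
    have "(exp (- (\<i> * of_real a)) / (2 * ?K)) * phi (axis i 1) x
      + (exp (\<i> * of_real a) / (2 * ?K)) * phi (axis i (- 1)) x
      = (exp (- (\<i> * of_real a)) * exp (\<i> * of_real (x $ i))
      + exp (\<i> * of_real a) * exp (\<i> * of_real (- (x $ i)))) / 2"
      using K by (simp add: phi_def lat1 field_simps)
    also have "\<dots> = (exp (\<i> * of_real (x $ i - a)) + exp (- (\<i> * of_real (x $ i - a)))) / 2"
      by (simp add: exp_add[symmetric] algebra_simps)
    also have "\<dots> = of_real (cos (x $ i - a))"
      by (simp only: cos_exp_eq[symmetric] cos_of_real)
    finally show ?thesis by simp
  qed
  moreover have "(\<lambda>x. (exp (- (\<i> * of_real a)) / (2 * ?K)) * phi (axis i 1) x
      + (exp (\<i> * of_real a) / (2 * ?K)) * phi (axis i (- 1)) x) \<in> trig_space (UNIV :: (int^'d) set)"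
    by (intro trig_space_add trig_space_cmult trig_space_phi) auto
  ultimately show ?thesis by simp
qed

lemma square_int_trig_space: "v \<in> trig_space \<Lambda> \<Longrightarrow> square_int v"
  unfolding trig_space_def by auto

section \<open>Density of the trigonometric polynomials in L2\<close>

definition l2sq :: "(real^'d \<Rightarrow> complex) \<Rightarrow> real" where
  "l2sq v = integral\<^sup>L cellM (\<lambda>x. (cmod (v x))\<^sup>2)"

text \<open>Square-integrable functions in the $L^2$ closure of the trigonometric polynomials.\<close>

definition trig_approximable :: "(real^'d \<Rightarrow> complex) \<Rightarrow> bool" where
  "trig_approximable v \<longleftrightarrow> square_int v \<and> (\<forall>e>0. \<exists>T\<in>trig_space UNIV. l2sq (\<lambda>x. v x - T x) < e)"

lemma l2sq_nonneg [simp]: "0 \<le> l2sq v"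
  by (simp add: l2sq_def)

lemma l2sq_cmult: "l2sq (\<lambda>x. c * v x) = (cmod c)\<^sup>2 * l2sq v"
  by (simp add: l2sq_def norm_mult power_mult_distrib)

lemma l2sq_add_le:
  assumes "square_int v" "square_int w"
  shows "l2sq (\<lambda>x. v x + w x) \<le> 2 * l2sq v + 2 * l2sq w"
proof -
  have "l2sq (\<lambda>x. v x + w x) \<le> integral\<^sup>L cellM (\<lambda>x. 2 * (cmod (v x))\<^sup>2 + 2 * (cmod (w x))\<^sup>2)"
    unfolding l2sq_def
  proof (rule integral_mono)
    show "integrable cellM (\<lambda>x. (cmod (v x + w x))\<^sup>2)"
      using square_int_add[OF assms] by (simp add: square_int_def)
    show "integrable cellM (\<lambda>x. 2 * (cmod (v x))\<^sup>2 + 2 * (cmod (w x))\<^sup>2)"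
      using assms by (simp add: square_int_def)
    show "(cmod (v x + w x))\<^sup>2 \<le> 2 * (cmod (v x))\<^sup>2 + 2 * (cmod (w x))\<^sup>2" for x
    proof -
      have "(cmod (v x + w x))\<^sup>2 \<le> (cmod (v x) + cmod (w x))\<^sup>2"
        by (intro power_mono norm_triangle_ineq) auto
      also have "\<dots> \<le> 2 * (cmod (v x))\<^sup>2 + 2 * (cmod (w x))\<^sup>2"
        using sum_squares_bound[of "cmod (v x)" "cmod (w x)"]
        unfolding power2_sum by linarith
      finally show ?thesis .
    qed
  qed
  also have "\<dots> = 2 * l2sq v + 2 * l2sq w"
    using assms by (simp add: l2sq_def square_int_def)
  finally show ?thesis .
qed

lemma trig_approximable_square_int: "trig_approximable v \<Longrightarrow> square_int v"
  by (simp add: trig_approximable_def)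

lemma trig_approximable_trig: "v \<in> trig_space UNIV \<Longrightarrow> trig_approximable v"
  unfolding trig_approximable_def by (auto simp: square_int_trig_space l2sq_def intro!: bexI[of _ v])

lemma trig_approximable_closed:
  assumes v: "square_int v" and lim: "\<And>e. e > 0 \<Longrightarrow> \<exists>w. trig_approximable w \<and> l2sq (\<lambda>x. v x - w x) < e"
  shows "trig_approximable v"
  unfolding trig_approximable_def
proof (intro conjI allI impI v)
  fix e :: real assume e: "e > 0"
  obtain w where w: "trig_approximable w" "l2sq (\<lambda>x. v x - w x) < e / 4" using lim[of "e / 4"] e by auto
  then obtain T where T: "T \<in> trig_space UNIV" "l2sq (\<lambda>x. w x - T x) < e / 4"
    using e unfolding trig_approximable_def by (meson divide_pos_pos zero_less_numeral)
  have "l2sq (\<lambda>x. (v x - w x) + (w x - T x)) \<le> 2 * l2sq (\<lambda>x. v x - w x) + 2 * l2sq (\<lambda>x. w x - T x)"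
    using v w T by (intro l2sq_add_le square_int_diff) (auto simp: trig_approximable_square_int square_int_trig_space)
  then have "l2sq (\<lambda>x. v x - T x) < e" using w T by simp
  then show "\<exists>T\<in>trig_space UNIV. l2sq (\<lambda>x. v x - T x) < e" using T by blast
qed

lemma trig_approximable_add:
  assumes "trig_approximable v" "trig_approximable w"
  shows "trig_approximable (\<lambda>x. v x + w x)"
  unfolding trig_approximable_def
proof (intro conjI allI impI)
  show "square_int (\<lambda>x. v x + w x)" using assms by (intro square_int_add trig_approximable_square_int)
  fix e :: real assume e: "e > 0"
  obtain T where T: "T \<in> trig_space UNIV" "l2sq (\<lambda>x. v x - T x) < e / 4"
    using e assms(1) unfolding trig_approximable_def by (meson divide_pos_pos zero_less_numeral)
  obtain U where U: "U \<in> trig_space UNIV" "l2sq (\<lambda>x. w x - U x) < e / 4"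
    using e assms(2) unfolding trig_approximable_def by (meson divide_pos_pos zero_less_numeral)
  have "l2sq (\<lambda>x. (v x - T x) + (w x - U x)) \<le> 2 * l2sq (\<lambda>x. v x - T x) + 2 * l2sq (\<lambda>x. w x - U x)"
    using assms U T by (intro l2sq_add_le square_int_diff) (auto simp: trig_approximable_square_int square_int_trig_space)
  then have "l2sq (\<lambda>x. (v x + w x) - (T x + U x)) < e" using U T by (simp add: algebra_simps)
  then show "\<exists>T\<in>trig_space UNIV. l2sq (\<lambda>x. v x + w x - T x) < e"
    using trig_space_add[OF T(1) U(1)] by (rule_tac x="\<lambda>x. T x + U x" in bexI) auto
qed

lemma trig_approximable_cmult:
  assumes "trig_approximable v"
  shows "trig_approximable (\<lambda>x. c * v x)"
proof (cases "c = 0")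
  case True
  then show ?thesis using trig_approximable_trig[OF trig_space_zero] by simp
next
  case False
  show ?thesis unfolding trig_approximable_def
  proof (intro conjI allI impI)
    show "square_int (\<lambda>x. c * v x)" using assms by (intro square_int_cmult trig_approximable_square_int)
    fix e :: real assume e: "e > 0"
    then have "e / (cmod c)\<^sup>2 > 0" using False by simp
    then obtain T where T: "T \<in> trig_space UNIV" "l2sq (\<lambda>x. v x - T x) < e / (cmod c)\<^sup>2"
      using assms unfolding trig_approximable_def by meson
    have "l2sq (\<lambda>x. c * v x - c * T x) = (cmod c)\<^sup>2 * l2sq (\<lambda>x. v x - T x)"
      using l2sq_cmult[of c "\<lambda>x. v x - T x"] by (simp add: right_diff_distrib)
    also have "\<dots> < e" using T(2) False by (simp add: field_simps)
    finally show "\<exists>T\<in>trig_space UNIV. l2sq (\<lambda>x. c * v x - T x) < e"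
      using trig_space_cmult[OF T(1), of c] by (rule_tac x="\<lambda>x. c * T x" in bexI) auto
  qed
qed

lemma trig_approximable_sum:
  "(\<And>i. i \<in> I \<Longrightarrow> trig_approximable (v i)) \<Longrightarrow> trig_approximable (\<lambda>x. \<Sum>i\<in>I. v i x)"
  by (induction I rule: infinite_finite_induct)
     (auto intro: trig_approximable_add trig_approximable_trig trig_space_zero)

lemma l2sq_cong_AE:
  assumes "AE x in cellM. v x = w x" "square_int v" "square_int w"
  shows "l2sq v = l2sq w"
  unfolding l2sq_def
  by (rule integral_cong_AE) (use assms in \<open>auto simp: square_int_def elim!: eventually_mono\<close>)

lemma trig_approximable_cong_AE:
  assumes v: "trig_approximable v" and ae: "AE x in cellM. w x = v x" and w: "w \<in> borel_measurable cellM"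
  shows "trig_approximable w"
proof -
  have sv: "square_int v" by (rule trig_approximable_square_int[OF v])
  have "integrable cellM (\<lambda>x. (cmod (w x))\<^sup>2) = integrable cellM (\<lambda>x. (cmod (v x))\<^sup>2)"
    by (rule integrable_cong_AE)
       (use ae w square_int_measurable[OF sv] in \<open>auto elim!: eventually_mono\<close>)
  then have sw: "square_int w" using sv w by (simp add: square_int_def)
  show ?thesis unfolding trig_approximable_def
  proof (intro conjI allI impI sw)
    fix e :: real assume "e > 0"
    then obtain T where T: "T \<in> trig_space UNIV" "l2sq (\<lambda>x. v x - T x) < e"
      using v unfolding trig_approximable_def by meson
    have "l2sq (\<lambda>x. w x - T x) = l2sq (\<lambda>x. v x - T x)"
      by (rule l2sq_cong_AE)
         (use ae sv sw T square_int_trig_space in \<open>auto intro!: square_int_diff elim!: eventually_mono\<close>)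
    with T(2) have "l2sq (\<lambda>x. w x - T x) < e" by linarith
    then show "\<exists>T\<in>trig_space UNIV. l2sq (\<lambda>x. w x - T x) < e" using T(1) by (rule rev_bexI[rotated])
  qed
qed

text \<open>The closure property in the form in which it is applied to indicator functions and to simple functions:
dominated pointwise limits are limits in $L^2$.\<close>

lemma trig_approximable_limit:
  fixes s :: "nat \<Rightarrow> real^'d \<Rightarrow> complex"
  assumes s: "\<And>n. trig_approximable (s n)" and v: "v \<in> borel_measurable cellM"
    and lim: "\<And>x. x \<in> cell \<Longrightarrow> (\<lambda>n. s n x) \<longlonglongrightarrow> v x"
    and bound: "\<And>n x. x \<in> cell \<Longrightarrow> cmod (s n x) \<le> B x" and B: "integrable cellM (\<lambda>x. (B x)\<^sup>2)"
  shows "trig_approximable v"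
proof -
  have sm: "s n \<in> borel_measurable cellM" for n
    using s by (intro square_int_measurable trig_approximable_square_int)
  have vB: "cmod (v x) \<le> B x" if "x \<in> cell" for x
    by (rule LIMSEQ_le_const2[OF tendsto_norm[OF lim[OF that]]]) (use bound that in auto)
  have "(\<lambda>n. integral\<^sup>L cellM (\<lambda>x. (cmod (v x - s n x))\<^sup>2)) \<longlonglongrightarrow> integral\<^sup>L cellM (\<lambda>x :: real^'d. 0 :: real)"
  proof (rule integral_dominated_convergence[where w="\<lambda>x. 4 * (B x)\<^sup>2"])
    show "AE x in cellM. (\<lambda>n. (cmod (v x - s n x))\<^sup>2) \<longlonglongrightarrow> 0"
    proof (rule AE_I2)
      fix x assume "x \<in> space (cellM :: (real^'d) measure)"
      then have "(\<lambda>n. (cmod (v x - s n x))\<^sup>2) \<longlonglongrightarrow> (cmod (v x - v x))\<^sup>2"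
        by (intro tendsto_intros lim) simp
      then show "(\<lambda>n. (cmod (v x - s n x))\<^sup>2) \<longlonglongrightarrow> 0" by simp
    qed
    show "AE x in cellM. norm ((cmod (v x - s n x))\<^sup>2) \<le> 4 * (B x)\<^sup>2" for n
    proof (rule AE_I2)
      fix x assume x: "x \<in> space (cellM :: (real^'d) measure)"
      have "cmod (v x - s n x) \<le> 2 * B x"
        using norm_triangle_ineq4[of "v x" "s n x"] vB[of x] bound[of x n] x by simp
      then have "(cmod (v x - s n x))\<^sup>2 \<le> (2 * B x)\<^sup>2" by (intro power_mono) auto
      then show "norm ((cmod (v x - s n x))\<^sup>2) \<le> 4 * (B x)\<^sup>2" by (simp add: power_mult_distrib)
    qed
  qed (use v sm B in auto)
  then have conv: "(\<lambda>n. l2sq (\<lambda>x. v x - s n x)) \<longlonglongrightarrow> 0"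
    by (simp add: l2sq_def)
  have sv: "square_int v" unfolding square_int_def
  proof
    show "integrable cellM (\<lambda>x. (cmod (v x))\<^sup>2)"
    proof (rule Bochner_Integration.integrable_bound[OF B])
      show "AE x in cellM. norm ((cmod (v x))\<^sup>2) \<le> norm ((B x)\<^sup>2)"
        using vB by (auto intro!: power_mono)
    qed (use v in measurable)
  qed (fact v)
  show ?thesis
  proof (rule trig_approximable_closed[OF sv])
    fix e :: real assume "e > 0"
    then have "\<exists>n. l2sq (\<lambda>x. v x - s n x) < e"
      using order_tendstoD(2)[OF conv, of e] by (auto simp: eventually_sequentially)
    then show "\<exists>w. trig_approximable w \<and> l2sq (\<lambda>x. v x - w x) < e" using s by blast
  qed
qed

text \<open>An interval inside one period is an arc of the circle, and an arc with midpoint $c$ and half-length $h$ is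
a superlevel set of $\cos(\cdot - c)$: points of the period outside it are at distance between $h$ and
$2\pi - h$ from $c$. Thus boxes are described by inequalities between trigonometric polynomials.\<close>

lemma cos_gt_iff_mem_arc:
  fixes a b y :: real
  assumes "0 \<le> a" "a < b" "b \<le> 2 * pi" "0 < y" "y < 2 * pi"
  shows "cos (y - (a + b) / 2) > cos ((b - a) / 2) \<longleftrightarrow> a < y \<and> y < b"
proof -
  define h where "h = (b - a) / 2"
  define z where "z = \<bar>y - (a + b) / 2\<bar>"
  have c: "cos (y - (a + b) / 2) = cos z" by (simp add: z_def)
  have h: "0 < h" "h \<le> pi" using assms by (auto simp: h_def)
  have z: "0 \<le> z" "z \<le> 2 * pi - h" using assms by (auto simp: z_def h_def field_simps abs_le_iff)
  have mem: "a < y \<and> y < b \<longleftrightarrow> z < h"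
    by (auto simp: z_def h_def abs_less_iff field_simps)
  have "cos h < cos z" if "z < h"
    using cos_monotone_0_pi[of z h] z h that by simp
  moreover have "cos z \<le> cos h" if "h \<le> z"
  proof (cases "z \<le> pi")
    case True
    then show ?thesis using cos_monotone_0_pi_le[of h z] h that by simp
  next
    case False
    then have "cos (2 * pi - z) \<le> cos h"
      using cos_monotone_0_pi_le[of h "2 * pi - z"] h z by simp
    then show ?thesis by (simp add: cos_diff)
  qed
  ultimately show ?thesis
    unfolding c mem h_def[symmetric] by (meson not_le)
qed

text \<open>The ramps $\max(0, \min(1, n (y - \tau)))$ converge to the jump at $\tau$ and lie between 0 and 1;
Bernstein polynomials within distance $1/(n+1)$ of them inherit the limit and the bound 2.\<close>

lemma polynomial_approx_step:
  fixes \<tau> :: real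
  shows "\<exists>p :: nat \<Rightarrow> real \<Rightarrow> real.
     (\<forall>n (s :: real^'d \<Rightarrow> real). (\<lambda>x. complex_of_real (s x)) \<in> trig_space UNIV \<longrightarrow>
          (\<lambda>x. complex_of_real (p n (s x))) \<in> trig_space UNIV) \<and>
     (\<forall>n. \<forall>y\<in>{0..1}. \<bar>p n y\<bar> \<le> 2) \<and>
     (\<forall>y\<in>{0..1}. (\<lambda>n. p n y) \<longlonglongrightarrow> (if \<tau> < y then 1 else 0))"
proof -
  define f where "f = (\<lambda>(n::nat) y. max 0 (min 1 (real n * (y - \<tau>))))"
  have "continuous_on {0..1} (f n)" for n
    unfolding f_def by (intro continuous_intros)
  then have "\<exists>N. \<forall>m y. N \<le> m \<and> y \<in> {0..1} \<longrightarrow>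
      \<bar>f n y - (\<Sum>k\<le>m. f n (k/m) * Bernstein m k y)\<bar> < 1 / real (Suc n)" for n
    by (intro Bernstein_Weierstrass) auto
  then obtain N where N: "\<And>n y. y \<in> {0..1} \<Longrightarrow>
      \<bar>f n y - (\<Sum>k\<le>N n. f n (k/N n) * Bernstein (N n) k y)\<bar> < 1 / real (Suc n)"
    by (metis order_refl)
  define p where "p = (\<lambda>n y. \<Sum>k\<le>N n. f n (k/N n) * Bernstein (N n) k y)"
  have close: "\<bar>f n y - p n y\<bar> < 1 / real (Suc n)" if "y \<in> {0..1}" for n y
    using N[OF that] by (simp add: p_def)
  have 1: "(\<lambda>x. complex_of_real (p n (s x))) \<in> trig_space UNIV"
    if s: "(\<lambda>x. complex_of_real (s x)) \<in> trig_space UNIV" for n and s :: "real^'d \<Rightarrow> real"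
  proof -
    have "(\<lambda>x. 1 - complex_of_real (s x)) \<in> trig_space UNIV"
      by (intro trig_space_diff trig_space_const s)
    then show ?thesis
      unfolding p_def Bernstein_def of_real_sum of_real_mult of_real_power of_real_diff of_real_1
      by (intro trig_space_sum trig_space_mult trig_space_const trig_space_power s)
  qed
  have f01: "0 \<le> f n y" "f n y \<le> 1" for n y by (auto simp: f_def)
  have 2: "\<bar>p n y\<bar> \<le> 2" if "y \<in> {0..1}" for n y
  proof -
    have "1 / real (Suc n) \<le> 1" by simp
    then show ?thesis using close[OF that, of n] f01[of n y] by linarith
  qed
  have 3: "(\<lambda>n. p n y) \<longlonglongrightarrow> (if \<tau> < y then 1 else 0)" if y: "y \<in> {0..1}" for y
  proof -
    have "(\<lambda>n. f n y) \<longlonglongrightarrow> (if \<tau> < y then 1 else 0)"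
    proof (cases "\<tau> < y")
      case True
      obtain M :: nat where M: "1 / (y - \<tau>) < real M" using reals_Archimedean2 by blast
      have "f n y = 1" if "n \<ge> M" for n
      proof -
        have "1 < real M * (y - \<tau>)" using M True by (simp add: field_simps)
        also have "\<dots> \<le> real n * (y - \<tau>)" using that True by (intro mult_right_mono) auto
        finally show ?thesis by (simp add: f_def)
      qed
      then have "eventually (\<lambda>n. f n y = 1) sequentially"
        by (auto simp: eventually_sequentially)
      then show ?thesis using True by (simp add: tendsto_eventually)
    next
      case False
      have "f n y = 0" for n
      proof -
        have "real n * (y - \<tau>) \<le> 0" using False by (intro mult_nonneg_nonpos) auto
        then show ?thesis by (simp add: f_def)
      qed
      then show ?thesis using False by simp
    qed
    moreover have "(\<lambda>n. f n y - p n y) \<longlonglongrightarrow> 0"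
    proof (rule Lim_null_comparison[OF _ LIMSEQ_inverse_real_of_nat])
      show "eventually (\<lambda>n. norm (f n y - p n y) \<le> inverse (real (Suc n))) sequentially"
        using close[OF y] by (intro always_eventually) (auto simp: inverse_eq_divide less_imp_le)
    qed
    ultimately have "(\<lambda>n. f n y - (f n y - p n y)) \<longlonglongrightarrow> (if \<tau> < y then 1 else 0) - 0"
      by (rule tendsto_diff)
    then show ?thesis by simp
  qed
  show ?thesis using 1 2 3 by blast
qed

lemma arc_indicator_limit:
  fixes i :: "'d::finite"
  assumes "0 \<le> a" "a < b" "b \<le> 2 * pi"
  shows "\<exists>P :: nat \<Rightarrow> real^'d \<Rightarrow> real.
     (\<forall>n. (\<lambda>x. complex_of_real (P n x)) \<in> trig_space UNIV) \<and>
     (\<forall>n x. \<bar>P n x\<bar> \<le> 2) \<and>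
     (\<forall>x\<in>cell. (\<lambda>n. P n x) \<longlonglongrightarrow> (if a < x $ i \<and> x $ i < b then 1 else 0))"
proof -
  define s where "s = (\<lambda>x :: real^'d. (1 + cos (x $ i - (a + b) / 2)) / 2)"
  define \<tau> where "\<tau> = (1 + cos ((b - a) / 2)) / 2"
  obtain p where p: "\<And>n (s :: real^'d \<Rightarrow> real). (\<lambda>x. complex_of_real (s x)) \<in> trig_space UNIV \<Longrightarrow>
          (\<lambda>x. complex_of_real (p n (s x))) \<in> trig_space UNIV"
     "\<And>n y. y\<in>{0..1} \<Longrightarrow> \<bar>p n y\<bar> \<le> (2::real)"
     "\<And>y. y\<in>{0..1} \<Longrightarrow> (\<lambda>n. p n y) \<longlonglongrightarrow> (if \<tau> < y then 1 else 0)"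
    using polynomial_approx_step[where 'd='d, of \<tau>] by blast
  have "(\<lambda>x :: real^'d. (1/2) * (1 + complex_of_real (cos (x $ i - (a + b) / 2)))) \<in> trig_space UNIV"
    by (intro trig_space_cmult trig_space_add trig_space_const trig_space_cos)
  then have s: "(\<lambda>x. complex_of_real (s x)) \<in> trig_space UNIV"
    by (simp add: s_def)
  have half: "(1 + c) / 2 \<in> {0..1}" if "- 1 \<le> c" "c \<le> 1" for c :: real
    using that by simp
  have s01: "s x \<in> {0..1}" for x
    unfolding s_def by (intro half cos_ge_minus_one cos_le_one)
  have "\<tau> < s x \<longleftrightarrow> a < x $ i \<and> x $ i < b" if "x \<in> cell" for x
    using cos_gt_iff_mem_arc[OF assms, of "x $ i"] that
    by (simp add: \<tau>_def s_def mem_cell)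
  then have "(\<lambda>n. p n (s x)) \<longlonglongrightarrow> (if a < x $ i \<and> x $ i < b then 1 else 0)" if "x \<in> cell" for x
    using p(3)[OF s01, of x] that by (simp only:)
  then show ?thesis using p(1)[OF s] p(2)[OF s01]
    by (intro exI[of _ "\<lambda>n x. p n (s x)"]) blast
qed

text \<open>The indicator of a box is the product over the coordinates of indicators of arcs, and products of the
trigonometric approximants of the latter converge boundedly.\<close>

lemma trig_approximable_box: "trig_approximable (indicator (box a b) :: real^'d \<Rightarrow> complex)"
proof -
  have bm: "indicator (box a b) \<in> borel_measurable (cellM :: (real^'d) measure)"
    by (intro measurable_cellM_borel borel_measurable_indicator) simp
  define a' where "a' i = max 0 (a $ i)" for i
  define b' where "b' i = min (2 * pi) (b $ i)" for i
  have mem: "x \<in> box a b \<longleftrightarrow> (\<forall>i. a' i < x $ i \<and> x $ i < b' i)" if "x \<in> cell" for x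
    using that by (auto simp: mem_cell mem_box_cart a'_def b'_def)
  show ?thesis
  proof (cases "\<forall>i. a' i < b' i")
    case False
    then have "indicator (box a b) x = (0 :: complex)" if "x \<in> cell" for x
      using mem[OF that] by (auto simp: indicator_def) (meson less_trans)
    then have "AE x in cellM. indicator (box a b) x = (0 :: complex)" by auto
    from trig_approximable_cong_AE[OF trig_approximable_trig[OF trig_space_zero] this bm] show ?thesis .
  next
    case True
    have "\<exists>P :: nat \<Rightarrow> real^'d \<Rightarrow> real.
     (\<forall>n. (\<lambda>x. complex_of_real (P n x)) \<in> trig_space UNIV) \<and>
     (\<forall>n x. \<bar>P n x\<bar> \<le> 2) \<and>
     (\<forall>x\<in>cell. (\<lambda>n. P n x) \<longlonglongrightarrow> (if a' i < x $ i \<and> x $ i < b' i then 1 else 0))" for i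
      using True by (intro arc_indicator_limit) (auto simp: a'_def b'_def)
    then obtain P where P: "\<And>i n. (\<lambda>x. complex_of_real (P i n x)) \<in> trig_space (UNIV :: (int^'d) set)"
     "\<And>i n x. \<bar>P i n x\<bar> \<le> 2"
     "\<And>i x. x \<in> cell \<Longrightarrow> (\<lambda>n. P i n x) \<longlonglongrightarrow> (if a' i < x $ i \<and> x $ i < b' i then 1 else 0)"
      by metis
    let ?s = "\<lambda>n x. \<Prod>i\<in>UNIV. complex_of_real (P i n x)"
    show ?thesis
    proof (rule trig_approximable_limit[where s="?s" and B="\<lambda>x. 2 ^ CARD('d)"])
      show "trig_approximable (?s n)" for n
        by (intro trig_approximable_trig trig_space_prod P)
      show "(\<lambda>n. ?s n x) \<longlonglongrightarrow> indicator (box a b) x" if "x \<in> cell" for x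
      proof -
        have "(\<lambda>n. ?s n x) \<longlonglongrightarrow> (\<Prod>i\<in>UNIV. complex_of_real (if a' i < x $ i \<and> x $ i < b' i then 1 else 0))"
          by (intro tendsto_prod tendsto_of_real P that)
        also have "(\<Prod>i\<in>UNIV. complex_of_real (if a' i < x $ i \<and> x $ i < b' i then 1 else 0))
            = indicator (box a b) x"
          by (auto simp: indicator_def mem[OF that] intro!: prod_zero)
        finally show ?thesis .
      qed
      show "cmod (?s n x) \<le> 2 ^ CARD('d)" for n x
      proof -
        have "cmod (?s n x) = (\<Prod>i\<in>UNIV. \<bar>P i n x\<bar>)" by (simp add: prod_norm[symmetric])
        also have "\<dots> \<le> (\<Prod>i\<in>(UNIV :: 'd set). 2)" by (intro prod_mono) (simp add: P)
        finally show ?thesis by simp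
      qed
      show "integrable cellM (\<lambda>x :: real^'d. (2 ^ CARD('d) :: real)\<^sup>2)"
        by (rule finite_measure.integrable_const[OF finite_measure_cellM])
    qed (fact bm)
  qed
qed

text \<open>Sets with approximable indicator form a Dynkin system, and the boxes are a generator closed under
intersection.\<close>

lemma trig_approximable_indicator_borel:
  assumes "A \<in> sets borel"
  shows "trig_approximable (indicator A :: real^'d \<Rightarrow> complex)"
proof -
  let ?G = "range (\<lambda>(a, b). box a b :: (real^'d) set)"
  have borel: "sets borel = sigma_sets UNIV ?G"
    by (subst borel_eq_box) (simp add: sets_measure_of)
  have m: "(indicator B :: real^'d \<Rightarrow> complex) \<in> borel_measurable cellM" if "B \<in> sigma_sets UNIV ?G" for B
    using that by (intro measurable_cellM_borel borel_measurable_indicator) (simp add: borel)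
  have "Int_stable ?G" by (auto simp: Int_stable_def box_Int_box)
  moreover have "?G \<subseteq> Pow UNIV" by simp
  moreover have "A \<in> sigma_sets UNIV ?G" using assms by (simp add: borel)
  ultimately show ?thesis
  proof (induction rule: sigma_sets_induct_disjoint)
    case (basic A)
    then show ?case by (auto intro: trig_approximable_box)
  next
    case empty
    then show ?case using trig_approximable_trig[OF trig_space_zero] by (simp add: indicator_def[abs_def])
  next
    case (compl A)
    have "trig_approximable (\<lambda>x. 1 + (-1) * indicator A x :: complex)"
      by (intro trig_approximable_add trig_approximable_cmult compl trig_approximable_trig trig_space_const)
    moreover have "(\<lambda>x. 1 + (-1) * indicator A x :: complex) = indicator (UNIV - A)"
      by (auto simp: indicator_def)
    ultimately show ?case by simp
  next
    case (union A)
    show ?case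
    proof (rule trig_approximable_limit[where s="\<lambda>n x. \<Sum>i<n. indicator (A i) x" and B="\<lambda>x. 1"])
      show "trig_approximable (\<lambda>x. \<Sum>i<n. indicator (A i) x :: complex)" for n
        by (intro trig_approximable_sum union)
      have part: "(\<Sum>i<n. indicator (A i) x) = (indicator (\<Union>i<n. A i) x :: complex)" for n x
        using union(1) by (subst indicator_UN_disjoint) (auto simp: disjoint_family_on_def)
      show "(\<lambda>n. \<Sum>i<n. indicator (A i) x :: complex) \<longlonglongrightarrow> indicator (\<Union>i. A i) x" for x
        unfolding part by (rule LIMSEQ_indicator_UN)
      show "cmod (\<Sum>i<n. indicator (A i) x) \<le> 1" for n x
        unfolding part by (simp add: indicator_def)
      show "integrable cellM (\<lambda>x :: real^'d. 1\<^sup>2 :: real)"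
        by (rule finite_measure.integrable_const[OF finite_measure_cellM])
      have "(\<Union>i. A i) \<in> sigma_sets UNIV ?G" using union(2) by (intro sigma_sets.Union) auto
      then show "(indicator (\<Union>i. A i) :: _ \<Rightarrow> complex) \<in> borel_measurable (cellM :: (real^'d) measure)" by (rule m)
    qed
  qed
qed

lemma trig_approximable_indicator:
  assumes "A \<in> sets (cellM :: (real^'d) measure)"
  shows "trig_approximable (indicator A :: real^'d \<Rightarrow> complex)"
proof -
  have "A \<in> sets lebesgue" using assms by (auto simp: sets_restrict_space)
  then obtain S N N' where A: "A = S \<union> N" "N \<subseteq> N'" "N' \<in> null_sets lborel" "S \<in> sets lborel"
    by (rule sets_completionE)
  have "N' \<in> null_sets lebesgue" using A(3) by (rule null_sets_completionI)
  then have "AE x in lebesgue. x \<notin> N'" by (rule AE_not_in)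
  then have "AE x in cellM. x \<notin> N'" by (subst AE_restrict_space_iff) (auto elim!: eventually_mono)
  then have ae: "AE x in cellM. indicator A x = (indicator S x :: complex)"
    using A by (auto simp: indicator_def elim!: eventually_mono)
  show ?thesis
    by (rule trig_approximable_cong_AE[OF trig_approximable_indicator_borel ae]) (use A assms in auto)
qed

lemma square_int_trig_approximable:
  fixes v :: "real^'d \<Rightarrow> complex"
  assumes "square_int v"
  shows "trig_approximable v"
proof -
  obtain F where F0: "\<forall>i. simple_function cellM (F i)" "\<forall>x\<in>space cellM. (\<lambda>i. F i x) \<longlonglongrightarrow> v x"
    "\<forall>i. \<forall>x\<in>space cellM. dist (F i x) 0 \<le> 2 * dist (v x) 0"
    using borel_measurable_implies_sequence_metric[OF square_int_measurable[OF assms], of 0] by blast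
  have F: "\<And>i. simple_function cellM (F i)" "\<And>x. x \<in> cell \<Longrightarrow> (\<lambda>i. F i x) \<longlonglongrightarrow> v x"
    "\<And>i x. x \<in> cell \<Longrightarrow> cmod (F i x) \<le> 2 * cmod (v x)"
    using F0 by auto
  show ?thesis
  proof (rule trig_approximable_limit[where s=F and B="\<lambda>x. 2 * cmod (v x)"])
    show "integrable cellM (\<lambda>x. (2 * cmod (v x))\<^sup>2)"
      using assms by (simp add: power_mult_distrib square_int_def)
    show "trig_approximable (F n)" for n
    proof (rule trig_approximable_cong_AE)
      let ?A = "\<lambda>y. F n -` {y} \<inter> cell"
      have fin: "finite (F n ` cell)" and meas: "\<And>y. y \<in> F n ` cell \<Longrightarrow> ?A y \<in> sets cellM"
        using F(1)[of n] by (auto simp: simple_function_def)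
      show "trig_approximable (\<lambda>x. \<Sum>y\<in>F n ` cell. y * indicator (?A y) x)"
        by (intro trig_approximable_sum trig_approximable_cmult trig_approximable_indicator meas)
      show "AE x in cellM. F n x = (\<Sum>y\<in>F n ` cell. y * indicator (?A y) x)"
      proof (rule AE_I2)
        fix x assume x: "x \<in> space (cellM :: (real^'d) measure)"
        have "(\<Sum>y\<in>F n ` cell. y * indicator (?A y) x) = (\<Sum>y\<in>F n ` cell. if y = F n x then y else 0)"
          by (rule sum.cong) (use x in \<open>auto simp: indicator_def\<close>)
        then show "F n x = (\<Sum>y\<in>F n ` cell. y * indicator (?A y) x)"
          using fin x by simp
      qed
      show "F n \<in> borel_measurable cellM" using F(1) by (rule borel_measurable_simple_function)
    qed
  qed (use F assms square_int_measurable in auto)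
qed

section \<open>Parseval's identity\<close>

text \<open>Bessel's inequality bounds the sum by the integral. Conversely, approximating $v$ by a trigonometric
polynomial with error $e$ in the squared norm shows that finitely many coefficients exhaust the integral
up to $e$.\<close>

lemma parseval:
  assumes "square_int v"
  shows "(\<lambda>k. (cmod (fcoeff v k))\<^sup>2) summable_on UNIV" "(\<Sum>\<^sub>\<infinity>k. (cmod (fcoeff v k))\<^sup>2) = l2sq v"
proof -
  have upper: "(\<Sum>k\<in>S. (cmod (fcoeff v k))\<^sup>2) \<le> l2sq v" if "finite S" for S
    using best_approximation[OF assms that, of "fcoeff v"]
      l2sq_nonneg[of "\<lambda>x. v x - (\<Sum>k\<in>S. fcoeff v k * phi k x)"]
    by (simp add: l2sq_def)
  have lower: "\<exists>S. finite S \<and> l2sq v - e < (\<Sum>k\<in>S. (cmod (fcoeff v k))\<^sup>2)" if e: "e > 0" for e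
  proof -
    obtain T where "T \<in> trig_space UNIV" "l2sq (\<lambda>x. v x - T x) < e"
      using square_int_trig_approximable[OF assms] e unfolding trig_approximable_def by meson
    then obtain c S where S: "finite S" and *: "l2sq (\<lambda>x. v x - (\<Sum>k\<in>S. c k * phi k x)) < e"
      unfolding trig_space_def by blast
    have "0 \<le> (\<Sum>k\<in>S. (cmod (fcoeff v k - c k))\<^sup>2)" by (simp add: sum_nonneg)
    then have "l2sq v - e < (\<Sum>k\<in>S. (cmod (fcoeff v k))\<^sup>2)"
      using best_approximation[OF assms S, of c] * unfolding l2sq_def by linarith
    then show ?thesis using S by blast
  qed
  show summ: "(\<lambda>k. (cmod (fcoeff v k))\<^sup>2) summable_on UNIV"
    by (rule nonneg_bdd_above_summable_on) (use upper in \<open>auto intro!: bdd_aboveI\<close>)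
  have "(\<Sum>\<^sub>\<infinity>k. (cmod (fcoeff v k))\<^sup>2) \<le> l2sq v"
    by (rule infsum_le_finite_sums[OF summ upper])
  moreover have "l2sq v \<le> (\<Sum>\<^sub>\<infinity>k. (cmod (fcoeff v k))\<^sup>2) + e" if e: "e > 0" for e
  proof -
    obtain S where S: "finite S" "l2sq v - e < (\<Sum>k\<in>S. (cmod (fcoeff v k))\<^sup>2)" using lower[OF e] by blast
    have "(\<Sum>k\<in>S. (cmod (fcoeff v k))\<^sup>2) \<le> (\<Sum>\<^sub>\<infinity>k. (cmod (fcoeff v k))\<^sup>2)"
      by (rule finite_sum_le_infsum[OF summ S(1)]) auto
    then show ?thesis using S(2) by linarith
  qed
  then have "l2sq v \<le> (\<Sum>\<^sub>\<infinity>k. (cmod (fcoeff v k))\<^sup>2)" by (rule field_le_epsilon)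
  ultimately show "(\<Sum>\<^sub>\<infinity>k. (cmod (fcoeff v k))\<^sup>2) = l2sq v" by simp
qed

lemma AE_zero_if_fcoeff_zero:
  assumes "square_int v" "\<And>k. fcoeff v k = 0"
  shows "AE x in cellM. v x = 0"
proof -
  have "integral\<^sup>L cellM (\<lambda>x. (cmod (v x))\<^sup>2) = 0"
    using parseval(2)[OF assms(1)] assms(2) by (simp add: l2sq_def)
  then have "AE x in cellM. (cmod (v x))\<^sup>2 = 0"
    using assms(1) by (subst (asm) integral_nonneg_eq_0_iff_AE) (auto simp: square_int_def)
  then show ?thesis by simp
qed

section \<open>Integration by parts on the torus\<close>

lemma continuous_bounded_on_cell:
  fixes h :: "real^'d \<Rightarrow> 'b::real_normed_vector"
  assumes "continuous_on UNIV h"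
  obtains B where "0 \<le> B" "\<And>x. x \<in> cbox 0 (\<chi> i. 4 * pi) \<Longrightarrow> norm (h x) \<le> B"
proof -
  have "compact (h ` cbox 0 (\<chi> i. 4 * pi))"
    by (intro compact_continuous_image continuous_on_subset[OF assms]) auto
  then obtain B where B: "\<And>y. y \<in> h ` cbox 0 (\<chi> i. 4 * pi) \<Longrightarrow> norm y \<le> B"
    using compact_imp_bounded bounded_iff by metis
  then have "norm (h x) \<le> max 0 B" if "x \<in> cbox 0 (\<chi> i. 4 * pi)" for x
    using that by (simp add: le_max_iff_disj)
  then show ?thesis by (intro that[of "max 0 B"]) auto
qed

lemma square_int_continuous:
  assumes "continuous_on UNIV v"
  shows "square_int v"
proof -
  obtain B where "\<And>x. x \<in> cbox 0 (\<chi> i. 4 * pi) \<Longrightarrow> cmod (v x) \<le> B"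
    using continuous_bounded_on_cell[OF assms] by blast
  then show ?thesis
    using cell_subset assms
    by (intro square_int_bounded[of v B] measurable_cellM_borel borel_measurable_continuous_onI) auto
qed

lemma integrable_continuous_cell:
  fixes f :: "real^'d \<Rightarrow> complex"
  assumes "continuous_on UNIV f"
  shows "integrable cellM f"
  using square_int_mult_integrable[OF square_int_continuous[OF assms] square_int_continuous[of "\<lambda>_. 1"]] by simp

lemma has_vector_derivative_along_axis:
  assumes "p differentiable (at (x + axis i s))"
  shows "((\<lambda>s. p (x + axis i s)) has_vector_derivative partial i p (x + axis i s)) (at s)"
proof -
  let ?D = "frechet_derivative p (at (x + axis i s))"
  have D: "(p has_derivative ?D) (at (x + axis i s))" using assms by (simp add: frechet_derivative_works)
  have ax: "(\<lambda>s. x + axis i s) = (\<lambda>s. x + s *\<^sub>R axis i (1::real))"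
    by (auto simp: vec_eq_iff axis_def)
  have "((\<lambda>s. x + axis i s) has_derivative (\<lambda>t. t *\<^sub>R axis i 1)) (at s)"
    unfolding ax by (auto intro!: derivative_eq_intros)
  from has_derivative_compose[OF this D]
  have "((\<lambda>s. p (x + axis i s)) has_derivative (\<lambda>t. ?D (t *\<^sub>R axis i 1))) (at s)" .
  moreover have "?D (t *\<^sub>R axis i 1) = t *\<^sub>R partial i p (x + axis i s)" for t
    unfolding partial_def by (rule linear_scale[OF has_derivative_linear[OF D]])
  ultimately show ?thesis by (simp add: has_vector_derivative_def)
qed

text \<open>Mean value estimate along the segment. It is used twice: with a crude $e$ for domination of the
difference quotients and with a small $e$ for their convergence.\<close>

lemma difference_quotient_close:
  assumes p: "\<And>x. p differentiable (at x)" and t: "0 < t"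
    and b: "\<And>s. 0 \<le> s \<Longrightarrow> s \<le> t \<Longrightarrow> cmod (partial i p (x + axis i s) - partial i p x) \<le> e"
  shows "cmod ((p (x + axis i t) - p x) / of_real t - partial i p x) \<le> e"
proof -
  have ax0: "axis i 0 = (0 :: real^'a)" by (auto simp: vec_eq_iff axis_def)
  have "norm (p (x + axis i t) - p (x + axis i 0) - (t - 0) *\<^sub>R partial i p (x + axis i 0)) \<le> norm (t - 0) * e"
  proof (rule vector_differentiable_bound_linearization[where S="{0..t}"])
    show "((\<lambda>s. p (x + axis i s)) has_vector_derivative partial i p (x + axis i s)) (at s within {0..t})" for s
      by (rule has_vector_derivative_at_within[OF has_vector_derivative_along_axis[OF p]])
    show "norm (partial i p (x + axis i s) - partial i p (x + axis i 0)) \<le> e" if "s \<in> {0..t}" for s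
      using b[of s] that by (simp add: ax0)
  qed (use t in \<open>auto simp: closed_segment_eq_real_ivl\<close>)
  then have "cmod (p (x + axis i t) - p x - of_real t * partial i p x) \<le> t * e"
    using t by (simp add: ax0 scaleR_conv_of_real)
  moreover have "(p (x + axis i t) - p x) / of_real t - partial i p x
      = (p (x + axis i t) - p x - of_real t * partial i p x) / of_real t"
    using t by (simp add: field_simps)
  ultimately show ?thesis using t by (simp add: norm_divide divide_le_eq mult.commute)
qed

text \<open>Difference quotients of $p$ in a coordinate direction have integral zero by translation invariance, and
they converge boundedly to the partial derivative.\<close>

lemma integral_partial_zero:
  assumes p: "test_fun p"
  shows "integral\<^sup>L cellM (partial i p) = 0"
proof -
  have per: "periodic p" and diff: "\<And>x. p differentiable (at x)" and cont: "continuous_on UNIV (partial i p)"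
    using p by (auto simp: test_fun_def)
  have contp: "continuous_on UNIV p"
    using diff by (simp add: continuous_at_imp_continuous_on differentiable_imp_continuous_within)
  define t where "t = (\<lambda>n. 1 / real (Suc n))"
  have t: "0 < t n" "t n \<le> 1" for n by (auto simp: t_def)
  define q where "q = (\<lambda>n x. (p (x + axis i (t n)) - p x) / complex_of_real (t n))"
  obtain B where B: "0 \<le> B" "\<And>x. x \<in> cbox 0 (\<chi> i. 4 * pi) \<Longrightarrow> cmod (partial i p x) \<le> B"
    using continuous_bounded_on_cell[OF cont] by blast
  have seg: "x + axis i s \<in> cbox 0 (\<chi> i. 4 * pi)" if "x \<in> cell" "0 \<le> s" "s \<le> 1" for x s
  proof -
    have "0 \<le> (x + axis i s) $ j \<and> (x + axis i s) $ j \<le> 4 * pi" for j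
    proof -
      have "0 < x $ j" "x $ j < 2 * pi" using that by (auto simp: mem_cell)
      moreover have "0 \<le> axis i s $ j" "axis i s $ j \<le> 1" using that by (auto simp: axis_def)
      ultimately show ?thesis using pi_ge_two unfolding vector_add_component by linarith
    qed
    then show ?thesis by (simp add: mem_box_cart)
  qed
  have contshift: "continuous_on UNIV (\<lambda>x. p (x + axis i s))" for s
    by (rule continuous_on_compose2[OF contp]) (auto intro: continuous_intros)
  have "(\<lambda>n. integral\<^sup>L cellM (q n)) \<longlonglongrightarrow> integral\<^sup>L cellM (partial i p)"
  proof (rule integral_dominated_convergence[where w="\<lambda>x. 3 * B"])
    show "partial i p \<in> borel_measurable cellM"
      by (intro measurable_cellM_borel borel_measurable_continuous_onI cont)
    show "q n \<in> borel_measurable cellM" for n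
      unfolding q_def using t[of n]
      by (intro measurable_cellM_borel borel_measurable_continuous_onI continuous_intros contshift contp) auto
    show "integrable cellM (\<lambda>x. 3 * B)"
      by (rule finite_measure.integrable_const[OF finite_measure_cellM])
    show "AE x in cellM. cmod (q n x) \<le> 3 * B" for n
    proof (rule AE_I2)
      fix x :: "real^'a" assume "x \<in> space cellM"
      then have x: "x \<in> cell" by simp
      have x0: "cmod (partial i p x) \<le> B" using B(2) cell_subset x by blast
      have "cmod (q n x - partial i p x) \<le> 2 * B"
        unfolding q_def
      proof (rule difference_quotient_close[OF diff t(1)])
        fix s assume "0 \<le> s" "s \<le> t n"
        then have "cmod (partial i p (x + axis i s)) \<le> B"
          using t(2)[of n] by (intro B(2) seg x) auto
        then show "cmod (partial i p (x + axis i s) - partial i p x) \<le> 2 * B"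
          using x0 norm_triangle_ineq4[of "partial i p (x + axis i s)" "partial i p x"] by linarith
      qed
      then show "cmod (q n x) \<le> 3 * B"
        using x0 norm_triangle_ineq[of "q n x - partial i p x" "partial i p x"] by simp
    qed
    show "AE x in cellM. (\<lambda>n. q n x) \<longlonglongrightarrow> partial i p x"
    proof (rule AE_I2)
      fix x :: "real^'a"
      show "(\<lambda>n. q n x) \<longlonglongrightarrow> partial i p x"
      proof (rule metric_LIMSEQ_I)
        fix e :: real assume e: "0 < e"
        have "\<forall>x. \<forall>e>0. \<exists>d>0. \<forall>x'. dist x' x < d \<longrightarrow> dist (partial i p x') (partial i p x) < e"
          using cont by (simp add: continuous_on_iff)
        then obtain d where d: "d > 0" "\<And>x'. dist x' x < d \<Longrightarrow> dist (partial i p x') (partial i p x) < e / 2"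
          using e by (meson half_gt_zero)
        obtain N where N: "1 / real (Suc N) < d" using nat_approx_posE[OF d(1)] by blast
        have "dist (q n x) (partial i p x) < e" if "n \<ge> N" for n
        proof -
          have tn: "t n < d"
            using N that frac_le[of 1 1 "real (Suc N)" "real (Suc n)"] by (simp add: t_def)
          have "cmod (q n x - partial i p x) \<le> e / 2"
            unfolding q_def
          proof (rule difference_quotient_close[OF diff t(1)])
            fix s assume s: "0 \<le> s" "s \<le> t n"
            have "dist (x + axis i s) x = s" using s by (simp add: dist_norm norm_eq_sqrt_inner inner_axis_axis)
            then show "cmod (partial i p (x + axis i s) - partial i p x) \<le> e / 2"
              using d(2)[of "x + axis i s"] s tn by (simp add: dist_norm)
          qed
          then show ?thesis using e by (simp add: dist_norm)
        qed
        then show "\<exists>N. \<forall>n\<ge>N. dist (q n x) (partial i p x) < e" by blast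
      qed
    qed
  qed
  moreover have "integral\<^sup>L cellM (q n) = 0" for n
  proof -
    have "integral\<^sup>L cellM (q n)
        = (integral\<^sup>L cellM (\<lambda>x. p (x + axis i (t n))) - integral\<^sup>L cellM p) / of_real (t n)"
      unfolding q_def by (simp add: integrable_continuous_cell contshift contp)
    also have "\<dots> = 0"
      using integral_cell_shift[OF contp per, of "t n" i] t[of n] pi_ge_two by simp
    finally show ?thesis .
  qed
  ultimately show ?thesis by (simp add: LIMSEQ_const_iff)
qed

section \<open>The space H1p in terms of Fourier coefficients\<close>

lemma test_fun_continuous:
  assumes "test_fun p"
  shows "continuous_on UNIV p"
  using assms by (simp add: test_fun_def continuous_at_imp_continuous_on differentiable_imp_continuous_within)

lemma frechet_derivative_mult_phi:
  assumes p: "p differentiable (at x)"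
  shows "(\<lambda>x. phi k x * p x) differentiable (at x)"
    "partial i (\<lambda>x. phi k x * p x) x = \<i> * of_int (k $ i) * phi k x * p x + phi k x * partial i p x"
proof -
  have "(p has_derivative frechet_derivative p (at x)) (at x)"
    using p by (simp add: frechet_derivative_works)
  from has_derivative_mult[OF has_derivative_phi this]
  have D: "((\<lambda>x. phi k x * p x) has_derivative
      (\<lambda>h. phi k x * frechet_derivative p (at x) h + \<i> * of_real (lat k \<bullet> h) * phi k x * p x)) (at x)" .
  then show "(\<lambda>x. phi k x * p x) differentiable (at x)" by (auto simp: differentiable_def)
  show "partial i (\<lambda>x. phi k x * p x) x = \<i> * of_int (k $ i) * phi k x * p x + phi k x * partial i p x"
    unfolding partial_def frechet_derivative_at[OF D, symmetric] by (simp add: inner_axis)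
qed

text \<open>The product of a mode with a test function is again a test function, and its partial derivative integrates
to zero: integration by parts without boundary terms.\<close>

lemma weak_gradient_phi: "weak_gradient (phi k) (\<lambda>x. \<chi> i. \<i> * of_int (k $ i) * phi k x)"
  unfolding weak_gradient_def
proof (intro allI conjI impI)
  fix i
  show "square_int (\<lambda>x. (\<chi> i. \<i> * of_int (k $ i) * phi k x) $ i)"
    by (simp add: square_int_cmult)
  fix p :: "real^'a \<Rightarrow> complex" assume p: "test_fun p"
  then have per: "periodic p" and diff: "\<And>x. p differentiable (at x)" and cont: "\<And>i. continuous_on UNIV (partial i p)"
    by (auto simp: test_fun_def)
  have part: "partial j (\<lambda>x. phi k x * p x)
      = (\<lambda>x. \<i> * of_int (k $ j) * phi k x * p x + phi k x * partial j p x)" for j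
    by (rule ext) (rule frechet_derivative_mult_phi[OF diff])
  have "test_fun (\<lambda>x. phi k x * p x)"
    unfolding test_fun_def part
    using per periodic_phi[of k]
    by (auto simp: periodic_def intro!: frechet_derivative_mult_phi diff continuous_intros cont test_fun_continuous[OF p])
  then have "0 = integral\<^sup>L cellM (\<lambda>x. \<i> * of_int (k $ i) * phi k x * p x + phi k x * partial i p x)"
    using integral_partial_zero[of "\<lambda>x. phi k x * p x" i] by (simp add: part)
  also have "\<dots> = integral\<^sup>L cellM (\<lambda>x. \<i> * of_int (k $ i) * phi k x * p x)
      + integral\<^sup>L cellM (\<lambda>x. phi k x * partial i p x)"
    by (intro Bochner_Integration.integral_add integrable_continuous_cell continuous_intros cont test_fun_continuous[OF p])
  finally show "integral\<^sup>L cellM (\<lambda>x. phi k x * partial i p x)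
      = - integral\<^sup>L cellM (\<lambda>x. (\<chi> i. \<i> * of_int (k $ i) * phi k x) $ i * p x)"
    by (simp add: eq_neg_iff_add_eq_0 add.commute)
qed

lemma integrable_mult_partial:
  assumes "square_int v" "test_fun p"
  shows "integrable cellM (\<lambda>x. v x * partial i p x)" "integrable cellM (\<lambda>x. v x * p x)"
proof -
  have "square_int (\<lambda>x. cnj (partial i p x))" "square_int (\<lambda>x. cnj (p x))"
    using assms(2) test_fun_continuous[OF assms(2)]
    by (auto simp: test_fun_def intro!: square_int_continuous continuous_intros)
  from this[THEN square_int_mult_integrable[OF assms(1)]]
  show "integrable cellM (\<lambda>x. v x * partial i p x)" "integrable cellM (\<lambda>x. v x * p x)" by simp_all
qed

lemma weak_gradient_add:
  assumes "square_int v" "square_int w" "weak_gradient v g" "weak_gradient w h"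
  shows "weak_gradient (\<lambda>x. v x + w x) (\<lambda>x. g x + h x)"
  using assms unfolding weak_gradient_def
  by (auto simp: square_int_add distrib_right integrable_mult_partial)

lemma weak_gradient_cmult:
  assumes "weak_gradient v g"
  shows "weak_gradient (\<lambda>x. c * v x) (\<lambda>x. c *s g x)"
  using assms unfolding weak_gradient_def
  by (auto simp: square_int_cmult mult.assoc)

lemma weak_gradient_zero: "weak_gradient (\<lambda>x. 0) (\<lambda>x. 0)"
  by (simp add: weak_gradient_def)

lemma H1p_square_int: "v \<in> H1p \<Longrightarrow> square_int v"
  by (simp add: H1p_def)

lemma weak_gradient_grad: "v \<in> H1p \<Longrightarrow> weak_gradient v (grad v)"
  unfolding grad_def H1p_def by (auto simp: some_eq_ex)

lemma H1pI: "periodic v \<Longrightarrow> square_int v \<Longrightarrow> weak_gradient v g \<Longrightarrow> v \<in> H1p"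
  unfolding H1p_def by blast

lemma H1p_periodic: "v \<in> H1p \<Longrightarrow> periodic v"
  by (simp add: H1p_def)

lemma H1p_add:
  assumes "v \<in> H1p" "w \<in> H1p"
  shows "(\<lambda>x. v x + w x) \<in> H1p"
proof (rule H1pI)
  show "periodic (\<lambda>x. v x + w x)"
    using assms[THEN H1p_periodic] by (simp add: periodic_def)
  show "square_int (\<lambda>x. v x + w x)"
    by (rule square_int_add[OF assms[THEN H1p_square_int]])
  show "weak_gradient (\<lambda>x. v x + w x) (\<lambda>x. grad v x + grad w x)"
    by (rule weak_gradient_add[OF assms[THEN H1p_square_int] assms[THEN weak_gradient_grad]])
qed

lemma H1p_cmult:
  assumes "v \<in> H1p"
  shows "(\<lambda>x. c * v x) \<in> H1p"
proof (rule H1pI)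
  show "periodic (\<lambda>x. c * v x)"
    using assms[THEN H1p_periodic] by (simp add: periodic_def)
  show "square_int (\<lambda>x. c * v x)"
    by (rule square_int_cmult[OF assms[THEN H1p_square_int]])
  show "weak_gradient (\<lambda>x. c * v x) (\<lambda>x. c *s grad v x)"
    by (rule weak_gradient_cmult[OF assms[THEN weak_gradient_grad]])
qed

lemma H1p_zero: "(\<lambda>x. 0) \<in> H1p"
  unfolding H1p_def using weak_gradient_zero by (auto simp: periodic_def)

lemma H1p_diff: "v \<in> H1p \<Longrightarrow> w \<in> H1p \<Longrightarrow> (\<lambda>x. v x - w x) \<in> H1p"
  using H1p_add[of v "\<lambda>x. (-1) * w x"] H1p_cmult[of w "-1"] by simp

lemma H1p_phi: "phi k \<in> H1p"
  unfolding H1p_def using weak_gradient_phi by auto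

lemma H1p_sum: "(\<And>i. i \<in> I \<Longrightarrow> v i \<in> H1p) \<Longrightarrow> (\<lambda>x. \<Sum>i\<in>I. v i x) \<in> H1p"
  by (induction I rule: infinite_finite_induct) (auto intro: H1p_add H1p_zero)

lemma H1p_trig: "(\<lambda>x. \<Sum>k\<in>S. c k * phi k x) \<in> H1p"
  by (intro H1p_sum H1p_cmult H1p_phi)

lemma trig_space_H1p: "trig_space \<Lambda> \<subseteq> H1p"
proof
  fix v assume "v \<in> trig_space \<Lambda>"
  then obtain c S where "v = (\<lambda>x. \<Sum>k\<in>S. c k * phi k x)"
    unfolding trig_space_def by blast
  then show "v \<in> H1p" by (simp only: H1p_trig)
qed

text \<open>Testing the weak gradient with the conjugate mode, which is a test function.\<close>

lemma fcoeff_weak_gradient: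
  assumes "weak_gradient v g"
  shows "fcoeff (\<lambda>x. g x $ i) k = \<i> * of_int (k $ i) * fcoeff v k"
proof -
  have "integral\<^sup>L cellM (\<lambda>x. v x * partial i (phi (- k)) x)
      = - integral\<^sup>L cellM (\<lambda>x. g x $ i * phi (- k) x)"
    using assms unfolding weak_gradient_def by simp
  moreover have "integral\<^sup>L cellM (\<lambda>x. v x * partial i (phi (- k)) x)
      = integral\<^sup>L cellM (\<lambda>x. (\<i> * of_int (- (k $ i))) * (v x * phi (- k) x))"
    by (rule arg_cong[where f="integral\<^sup>L cellM"]) (auto simp: partial_phi)
  ultimately show ?thesis
    unfolding fcoeff_def cnj_phi by (simp add: equation_minus_iff)
qed

text \<open>The Fourier coefficients of a weak gradient are determined by those of the function, and by Parseval's
identity they determine it up to null sets. Hence the choice made in \<open>grad\<close> does not affect integrals.\<close>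

lemma weak_gradient_unique:
  assumes "weak_gradient v g" "weak_gradient v h"
  shows "AE x in cellM. g x $ i = h x $ i"
proof -
  have sq: "square_int (\<lambda>x. g x $ i)" "square_int (\<lambda>x. h x $ i)"
    using assms by (auto simp: weak_gradient_def)
  have "AE x in cellM. g x $ i - h x $ i = 0"
    by (rule AE_zero_if_fcoeff_zero)
       (use sq in \<open>auto simp: square_int_diff fcoeff_diff fcoeff_weak_gradient[OF assms(1)] fcoeff_weak_gradient[OF assms(2)]\<close>)
  then show ?thesis by simp
qed

lemma norm_lat_sq: "(norm (lat k))\<^sup>2 = (\<Sum>i\<in>UNIV. (real_of_int (k $ i))\<^sup>2)"
  unfolding power2_norm_eq_inner inner_vec_def by (simp add: power2_eq_square)

lemma infsum_finite_sum:
  fixes f :: "'i \<Rightarrow> 'k \<Rightarrow> real"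
  assumes "finite I" "\<And>i. i \<in> I \<Longrightarrow> f i summable_on A"
  shows "(\<lambda>k. \<Sum>i\<in>I. f i k) summable_on A" "(\<Sum>\<^sub>\<infinity>k\<in>A. \<Sum>i\<in>I. f i k) = (\<Sum>i\<in>I. infsum (f i) A)"
proof -
  have "(\<lambda>k. \<Sum>i\<in>I. f i k) summable_on A \<and> (\<Sum>\<^sub>\<infinity>k\<in>A. \<Sum>i\<in>I. f i k) = (\<Sum>i\<in>I. infsum (f i) A)"
    using assms
  proof (induction I rule: finite_induct)
    case (insert i I)
    then have "f i summable_on A" "(\<lambda>k. \<Sum>i\<in>I. f i k) summable_on A" by auto
    from summable_on_add[OF this] infsum_add[OF this] insert show ?case by simp
  qed simp
  then show "(\<lambda>k. \<Sum>i\<in>I. f i k) summable_on A" "(\<Sum>\<^sub>\<infinity>k\<in>A. \<Sum>i\<in>I. f i k) = (\<Sum>i\<in>I. infsum (f i) A)"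
    by auto
qed

text \<open>Parseval's identity for the function and for each component of its weak gradient.\<close>

lemma H1_norm_eq_gradient:
  assumes "square_int v" "weak_gradient v g"
  shows "(\<lambda>k. (1 + (norm (lat k))\<^sup>2) * (cmod (fcoeff v k))\<^sup>2) summable_on UNIV"
    and "(H1_norm v)\<^sup>2 = l2sq v + (\<Sum>i\<in>UNIV. l2sq (\<lambda>x. g x $ i))"
proof -
  have sq: "square_int (\<lambda>x. g x $ i)" for i using assms(2) unfolding weak_gradient_def by blast
  define F where "F = (\<lambda>i k. (cmod (fcoeff (\<lambda>x. g x $ i) k))\<^sup>2)"
  have F: "F i summable_on UNIV" "infsum (F i) UNIV = l2sq (\<lambda>x. g x $ i)" for i
    unfolding F_def using parseval[OF sq[of i]] by blast+
  have eq: "(1 + (norm (lat k))\<^sup>2) * (cmod (fcoeff v k))\<^sup>2 = (cmod (fcoeff v k))\<^sup>2 + (\<Sum>i\<in>UNIV. F i k)" for k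
  proof -
    have "F i k = (real_of_int (k $ i))\<^sup>2 * (cmod (fcoeff v k))\<^sup>2" for i
      by (simp only: F_def fcoeff_weak_gradient[OF assms(2)] norm_mult power_mult_distrib
          norm_ii norm_of_int power2_abs power_one mult_1_left)
    then show ?thesis
      by (simp only: norm_lat_sq sum_distrib_right[symmetric] distrib_right mult_1_left)
  qed
  have s: "(\<lambda>k. \<Sum>i\<in>UNIV. F i k) summable_on UNIV"
     "(\<Sum>\<^sub>\<infinity>k. \<Sum>i\<in>UNIV. F i k) = (\<Sum>i\<in>UNIV. l2sq (\<lambda>x. g x $ i))"
    using infsum_finite_sum[of UNIV F UNIV] F by simp_all
  show "(\<lambda>k. (1 + (norm (lat k))\<^sup>2) * (cmod (fcoeff v k))\<^sup>2) summable_on UNIV"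
    unfolding eq by (intro summable_on_add s parseval assms)
  have "(\<Sum>\<^sub>\<infinity>k. (1 + (norm (lat k))\<^sup>2) * (cmod (fcoeff v k))\<^sup>2) = l2sq v + (\<Sum>i\<in>UNIV. l2sq (\<lambda>x. g x $ i))"
    unfolding eq by (subst infsum_add) (use parseval[OF assms(1)] s in auto)
  moreover have "0 \<le> l2sq v + (\<Sum>i\<in>UNIV. l2sq (\<lambda>x. g x $ i))"
    by (intro add_nonneg_nonneg sum_nonneg) auto
  ultimately show "(H1_norm v)\<^sup>2 = l2sq v + (\<Sum>i\<in>UNIV. l2sq (\<lambda>x. g x $ i))"
    by (simp add: H1_norm_def)
qed

section \<open>Square-summable families\<close>

lemma ell2_finite_sum_le:
  assumes "x \<in> ell2" "finite F"
  shows "(\<Sum>k\<in>F. (cmod (x k))\<^sup>2) \<le> (ell2_norm x)\<^sup>2"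
proof -
  have s: "(\<lambda>k. (cmod (x k))\<^sup>2) summable_on UNIV" using assms(1) by (simp add: ell2_def)
  have "(\<Sum>k\<in>F. (cmod (x k))\<^sup>2) \<le> (\<Sum>\<^sub>\<infinity>k. (cmod (x k))\<^sup>2)"
    by (rule finite_sum_le_infsum[OF s assms(2)]) auto
  moreover have "0 \<le> (\<Sum>\<^sub>\<infinity>k. (cmod (x k))\<^sup>2)" by (rule infsum_nonneg) simp
  ultimately show ?thesis by (simp add: ell2_norm_def)
qed

lemma ell2I:
  assumes "0 \<le> c" "\<And>F. finite F \<Longrightarrow> (\<Sum>k\<in>F. (cmod (x k))\<^sup>2) \<le> c\<^sup>2"
  shows "x \<in> ell2" "ell2_norm x \<le> c"
proof -
  have s: "(\<lambda>k. (cmod (x k))\<^sup>2) summable_on UNIV"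
    by (rule nonneg_bdd_above_summable_on) (use assms(2) in \<open>auto intro!: bdd_aboveI\<close>)
  then show "x \<in> ell2" by (simp add: ell2_def)
  have "(\<Sum>\<^sub>\<infinity>k. (cmod (x k))\<^sup>2) \<le> c\<^sup>2"
    by (rule infsum_le_finite_sums[OF s assms(2)])
  then show "ell2_norm x \<le> c"
    unfolding ell2_norm_def using assms(1) by (metis real_sqrt_le_iff real_sqrt_unique)
qed

lemma ell2_norm_nonneg [simp]: "0 \<le> ell2_norm x"
  unfolding ell2_norm_def by (intro real_sqrt_ge_zero infsum_nonneg) simp

lemma ell2_L2_set_le: "x \<in> ell2 \<Longrightarrow> finite F \<Longrightarrow> L2_set (\<lambda>k. cmod (x k)) F \<le> ell2_norm x"
  unfolding L2_set_def using ell2_finite_sum_le[of x F]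
  by (metis ell2_norm_nonneg real_sqrt_le_iff real_sqrt_unique)

lemma ell2I_L2_set:
  assumes "\<And>F. finite F \<Longrightarrow> L2_set (\<lambda>k. cmod (x k)) F \<le> c"
  shows "x \<in> ell2" "ell2_norm x \<le> c"
proof -
  have c: "0 \<le> c" using assms[of "{}"] by simp
  have "(\<Sum>k\<in>F. (cmod (x k))\<^sup>2) \<le> c\<^sup>2" if "finite F" for F
    using assms[OF that] unfolding L2_set_def
    by (metis real_sqrt_le_iff real_sqrt_unique c)
  from ell2I[OF c this] show "x \<in> ell2" "ell2_norm x \<le> c" by auto
qed

lemma ell2_coordinate_le:
  assumes "x \<in> ell2"
  shows "cmod (x k) \<le> ell2_norm x"
  using ell2_L2_set_le[OF assms, of "{k}"] by simp

lemma ell2_add: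
  assumes "x \<in> ell2" "y \<in> ell2"
  shows "(\<lambda>k. x k + y k) \<in> ell2" "ell2_norm (\<lambda>k. x k + y k) \<le> ell2_norm x + ell2_norm y"
proof -
  have "L2_set (\<lambda>k. cmod (x k + y k)) F \<le> ell2_norm x + ell2_norm y" if "finite F" for F
  proof -
    have "L2_set (\<lambda>k. cmod (x k + y k)) F \<le> L2_set (\<lambda>k. cmod (x k) + cmod (y k)) F"
      by (rule L2_set_mono) (auto intro: norm_triangle_ineq)
    also have "\<dots> \<le> L2_set (\<lambda>k. cmod (x k)) F + L2_set (\<lambda>k. cmod (y k)) F"
      by (rule L2_set_triangle_ineq)
    also have "\<dots> \<le> ell2_norm x + ell2_norm y"
      by (intro add_mono ell2_L2_set_le assms that)
    finally show ?thesis .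
  qed
  from ell2I_L2_set[OF this]
  show "(\<lambda>k. x k + y k) \<in> ell2" "ell2_norm (\<lambda>k. x k + y k) \<le> ell2_norm x + ell2_norm y" by auto
qed

lemma ell2_cmult:
  assumes "x \<in> ell2"
  shows "(\<lambda>k. c * x k) \<in> ell2" "ell2_norm (\<lambda>k. c * x k) \<le> cmod c * ell2_norm x"
proof -
  have "(\<Sum>k\<in>F. (cmod (c * x k))\<^sup>2) \<le> (cmod c * ell2_norm x)\<^sup>2" if "finite F" for F
    using ell2_finite_sum_le[OF assms that]
    by (simp add: norm_mult power_mult_distrib sum_distrib_left[symmetric] mult_left_mono)
  from ell2I[OF _ this]
  show "(\<lambda>k. c * x k) \<in> ell2" "ell2_norm (\<lambda>k. c * x k) \<le> cmod c * ell2_norm x" by auto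
qed

lemma ell2_diff:
  assumes "x \<in> ell2" "y \<in> ell2"
  shows "(\<lambda>k. x k - y k) \<in> ell2" "ell2_norm (\<lambda>k. x k - y k) \<le> ell2_norm x + ell2_norm y"
  using ell2_add[OF assms(1) ell2_cmult(1)[OF assms(2), of "-1"]] ell2_cmult(2)[OF assms(2), of "-1"]
  by simp_all

lemma ell2_mono:
  assumes "y \<in> ell2" "\<And>k. cmod (x k) \<le> cmod (y k)"
  shows "x \<in> ell2" "ell2_norm x \<le> ell2_norm y"
proof -
  have "(\<Sum>k\<in>F. (cmod (x k))\<^sup>2) \<le> (ell2_norm y)\<^sup>2" if "finite F" for F
    by (rule order_trans[OF sum_mono ell2_finite_sum_le[OF assms(1) that]])
       (intro power_mono assms(2) norm_ge_zero)
  from ell2I[OF _ this] show "x \<in> ell2" "ell2_norm x \<le> ell2_norm y" by auto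
qed

lemma ell2_finite_support:
  assumes "finite N" "\<And>k. k \<notin> N \<Longrightarrow> x k = 0"
  shows "x \<in> ell2" "(ell2_norm x)\<^sup>2 = (\<Sum>k\<in>N. (cmod (x k))\<^sup>2)"
proof -
  have le: "(\<Sum>k\<in>F. (cmod (x k))\<^sup>2) \<le> (sqrt (\<Sum>k\<in>N. (cmod (x k))\<^sup>2))\<^sup>2" if "finite F" for F
  proof -
    have "(\<Sum>k\<in>F. (cmod (x k))\<^sup>2) = (\<Sum>k\<in>F \<inter> N. (cmod (x k))\<^sup>2)"
      by (rule sum.mono_neutral_right) (use assms that in auto)
    also have "\<dots> \<le> (\<Sum>k\<in>N. (cmod (x k))\<^sup>2)"
      by (rule sum_mono2) (use assms in auto)
    finally show ?thesis by (simp add: sum_nonneg)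
  qed
  have nn: "0 \<le> sqrt (\<Sum>k\<in>N. (cmod (x k))\<^sup>2)" by (simp add: sum_nonneg)
  note E = ell2I[OF nn le]
  show "x \<in> ell2" by (rule E)
  have "(ell2_norm x)\<^sup>2 \<le> (sqrt (\<Sum>k\<in>N. (cmod (x k))\<^sup>2))\<^sup>2"
    using E(2) ell2_norm_nonneg by (rule power_mono)
  then show "(ell2_norm x)\<^sup>2 = (\<Sum>k\<in>N. (cmod (x k))\<^sup>2)"
    using ell2_finite_sum_le[OF E(1) assms(1)] by (simp add: sum_nonneg)
qed

lemma ell2_zero [simp]: "(\<lambda>k. 0) \<in> ell2" "ell2_norm (\<lambda>k. 0) = 0"
  by (auto simp: ell2_def ell2_norm_def)

lemma ell2_norm_eq_0:
  assumes "x \<in> ell2" "\<And>e. e > 0 \<Longrightarrow> ell2_norm x \<le> e"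
  shows "x k = 0"
proof -
  have "ell2_norm x \<le> 0" by (rule field_le_epsilon) (use assms(2) in simp)
  then have "cmod (x k) \<le> 0" using ell2_coordinate_le[OF assms(1), of k] by linarith
  then show ?thesis by simp
qed

lemma ell2_mult_le:
  assumes "x \<in> ell2" "y \<in> ell2" "finite F"
  shows "(\<Sum>k\<in>F. cmod (x k) * cmod (y k)) \<le> ell2_norm x * ell2_norm y"
proof -
  have "(\<Sum>k\<in>F. cmod (x k) * cmod (y k)) \<le> L2_set (\<lambda>k. cmod (x k)) F * L2_set (\<lambda>k. cmod (y k)) F"
    using L2_set_mult_ineq[of "\<lambda>k. cmod (x k)" "\<lambda>k. cmod (y k)" F] by simp
  also have "\<dots> \<le> ell2_norm x * ell2_norm y"
    by (intro mult_mono ell2_L2_set_le assms) auto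
  finally show ?thesis .
qed

lemma ell2_mult_summable:
  assumes "x \<in> ell2" "y \<in> ell2"
  shows "(\<lambda>k. x k * y k) summable_on UNIV"
proof (rule abs_summable_summable)
  show "(\<lambda>k. norm (x k * y k)) summable_on UNIV"
    by (rule nonneg_bdd_above_summable_on)
       (use ell2_mult_le[OF assms] in \<open>auto simp: norm_mult intro!: bdd_aboveI\<close>)
qed

lemma ell2_tail:
  assumes "x \<in> ell2" "e > 0"
  obtains F where "finite F" "(\<lambda>k. if k \<in> F then 0 else x k) \<in> ell2"
    "ell2_norm (\<lambda>k. if k \<in> F then 0 else x k) \<le> e"
proof -
  let ?f = "\<lambda>k. (cmod (x k))\<^sup>2"
  have s: "?f summable_on UNIV" using assms(1) by (simp add: ell2_def)
  have "\<exists>F. finite F \<and> infsum ?f UNIV - e\<^sup>2 < sum ?f F"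
  proof (rule ccontr)
    assume "\<not> ?thesis"
    then have "infsum ?f UNIV \<le> infsum ?f UNIV - e\<^sup>2"
      by (intro infsum_le_finite_sums[OF s]) (auto simp: not_less)
    then show False using assms(2) by simp
  qed
  then obtain F where F: "finite F" "infsum ?f UNIV - e\<^sup>2 < sum ?f F" by blast
  let ?y = "\<lambda>k. if k \<in> F then 0 else x k"
  have bound: "(\<Sum>k\<in>H. (cmod (?y k))\<^sup>2) \<le> e\<^sup>2" if H: "finite H" for H
  proof -
    have "(\<Sum>k\<in>H. (cmod (?y k))\<^sup>2) = sum ?f (H - F)"
      by (rule sum.mono_neutral_cong_right) (use H in auto)
    also have "\<dots> = sum ?f ((H - F) \<union> F) - sum ?f F"
      using H F by (subst sum.union_disjoint) auto
    also have "\<dots> \<le> infsum ?f UNIV - sum ?f F"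
      using H F by (intro diff_right_mono finite_sum_le_infsum[OF s]) auto
    finally show ?thesis using F(2) by simp
  qed
  note E = ell2I[OF less_imp_le[OF assms(2)] bound]
  show ?thesis by (rule that[OF F(1) E])
qed

section \<open>Matrices acting on square-summable families\<close>

lemma opnorm_leD:
  assumes "opnorm_le B M" "x \<in> ell2"
  shows "(\<lambda>k. B l k * x k) summable_on UNIV" "mat_apply B x \<in> ell2"
    "ell2_norm (mat_apply B x) \<le> M * ell2_norm x"
  using assms unfolding opnorm_le_def by blast+

text \<open>Testing a finite section with the conjugate of a row shows that every row is square-summable, so that the
infinite sums defining the product with an $\ell^2$ vector converge; the norm bound then passes to the
limit.\<close>

lemma opnorm_leI_finite_sections:
  assumes M: "0 \<le> M" and fin: "\<And>S N z. finite S \<Longrightarrow> finite N \<Longrightarrow>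
      (\<Sum>l\<in>S. (cmod (\<Sum>k\<in>N. B l k * z k))\<^sup>2) \<le> M\<^sup>2 * (\<Sum>k\<in>N. (cmod (z k))\<^sup>2)"
  shows "opnorm_le B M"
  unfolding opnorm_le_def
proof (intro ballI conjI allI)
  fix x :: "int^'a \<Rightarrow> complex" assume x: "x \<in> ell2"
  have row: "B l \<in> ell2" for l
  proof (rule ell2I(1)[OF M])
    fix N :: "(int^'a) set" assume N: "finite N"
    define s where "s = (\<Sum>k\<in>N. (cmod (B l k))\<^sup>2)"
    have s0: "0 \<le> s" by (simp add: s_def sum_nonneg)
    have "(\<Sum>k\<in>N. B l k * cnj (B l k)) = complex_of_real s"
      unfolding s_def of_real_sum complex_norm_square ..
    then have "s\<^sup>2 \<le> M\<^sup>2 * s"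
      using fin[of "{l}" N "\<lambda>k. cnj (B l k)"] N s0 by (simp flip: s_def)
    then show "s \<le> M\<^sup>2"
      using s0 M by (cases "s = 0") (auto simp: power2_eq_square)
  qed
  show summ: "(\<lambda>k. B l k * x k) summable_on UNIV" for l
    by (rule ell2_mult_summable[OF row x])
  have bound: "(\<Sum>l\<in>S. (cmod (mat_apply B x l))\<^sup>2) \<le> (M * ell2_norm x)\<^sup>2" if S: "finite S" for S
  proof (rule tendsto_upperbound)
    have "((\<lambda>N. \<Sum>k\<in>N. B l k * x k) \<longlongrightarrow> mat_apply B x l) (finite_subsets_at_top UNIV)" for l
      unfolding mat_apply_def by (rule infsum_tendsto[OF summ])
    then show "((\<lambda>N. \<Sum>l\<in>S. (cmod (\<Sum>k\<in>N. B l k * x k))\<^sup>2) \<longlongrightarrow> (\<Sum>l\<in>S. (cmod (mat_apply B x l))\<^sup>2))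
       (finite_subsets_at_top UNIV)"
      by (intro tendsto_sum tendsto_power tendsto_norm)
    show "\<forall>\<^sub>F N in finite_subsets_at_top UNIV.
        (\<Sum>l\<in>S. (cmod (\<Sum>k\<in>N. B l k * x k))\<^sup>2) \<le> (M * ell2_norm x)\<^sup>2"
    proof (rule eventually_finite_subsets_at_top_weakI)
      fix N :: "(int^'a) set" assume N: "finite N"
      show "(\<Sum>l\<in>S. (cmod (\<Sum>k\<in>N. B l k * x k))\<^sup>2) \<le> (M * ell2_norm x)\<^sup>2"
        using fin[OF S N, of x] mult_left_mono[OF ell2_finite_sum_le[OF x N], of "M\<^sup>2"]
        by (simp add: power_mult_distrib)
    qed
  qed simp
  from ell2I[OF _ bound] M
  show "mat_apply B x \<in> ell2" "ell2_norm (mat_apply B x) \<le> M * ell2_norm x" by auto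
qed

lemma mat_apply_add:
  assumes "opnorm_le B M" "x \<in> ell2" "y \<in> ell2"
  shows "mat_apply B (\<lambda>k. x k + y k) = (\<lambda>l. mat_apply B x l + mat_apply B y l)"
  unfolding mat_apply_def
  by (rule ext) (simp add: distrib_left infsum_add opnorm_leD(1)[OF assms(1)] assms)

lemma mat_apply_cmult: "mat_apply B (\<lambda>k. c * x k) = (\<lambda>l. c * mat_apply B x l)"
  unfolding mat_apply_def
  by (rule ext) (simp add: infsum_cmult_right'[symmetric] mult.left_commute)

lemma mat_apply_diff:
  assumes "opnorm_le B M" "x \<in> ell2" "y \<in> ell2"
  shows "mat_apply B (\<lambda>k. x k - y k) = (\<lambda>l. mat_apply B x l - mat_apply B y l)"
  using mat_apply_add[OF assms(1,2) ell2_cmult(1)[OF assms(3), of "-1"]] mat_apply_cmult[of B "-1" y]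
  by simp

lemma mat_apply_finite:
  assumes "finite N" "\<And>k. k \<notin> N \<Longrightarrow> x k = 0"
  shows "mat_apply B x l = (\<Sum>k\<in>N. B l k * x k)"
proof -
  have "mat_apply B x l = (\<Sum>\<^sub>\<infinity>k\<in>N. B l k * x k)"
    unfolding mat_apply_def by (rule infsum_cong_neutral) (use assms in auto)
  then show ?thesis using assms(1) by simp
qed

lemma mat_apply_sum:
  assumes "opnorm_le B M" "finite T" "\<And>k. k \<in> T \<Longrightarrow> x k \<in> ell2"
  shows "(\<lambda>l. \<Sum>k\<in>T. c k * x k l) \<in> ell2 \<and>
    mat_apply B (\<lambda>l. \<Sum>k\<in>T. c k * x k l) = (\<lambda>l. \<Sum>k\<in>T. c k * mat_apply B (x k) l)"
  using assms(2,3)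
proof (induction T rule: finite_induct)
  case empty
  then show ?case by (simp add: mat_apply_def)
next
  case (insert a T)
  then have 1: "(\<lambda>l. c a * x a l) \<in> ell2" and 2: "(\<lambda>l. \<Sum>k\<in>T. c k * x k l) \<in> ell2"
    and 3: "mat_apply B (\<lambda>l. \<Sum>k\<in>T. c k * x k l) = (\<lambda>l. \<Sum>k\<in>T. c k * mat_apply B (x k) l)"
    by (auto intro: ell2_cmult)
  show ?case
    using ell2_add(1)[OF 1 2] mat_apply_add[OF assms(1) 1 2] 3 insert.hyps
    by (simp add: mat_apply_cmult)
qed

section \<open>Contractions and coercive matrices\<close>

text \<open>The Neumann series $\sum_i C^i y$. Its partial sums $s_n$ satisfy $s_{n+1} = C s_n + y$; their
coordinatewise limit lies in $\ell^2$, because the tail estimate for the geometric series holds on every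
finite set of coordinates.\<close>

lemma contraction_fixed_point:
  assumes C: "opnorm_le C q" and q: "0 \<le> q" "q < 1" and y: "y \<in> ell2"
  obtains x where "x \<in> ell2" "\<And>l. x l = mat_apply C x l + y l"
proof -
  define d where "d = (\<lambda>n. (mat_apply C ^^ n) y)"
  have d_Suc: "d (Suc n) = mat_apply C (d n)" for n by (simp add: d_def)
  have d0: "d 0 = y" by (simp add: d_def)
  have d: "d n \<in> ell2 \<and> ell2_norm (d n) \<le> q ^ n * ell2_norm y" for n
  proof (induction n)
    case 0
    then show ?case using y by (simp add: d0)
  next
    case (Suc n)
    then have "ell2_norm (d (Suc n)) \<le> q * ell2_norm (d n)"
      unfolding d_Suc using opnorm_leD(3)[OF C] by blast
    also have "\<dots> \<le> q * (q ^ n * ell2_norm y)" using Suc q by (intro mult_left_mono) auto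
    finally show ?case using Suc opnorm_leD(2)[OF C, of "d n"] by (simp add: d_Suc mult.assoc)
  qed
  \<comment> \<open>the tail of the geometric series that dominates the Neumann series\<close>
  define b where "b = (\<lambda>n. q ^ n * ell2_norm y / (1 - q))"
  have b_Suc: "b n = q ^ n * ell2_norm y + b (Suc n)" for n
    using q by (simp add: b_def field_simps)
  have b0: "0 \<le> b n" for n using q by (simp add: b_def)
  have b_lim: "b \<longlonglongrightarrow> 0"
    unfolding b_def using q by (auto intro!: tendsto_eq_intros LIMSEQ_power_zero)
  define s where "s = (\<lambda>n k. \<Sum>i<n. d i k)"
  have s_ell2: "s n \<in> ell2" for n
  proof (induction n)
    case (Suc n)
    then show ?case using ell2_add(1)[of "s n" "d n"] d by (simp add: s_def)
  qed (simp add: s_def)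
  have s_Suc: "s (Suc n) l = mat_apply C (s n) l + y l" for n l
  proof (induction n arbitrary: l)
    case 0
    then show ?case by (simp add: s_def d0 mat_apply_def)
  next
    case (Suc n)
    have "s (Suc (Suc n)) l = s (Suc n) l + d (Suc n) l" by (simp add: s_def)
    also have "\<dots> = (mat_apply C (s n) l + mat_apply C (d n) l) + y l"
      by (simp add: Suc d_Suc)
    also have "\<dots> = mat_apply C (\<lambda>k. s n k + d n k) l + y l"
      using mat_apply_add[OF C s_ell2 conjunct1[OF d]] by simp
    finally show ?case by (simp add: s_def)
  qed
  have diff: "(\<lambda>k. s (n + m) k - s n k) \<in> ell2 \<and> ell2_norm (\<lambda>k. s (n + m) k - s n k) \<le> b n - b (n + m)" for n m
  proof (induction m)
    case (Suc m)
    have "(\<lambda>k. s (n + Suc m) k - s n k) = (\<lambda>k. (s (n + m) k - s n k) + d (n + m) k)"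
      by (simp add: s_def algebra_simps)
    moreover have "ell2_norm (d (n + m)) \<le> b (n + m) - b (n + Suc m)"
      using d[of "n + m"] b_Suc[of "n + m"] by simp
    ultimately show ?case
      using ell2_add[of "\<lambda>k. s (n + m) k - s n k" "d (n + m)"] Suc d[of "n + m"] by auto
  qed simp
  have dle: "cmod (d i k) \<le> ell2_norm y * q ^ i" for i k
    using ell2_coordinate_le[OF conjunct1[OF d], of i k] d[of i] by (simp add: mult.commute)
  have "summable (\<lambda>i. d i k)" for k
    by (rule summable_comparison_test[of _ "\<lambda>i. ell2_norm y * q ^ i"])
       (use dle q in \<open>auto intro!: summable_mult summable_geometric\<close>)
  then have lim: "(\<lambda>n. s n k) \<longlonglongrightarrow> (\<Sum>i. d i k)" for k
    unfolding s_def by (rule summable_LIMSEQ)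
  define x where "x = (\<lambda>k. \<Sum>i. d i k)"
  have xs: "(\<lambda>k. x k - s n k) \<in> ell2 \<and> ell2_norm (\<lambda>k. x k - s n k) \<le> b n" for n
  proof -
    have "(\<Sum>k\<in>F. (cmod (x k - s n k))\<^sup>2) \<le> (b n)\<^sup>2" if F: "finite F" for F
    proof (rule LIMSEQ_le_const2)
      have "(\<lambda>m. s (n + m) k) \<longlonglongrightarrow> x k" for k
        using LIMSEQ_ignore_initial_segment[OF lim[of k], of n] by (simp add: add.commute x_def)
      then show "(\<lambda>m. \<Sum>k\<in>F. (cmod (s (n + m) k - s n k))\<^sup>2) \<longlonglongrightarrow> (\<Sum>k\<in>F. (cmod (x k - s n k))\<^sup>2)"
        by (intro tendsto_sum tendsto_power tendsto_norm tendsto_diff tendsto_const)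
      have "(\<Sum>k\<in>F. (cmod (s (n + m) k - s n k))\<^sup>2) \<le> (b n)\<^sup>2" for m
      proof -
        have "(\<Sum>k\<in>F. (cmod (s (n + m) k - s n k))\<^sup>2) \<le> (ell2_norm (\<lambda>k. s (n + m) k - s n k))\<^sup>2"
          by (rule ell2_finite_sum_le[OF conjunct1[OF diff] F])
        also have "\<dots> \<le> (b n)\<^sup>2"
          using diff[of n m] b0[of "n + m"] by (intro power_mono) auto
        finally show ?thesis .
      qed
      then show "\<exists>N. \<forall>m\<ge>N. (\<Sum>k\<in>F. (cmod (s (n + m) k - s n k))\<^sup>2) \<le> (b n)\<^sup>2" by blast
    qed
    from ell2I[OF b0 this] show ?thesis by blast
  qed
  have x: "x \<in> ell2" using xs[of 0] by (simp add: s_def)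
  have "x l = mat_apply C x l + y l" for l
  proof -
    have "cmod (mat_apply C x l + y l - x l) \<le> b n + b (Suc n)" for n
    proof -
      have ap: "mat_apply C x l - mat_apply C (s n) l = mat_apply C (\<lambda>k. x k - s n k) l"
        using mat_apply_diff[OF C x s_ell2] by simp
      have "cmod (mat_apply C (\<lambda>k. x k - s n k) l) \<le> b n"
      proof -
        have "cmod (mat_apply C (\<lambda>k. x k - s n k) l) \<le> ell2_norm (mat_apply C (\<lambda>k. x k - s n k))"
          by (rule ell2_coordinate_le[OF opnorm_leD(2)[OF C conjunct1[OF xs]]])
        also have "\<dots> \<le> q * ell2_norm (\<lambda>k. x k - s n k)"
          by (rule opnorm_leD(3)[OF C conjunct1[OF xs]])
        also have "\<dots> \<le> 1 * b n" using q xs[of n] by (intro mult_mono) auto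
        finally show ?thesis by simp
      qed
      moreover have "cmod (x l - s (Suc n) l) \<le> b (Suc n)"
        using ell2_coordinate_le[OF conjunct1[OF xs[of "Suc n"]], of l] xs[of "Suc n"] by linarith
      moreover have eq: "mat_apply C x l + y l - x l
          = (mat_apply C x l - mat_apply C (s n) l) - (x l - s (Suc n) l)"
        by (simp add: s_Suc)
      ultimately show ?thesis
        unfolding eq ap
        using norm_triangle_ineq4[of "mat_apply C (\<lambda>k. x k - s n k) l" "x l - s (Suc n) l"]
        by linarith
    qed
    moreover have "(\<lambda>n. b n + b (Suc n)) \<longlonglongrightarrow> 0 + 0"
      by (intro tendsto_add b_lim LIMSEQ_Suc)
    ultimately have "cmod (mat_apply C x l + y l - x l) \<le> 0"
      by (intro LIMSEQ_le_const[of "\<lambda>n. b n + b (Suc n)"]) auto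
    then show ?thesis by simp
  qed
  with x show ?thesis by (rule that)
qed

text \<open>For $B$ coercive with constant $m$ and bounded by $M$,
$\|z - \tau B z\|^2 \le (1 - 2 \tau m + \tau^2 M^2) \|z\|^2$; the step $\tau = m / M^2$ minimizes the
factor.\<close>

lemma coercive_matrix_contraction:
  fixes B :: "'d::finite bimatrix"
  assumes m: "0 < m" "m \<le> M"
    and bound: "\<And>S N z. finite S \<Longrightarrow> finite N \<Longrightarrow>
      (\<Sum>l\<in>S. (cmod (\<Sum>k\<in>N. B l k * z k))\<^sup>2) \<le> M\<^sup>2 * (\<Sum>k\<in>N. (cmod (z k))\<^sup>2)"
    and coercive: "\<And>N z. finite N \<Longrightarrow>
      m * (\<Sum>k\<in>N. (cmod (z k))\<^sup>2) \<le> Re (\<Sum>l\<in>N. (\<Sum>k\<in>N. B l k * z k) * cnj (z l))"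
  shows "opnorm_le (\<lambda>l k. (if l = k then 1 else 0) - of_real (m / M\<^sup>2) * B l k) (sqrt (1 - (m / M)\<^sup>2))"
    (is "opnorm_le ?C ?q")
proof (rule opnorm_leI_finite_sections)
  have q: "0 \<le> 1 - (m / M)\<^sup>2" using m by (simp add: power_le_one)
  then show "0 \<le> ?q" by simp
  fix S N :: "(int^'d) set" and z :: "int^'d \<Rightarrow> complex" assume S: "finite S" and N: "finite N"
  define \<tau> where "\<tau> = m / M\<^sup>2"
  define U where "U = S \<union> N"
  \<comment> \<open>extension of \<open>z\<close> by zero from the columns \<open>N\<close> to the rows \<open>U\<close>\<close>
  define w where "w = (\<lambda>l. if l \<in> N then z l else 0)"
  define Bz where "Bz = (\<lambda>l. \<Sum>k\<in>N. B l k * z k)"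
  have U: "finite U" "N \<subseteq> U" "S \<subseteq> U" using S N by (auto simp: U_def)
  have C: "(\<Sum>k\<in>N. ?C l k * z k) = w l - of_real \<tau> * Bz l" for l
  proof -
    have "(\<Sum>k\<in>N. ?C l k * z k) = (\<Sum>k\<in>N. (if l = k then z k else 0)) - (\<Sum>k\<in>N. of_real \<tau> * (B l k * z k))"
      by (simp add: sum_subtractf[symmetric] left_diff_distrib \<tau>_def mult.assoc)
         (rule sum.cong; simp)
    then show ?thesis using N by (simp add: w_def Bz_def sum_distrib_left)
  qed
  have expand: "(cmod (w l - of_real \<tau> * Bz l))\<^sup>2
      = (cmod (w l))\<^sup>2 - 2 * \<tau> * Re (Bz l * cnj (w l)) + \<tau>\<^sup>2 * (cmod (Bz l))\<^sup>2" for l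
    unfolding cmod_power2 by (simp add: power2_eq_square algebra_simps)
  have "(\<Sum>l\<in>S. (cmod (\<Sum>k\<in>N. ?C l k * z k))\<^sup>2) \<le> (\<Sum>l\<in>U. (cmod (w l - of_real \<tau> * Bz l))\<^sup>2)"
    unfolding C by (rule sum_mono2) (use U in auto)
  also have "\<dots> = (\<Sum>l\<in>U. (cmod (w l))\<^sup>2) - 2 * \<tau> * Re (\<Sum>l\<in>U. Bz l * cnj (w l)) + \<tau>\<^sup>2 * (\<Sum>l\<in>U. (cmod (Bz l))\<^sup>2)"
    unfolding expand by (simp only: sum.distrib sum_subtractf sum_distrib_left Re_sum)
  also have "(\<Sum>l\<in>U. (cmod (w l))\<^sup>2) = (\<Sum>l\<in>N. (cmod (z l))\<^sup>2)"
    by (rule sum.mono_neutral_cong_right) (use U in \<open>auto simp: w_def\<close>)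
  also have "(\<Sum>l\<in>U. Bz l * cnj (w l)) = (\<Sum>l\<in>N. Bz l * cnj (z l))"
    by (rule sum.mono_neutral_cong_right) (use U in \<open>auto simp: w_def\<close>)
  also have "(\<Sum>l\<in>N. (cmod (z l))\<^sup>2) - 2 * \<tau> * Re (\<Sum>l\<in>N. Bz l * cnj (z l)) + \<tau>\<^sup>2 * (\<Sum>l\<in>U. (cmod (Bz l))\<^sup>2)
      \<le> (\<Sum>l\<in>N. (cmod (z l))\<^sup>2) - 2 * \<tau> * (m * (\<Sum>l\<in>N. (cmod (z l))\<^sup>2))
        + \<tau>\<^sup>2 * (M\<^sup>2 * (\<Sum>l\<in>N. (cmod (z l))\<^sup>2))"
  proof -
    have "0 \<le> 2 * \<tau>" using m by (simp add: \<tau>_def)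
    then have "2 * \<tau> * (m * (\<Sum>l\<in>N. (cmod (z l))\<^sup>2)) \<le> 2 * \<tau> * Re (\<Sum>l\<in>N. Bz l * cnj (z l))"
      using coercive[OF N, of z] unfolding Bz_def by (rule mult_left_mono[rotated])
    moreover have "\<tau>\<^sup>2 * (\<Sum>l\<in>U. (cmod (Bz l))\<^sup>2) \<le> \<tau>\<^sup>2 * (M\<^sup>2 * (\<Sum>l\<in>N. (cmod (z l))\<^sup>2))"
      using bound[OF U(1) N, of z] unfolding Bz_def by (rule mult_left_mono) simp
    ultimately show ?thesis by linarith
  qed
  also have "\<dots> = (1 - 2 * (\<tau> * m) + \<tau>\<^sup>2 * M\<^sup>2) * (\<Sum>l\<in>N. (cmod (z l))\<^sup>2)"
    by (simp add: algebra_simps)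
  also have "1 - 2 * (\<tau> * m) + \<tau>\<^sup>2 * M\<^sup>2 = ?q\<^sup>2"
    using m q by (simp add: \<tau>_def power2_eq_square)
  finally show "(\<Sum>l\<in>S. (cmod (\<Sum>k\<in>N. ?C l k * z k))\<^sup>2) \<le> ?q\<^sup>2 * (\<Sum>k\<in>N. (cmod (z k))\<^sup>2)" .
qed

text \<open>The Lax--Milgram lemma for matrices: solutions of $B x = y$ are the fixed points of
$x \mapsto (I - \tau B) x + \tau y$, whose linear part is a contraction.\<close>

lemma coercive_matrix_bijective:
  fixes B :: "'d::finite bimatrix"
  assumes m: "0 < m" "m \<le> M"
    and bound: "\<And>S N z. finite S \<Longrightarrow> finite N \<Longrightarrow>
      (\<Sum>l\<in>S. (cmod (\<Sum>k\<in>N. B l k * z k))\<^sup>2) \<le> M\<^sup>2 * (\<Sum>k\<in>N. (cmod (z k))\<^sup>2)"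
    and coercive: "\<And>N z. finite N \<Longrightarrow>
      m * (\<Sum>k\<in>N. (cmod (z k))\<^sup>2) \<le> Re (\<Sum>l\<in>N. (\<Sum>k\<in>N. B l k * z k) * cnj (z l))"
  shows "bij_betw (mat_apply B) ell2 ell2"
proof -
  let ?C = "\<lambda>l k. (if l = k then 1 else 0) - of_real (m / M\<^sup>2) * B l k :: complex"
  let ?q = "sqrt (1 - (m / M)\<^sup>2)"
  have C: "opnorm_le ?C ?q" by (rule coercive_matrix_contraction[OF assms])
  have M: "0 < M" using m by linarith
  have q: "0 \<le> ?q" "?q < 1" using m M by (auto simp: power_le_one)
  have B: "opnorm_le B M" by (rule opnorm_leI_finite_sections[OF _ bound]) (use M in auto)
  have Capply: "mat_apply ?C x l = x l - of_real (m / M\<^sup>2) * mat_apply B x l" if x: "x \<in> ell2" for x l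
  proof -
    have 1: "((\<lambda>k. (if l = k then 1 else 0) * x k) has_sum x l) UNIV"
      by (rule has_sum_finite_neutralI[of "{l}"]) auto
    have 2: "((\<lambda>k. - of_real (m / M\<^sup>2) * (B l k * x k)) has_sum (- of_real (m / M\<^sup>2) * mat_apply B x l)) UNIV"
      unfolding mat_apply_def by (intro has_sum_cmult_right has_sum_infsum opnorm_leD(1)[OF B x])
    have "((\<lambda>k. ?C l k * x k) has_sum (x l - of_real (m / M\<^sup>2) * mat_apply B x l)) UNIV"
      using has_sum_add[OF 1 2]
      by (simp only: distrib_right mult.assoc mult_minus_left diff_conv_add_uminus)
    then show ?thesis unfolding mat_apply_def[of ?C] by (rule infsumI)
  qed
  have c0: "complex_of_real (m / M\<^sup>2) \<noteq> 0" using m M by simp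
  show ?thesis
    unfolding bij_betw_def
  proof
    show "inj_on (mat_apply B) ell2"
    proof (rule inj_onI)
      fix x y :: "int^'d \<Rightarrow> complex"
      assume x: "x \<in> ell2" and y: "y \<in> ell2" and eq: "mat_apply B x = mat_apply B y"
      define z where "z = (\<lambda>k. x k - y k)"
      have z: "z \<in> ell2" unfolding z_def by (rule ell2_diff(1)[OF x y])
      have "mat_apply B z = (\<lambda>l. 0)"
        unfolding z_def mat_apply_diff[OF B x y] eq by simp
      then have "mat_apply ?C z = z" by (intro ext) (simp only: Capply[OF z], simp)
      then have "ell2_norm z \<le> ?q * ell2_norm z" using opnorm_leD(3)[OF C z] by simp
      then have "(1 - ?q) * ell2_norm z \<le> 0" by (simp add: algebra_simps)
      then have "ell2_norm z \<le> 0" using q(2) by (simp add: mult_le_0_iff)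
      then have "z k = 0" for k
        using ell2_norm_eq_0[OF z] by (meson less_imp_le order_trans)
      then show "x = y" by (intro ext) (simp add: z_def)
    qed
    show "mat_apply B ` ell2 = ell2"
    proof
      show "mat_apply B ` ell2 \<subseteq> ell2" using opnorm_leD(2)[OF B] by blast
      show "ell2 \<subseteq> mat_apply B ` ell2"
      proof
        fix y :: "int^'d \<Rightarrow> complex" assume y: "y \<in> ell2"
        obtain x where x: "x \<in> ell2" and fp: "\<And>l. x l = mat_apply ?C x l + of_real (m / M\<^sup>2) * y l"
          using contraction_fixed_point[OF C q ell2_cmult(1)[OF y, of "of_real (m / M\<^sup>2)"]] by blast
        have "mat_apply B x l = y l" for l
        proof -
          have "complex_of_real (m / M\<^sup>2) * mat_apply B x l = of_real (m / M\<^sup>2) * y l"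
            using fp[of l] unfolding Capply[OF x] by (simp add: algebra_simps)
          then show ?thesis using c0 by (metis mult_left_cancel)
        qed
        then have "y = mat_apply B x" by (intro ext) simp
        then show "y \<in> mat_apply B ` ell2" using x by blast
      qed
    qed
  qed
qed

lemma inverse_mat_column:
  assumes "bij_betw (mat_apply B) ell2 ell2"
  shows "(\<lambda>l. inverse_mat B l k) \<in> ell2"
    "mat_apply B (\<lambda>l. inverse_mat B l k) = (\<lambda>j. if j = k then 1 else 0)"
proof -
  let ?e = "\<lambda>j. if j = k then 1 else 0 :: complex"
  have e: "?e \<in> ell2" by (rule ell2_finite_support(1)[of "{k}"]) auto
  have eq: "(\<lambda>l. inverse_mat B l k) = the_inv_into ell2 (mat_apply B) ?e"
    by (simp add: inverse_mat_def)
  have inj: "inj_on (mat_apply B) ell2" and im: "mat_apply B ` ell2 = ell2"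
    using assms by (auto simp: bij_betw_def)
  show "(\<lambda>l. inverse_mat B l k) \<in> ell2"
    unfolding eq by (rule the_inv_into_into[OF inj _ subset_refl]) (simp only: im e)
  show "mat_apply B (\<lambda>l. inverse_mat B l k) = ?e"
    unfolding eq by (rule f_the_inv_into_f[OF inj]) (simp only: im e)
qed

text \<open>Column $k$ of the truncated inverse vanishes at all indices farther than $J$ from $k$. So outside the
enrichment of the support of $y$, the solution coincides with the truncation error applied to $y$.\<close>

lemma localized_inverse:
  assumes bij: "bij_betw (mat_apply B) ell2 ell2" and B: "opnorm_le B M"
    and trunc: "opnorm_le (\<lambda>l k. inverse_mat B l k - truncate (inverse_mat B) J l k) \<epsilon>"
    and T: "finite T" and y: "\<And>k. k \<notin> T \<Longrightarrow> y k = 0"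
  obtains x where "x \<in> ell2" "mat_apply B x = y"
    "ell2_norm (\<lambda>l. if l \<in> enrich T J then 0 else x l) \<le> \<epsilon> * ell2_norm y"
proof -
  define x where "x = (\<lambda>l. \<Sum>k\<in>T. y k * inverse_mat B l k)"
  have 1: "x \<in> ell2" and 2: "mat_apply B x = (\<lambda>l. \<Sum>k\<in>T. y k * (if l = k then 1 else 0))"
    using mat_apply_sum[OF B T, of "\<lambda>k l. inverse_mat B l k" y]
      inverse_mat_column[OF bij] by (auto simp: x_def)
  have "mat_apply B x = y"
  proof
    fix l
    have "mat_apply B x l = (\<Sum>k\<in>T. if l = k then y k else 0)"
      unfolding 2 by (rule sum.cong) auto
    then show "mat_apply B x l = y l" using T y by auto
  qed
  moreover have "ell2_norm (\<lambda>l. if l \<in> enrich T J then 0 else x l) \<le> \<epsilon> * ell2_norm y"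
  proof -
    let ?D = "\<lambda>l k. inverse_mat B l k - truncate (inverse_mat B) J l k"
    have yl: "y \<in> ell2" by (rule ell2_finite_support(1)[OF T y])
    have "ell2_norm (\<lambda>l. if l \<in> enrich T J then 0 else x l) \<le> ell2_norm (mat_apply ?D y)"
    proof (rule ell2_mono(2)[OF opnorm_leD(2)[OF trunc yl]])
      fix l
      have "mat_apply ?D y l = (\<Sum>k\<in>T. ?D l k * y k)"
        by (rule mat_apply_finite[OF T y])
      also have "\<dots> = x l" if "l \<notin> enrich T J"
        unfolding x_def
        by (rule sum.cong) (use that in \<open>auto simp: enrich_def truncate_def mult.commute\<close>)
      finally show "cmod (if l \<in> enrich T J then 0 else x l) \<le> cmod (mat_apply ?D y l)" by auto
    qed
    also have "\<dots> \<le> \<epsilon> * ell2_norm y" by (rule opnorm_leD(3)[OF trunc yl])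
    finally show ?thesis .
  qed
  ultimately show ?thesis using 1 by (intro that)
qed

section \<open>The energy form\<close>

lemma square_int_weight:
  assumes "continuous_on UNIV \<rho>" "\<And>x. m \<le> \<rho> x \<and> \<rho> x \<le> M" "0 \<le> m" "square_int v"
  shows "square_int (\<lambda>x. complex_of_real (\<rho> x) * v x)"
proof (rule square_int_bounded_mult[OF assms(4), where B=M])
  have "continuous_on UNIV (\<lambda>x. complex_of_real (\<rho> x))"
    by (intro continuous_intros assms(1))
  then show "(\<lambda>x. complex_of_real (\<rho> x)) \<in> borel_measurable cellM"
    by (intro measurable_cellM_borel borel_measurable_continuous_onI)
  show "cmod (complex_of_real (\<rho> x)) \<le> M" for x
    using assms(2)[of x] assms(3) by simp
qed

lemma l2ip_weight_cnj:
  "l2ip (\<lambda>x. complex_of_real (\<rho> x) * v x) w = cnj (l2ip (\<lambda>x. complex_of_real (\<rho> x) * w x) v)"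
proof -
  have eq: "(\<lambda>x. complex_of_real (\<rho> x) * v x * cnj (w x)) = (\<lambda>x. cnj (complex_of_real (\<rho> x) * w x * cnj (v x)))"
    by (rule ext) (simp add: mult_ac)
  show ?thesis unfolding l2ip_def eq by (rule Bochner_Integration.integral_cnj)
qed

lemma l2ip_weight_bounds:
  assumes "continuous_on UNIV \<rho>" "\<And>x. m \<le> \<rho> x \<and> \<rho> x \<le> M" "0 \<le> m" "square_int v"
  shows "m * l2sq v \<le> Re (l2ip (\<lambda>x. complex_of_real (\<rho> x) * v x) v)"
    "Re (l2ip (\<lambda>x. complex_of_real (\<rho> x) * v x) v) \<le> M * l2sq v"
proof -
  have eq: "(\<lambda>x. complex_of_real (\<rho> x) * v x * cnj (v x)) = (\<lambda>x. complex_of_real (\<rho> x * (cmod (v x))\<^sup>2))"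
    by (rule ext) (simp only: of_real_mult complex_norm_square mult.assoc)
  have "integrable cellM (\<lambda>x. complex_of_real (\<rho> x) * v x * cnj (v x))"
    by (rule square_int_mult_integrable[OF square_int_weight[OF assms] assms(4)])
  then have int: "integrable cellM (\<lambda>x. \<rho> x * (cmod (v x))\<^sup>2)"
    unfolding eq by (simp only: complex_of_real_integrable_eq)
  have val: "Re (l2ip (\<lambda>x. complex_of_real (\<rho> x) * v x) v) = integral\<^sup>L cellM (\<lambda>x. \<rho> x * (cmod (v x))\<^sup>2)"
    unfolding l2ip_def eq by (simp only: integral_complex_of_real Re_complex_of_real)
  have sq: "integrable cellM (\<lambda>x. (cmod (v x))\<^sup>2)" using assms(4) by (simp add: square_int_def)
  have "integral\<^sup>L cellM (\<lambda>x. m * (cmod (v x))\<^sup>2) \<le> integral\<^sup>L cellM (\<lambda>x. \<rho> x * (cmod (v x))\<^sup>2)"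
    by (rule integral_mono[OF _ int]) (use sq assms(2) in \<open>auto intro: mult_right_mono\<close>)
  then show "m * l2sq v \<le> Re (l2ip (\<lambda>x. complex_of_real (\<rho> x) * v x) v)"
    using sq by (simp add: val l2sq_def)
  have "integral\<^sup>L cellM (\<lambda>x. \<rho> x * (cmod (v x))\<^sup>2) \<le> integral\<^sup>L cellM (\<lambda>x. M * (cmod (v x))\<^sup>2)"
    by (rule integral_mono[OF int]) (use sq assms(2) in \<open>auto intro: mult_right_mono\<close>)
  then show "Re (l2ip (\<lambda>x. complex_of_real (\<rho> x) * v x) v) \<le> M * l2sq v"
    using sq by (simp add: val l2sq_def)
qed

lemma H1_norm_nonneg [simp]: "0 \<le> H1_norm v"
  unfolding H1_norm_def
  by (intro real_sqrt_ge_zero infsum_nonneg mult_nonneg_nonneg add_nonneg_nonneg) auto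

lemma l2ip_cong_AE:
  assumes "AE x in cellM. v x = v' x" "AE x in cellM. w x = w' x"
    "square_int v" "square_int v'" "square_int w" "square_int w'"
  shows "l2ip v w = l2ip v' w'"
  unfolding l2ip_def
proof (rule integral_cong_AE)
  show "(\<lambda>x. v x * cnj (w x)) \<in> borel_measurable cellM" "(\<lambda>x. v' x * cnj (w' x)) \<in> borel_measurable cellM"
    using assms(3-6)[THEN square_int_measurable] by measurable
  show "AE x in cellM. v x * cnj (w x) = v' x * cnj (w' x)"
    using assms(1,2) by eventually_elim simp
qed

locale elliptic_form =
  fixes \<nu> \<sigma> :: "real^'d \<Rightarrow> real" and \<alpha>lo \<alpha>hi :: real
  assumes continuous_coefficients: "continuous_on UNIV \<nu>" "continuous_on UNIV \<sigma>"
    and alpha_pos: "0 < \<alpha>lo"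
    and coefficient_bounds: "\<And>x. \<alpha>lo \<le> \<nu> x \<and> \<nu> x \<le> \<alpha>hi" "\<And>x. \<alpha>lo \<le> \<sigma> x \<and> \<sigma> x \<le> \<alpha>hi"
begin

abbreviation a where "a \<equiv> form_a \<nu> \<sigma>"
abbreviation energy where "energy \<equiv> energy_norm \<nu> \<sigma>"

lemma alpha_le: "\<alpha>lo \<le> \<alpha>hi"
  using coefficient_bounds(1)[of 0] by linarith

text \<open>Any weak gradients may be inserted into the form. Since sums and multiples of weak gradients are weak
gradients of the sums and multiples, sesquilinearity of the form follows.\<close>

lemma form_a_weak_gradient:
  assumes u: "square_int u" "weak_gradient u g" and v: "square_int v" "weak_gradient v h"
  shows "a u v = (\<Sum>i\<in>UNIV. l2ip (\<lambda>x. complex_of_real (\<nu> x) * g x $ i) (\<lambda>x. h x $ i))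
     + l2ip (\<lambda>x. complex_of_real (\<sigma> x) * u x) v"
proof -
  have gu: "weak_gradient u (grad u)" and gv: "weak_gradient v (grad v)"
    unfolding grad_def by (rule someI[of "weak_gradient u", OF u(2)], rule someI[of "weak_gradient v", OF v(2)])
  have sq: "square_int (\<lambda>x. g x $ i)" "square_int (\<lambda>x. h x $ i)"
     "square_int (\<lambda>x. grad u x $ i)" "square_int (\<lambda>x. grad v x $ i)" for i
    using u(2) v(2) gu gv unfolding weak_gradient_def by blast+
  note weight = square_int_weight[OF continuous_coefficients(1) coefficient_bounds(1) less_imp_le[OF alpha_pos]]
  have "integral\<^sup>L cellM (\<lambda>x. complex_of_real (\<nu> x) * (\<Sum>i\<in>UNIV. grad u x $ i * cnj (grad v x $ i)))
      = integral\<^sup>L cellM (\<lambda>x. \<Sum>i\<in>UNIV. (complex_of_real (\<nu> x) * grad u x $ i) * cnj (grad v x $ i))"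
    by (simp only: sum_distrib_left mult.assoc)
  also have "\<dots> = (\<Sum>i\<in>UNIV. l2ip (\<lambda>x. complex_of_real (\<nu> x) * grad u x $ i) (\<lambda>x. grad v x $ i))"
    unfolding l2ip_def
    by (rule Bochner_Integration.integral_sum) (rule square_int_mult_integrable[OF weight[OF sq(3)] sq(4)])
  also have "\<dots> = (\<Sum>i\<in>UNIV. l2ip (\<lambda>x. complex_of_real (\<nu> x) * g x $ i) (\<lambda>x. h x $ i))"
  proof (rule sum.cong[OF refl])
    fix i
    show "l2ip (\<lambda>x. complex_of_real (\<nu> x) * grad u x $ i) (\<lambda>x. grad v x $ i)
        = l2ip (\<lambda>x. complex_of_real (\<nu> x) * g x $ i) (\<lambda>x. h x $ i)"
    proof (rule l2ip_cong_AE)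
      show "AE x in cellM. complex_of_real (\<nu> x) * grad u x $ i = complex_of_real (\<nu> x) * g x $ i"
        using weak_gradient_unique[OF gu u(2), of i] by eventually_elim simp
      show "AE x in cellM. grad v x $ i = h x $ i"
        by (rule weak_gradient_unique[OF gv v(2)])
    qed (rule weight sq)+
  qed
  finally show ?thesis by (simp add: form_a_def l2ip_def mult.assoc)
qed

lemma form_add_left:
  assumes "u \<in> H1p" "v \<in> H1p" "w \<in> H1p"
  shows "a (\<lambda>x. u x + v x) w = a u w + a v w"
proof -
  note sq = assms[THEN H1p_square_int] and g = assms[THEN weak_gradient_grad]
  have sg: "square_int (\<lambda>x. grad u x $ i)" "square_int (\<lambda>x. grad v x $ i)" "square_int (\<lambda>x. grad w x $ i)" for i
    using g unfolding weak_gradient_def by blast+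
  note weight = square_int_weight[OF continuous_coefficients(1) coefficient_bounds(1) less_imp_le[OF alpha_pos]]
    square_int_weight[OF continuous_coefficients(2) coefficient_bounds(2) less_imp_le[OF alpha_pos]]
  show ?thesis
    unfolding form_a_weak_gradient[OF sq(1) g(1) sq(3) g(3)] form_a_weak_gradient[OF sq(2) g(2) sq(3) g(3)]
      form_a_weak_gradient[OF square_int_add[OF sq(1,2)] weak_gradient_add[OF sq(1,2) g(1,2)] sq(3) g(3)]
    by (simp add: distrib_left l2ip_add_left weight sg sq sum.distrib)
qed

lemma form_cmult_left:
  assumes "u \<in> H1p" "w \<in> H1p"
  shows "a (\<lambda>x. c * u x) w = c * a u w"
proof -
  note sq = assms[THEN H1p_square_int] and g = assms[THEN weak_gradient_grad]
  have "(\<lambda>x. complex_of_real (\<rho> x) * (c * y x)) = (\<lambda>x. c * (complex_of_real (\<rho> x) * y x))"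
    for \<rho> and y :: "real^'d \<Rightarrow> complex"
    by (rule ext) simp
  then show ?thesis
    unfolding form_a_weak_gradient[OF sq(1) g(1) sq(2) g(2)]
      form_a_weak_gradient[OF square_int_cmult[OF sq(1)] weak_gradient_cmult[OF g(1)] sq(2) g(2)]
    by (simp only: vector_smult_component l2ip_cmult_left sum_distrib_left distrib_left)
qed

lemma form_cnj:
  assumes "u \<in> H1p" "w \<in> H1p"
  shows "a w u = cnj (a u w)"
proof -
  note sq = assms[THEN H1p_square_int] and g = assms[THEN weak_gradient_grad]
  show ?thesis
    unfolding form_a_weak_gradient[OF sq(1) g(1) sq(2) g(2)] form_a_weak_gradient[OF sq(2) g(2) sq(1) g(1)]
      complex_cnj_add cnj_sum
    by (intro arg_cong2[where f="(+)"] sum.cong refl l2ip_weight_cnj)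
qed

lemma form_add_right:
  assumes "u \<in> H1p" "v \<in> H1p" "w \<in> H1p"
  shows "a w (\<lambda>x. u x + v x) = a w u + a w v"
  using form_cnj[OF H1p_add[OF assms(1,2)] assms(3)] form_cnj[OF assms(1,3)] form_cnj[OF assms(2,3)]
    form_add_left[OF assms] by simp

lemma form_cmult_right:
  assumes "u \<in> H1p" "w \<in> H1p"
  shows "a w (\<lambda>x. c * u x) = cnj c * a w u"
  using form_cnj[OF H1p_cmult[OF assms(1)] assms(2)] form_cnj[OF assms]
    form_cmult_left[OF assms] by simp

lemma form_diff_left:
  assumes "u \<in> H1p" "v \<in> H1p" "w \<in> H1p"
  shows "a (\<lambda>x. u x - v x) w = a u w - a v w"
  using form_add_left[OF assms(1) H1p_cmult[OF assms(2), of "-1"] assms(3)]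
    form_cmult_left[OF assms(2,3), of "-1"] by simp

lemma form_diff_right:
  assumes "u \<in> H1p" "v \<in> H1p" "w \<in> H1p"
  shows "a w (\<lambda>x. u x - v x) = a w u - a w v"
  using form_add_right[OF assms(1) H1p_cmult[OF assms(2), of "-1"] assms(3)]
    form_cmult_right[OF assms(2,3), of "-1"] by simp

lemma form_zero_right:
  assumes "w \<in> H1p"
  shows "a w (\<lambda>x. 0) = 0"
  using form_cmult_right[OF H1p_zero assms, of 0] by simp

lemma form_sum_right:
  assumes "w \<in> H1p" "\<And>i. i \<in> I \<Longrightarrow> v i \<in> H1p"
  shows "a w (\<lambda>x. \<Sum>i\<in>I. v i x) = (\<Sum>i\<in>I. a w (v i))"
  using assms(2)
proof (induction I rule: infinite_finite_induct)
  case (insert i I)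
  then have "v i \<in> H1p" "(\<lambda>x. \<Sum>i\<in>I. v i x) \<in> H1p" by (auto intro: H1p_sum)
  from form_add_right[OF this assms(1)] insert show ?case by simp
qed (simp_all add: form_zero_right assms(1))

lemma form_trig_right:
  assumes "w \<in> H1p"
  shows "a w (\<lambda>x. \<Sum>k\<in>S. c k * phi k x) = (\<Sum>k\<in>S. cnj (c k) * a w (phi k))"
proof -
  have "a w (\<lambda>x. \<Sum>k\<in>S. c k * phi k x) = (\<Sum>k\<in>S. a w (\<lambda>x. c k * phi k x))"
    by (rule form_sum_right[OF assms]) (rule H1p_cmult[OF H1p_phi])
  then show ?thesis by (simp only: form_cmult_right[OF H1p_phi assms])
qed

lemma form_trig_left:
  assumes "w \<in> H1p"
  shows "a (\<lambda>x. \<Sum>k\<in>S. c k * phi k x) w = (\<Sum>k\<in>S. c k * a (phi k) w)"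
proof -
  have "a (\<lambda>x. \<Sum>k\<in>S. c k * phi k x) w = cnj (a w (\<lambda>x. \<Sum>k\<in>S. c k * phi k x))"
    by (rule form_cnj[OF assms H1p_trig])
  also have "\<dots> = (\<Sum>k\<in>S. c k * cnj (a w (phi k)))"
    by (simp add: form_trig_right[OF assms])
  finally show ?thesis by (simp only: form_cnj[OF assms H1p_phi])
qed

lemma form_coercive_bounded:
  assumes "v \<in> H1p"
  shows "\<alpha>lo * (H1_norm v)\<^sup>2 \<le> Re (a v v)" "Re (a v v) \<le> \<alpha>hi * (H1_norm v)\<^sup>2"
proof -
  note sq = assms[THEN H1p_square_int] and g = assms[THEN weak_gradient_grad]
  have sg: "square_int (\<lambda>x. grad v x $ i)" for i
    using g unfolding weak_gradient_def by blast
  note bn = l2ip_weight_bounds[OF continuous_coefficients(1) coefficient_bounds(1) less_imp_le[OF alpha_pos] sg]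
    and bs = l2ip_weight_bounds[OF continuous_coefficients(2) coefficient_bounds(2) less_imp_le[OF alpha_pos] sq]
  have H: "c * (H1_norm v)\<^sup>2 = (\<Sum>i\<in>UNIV. c * l2sq (\<lambda>x. grad v x $ i)) + c * l2sq v" for c
    by (simp add: H1_norm_eq_gradient(2)[OF sq g] distrib_left sum_distrib_left)
  show "\<alpha>lo * (H1_norm v)\<^sup>2 \<le> Re (a v v)" "Re (a v v) \<le> \<alpha>hi * (H1_norm v)\<^sup>2"
    unfolding form_a_weak_gradient[OF sq g sq g] plus_complex.sel Re_sum H
    by (intro add_mono sum_mono bn bs)+
qed

lemma form_self: 
  assumes "v \<in> H1p"
  shows "a v v = complex_of_real ((energy v)\<^sup>2)" "0 \<le> energy v"
proof -
  have nn: "0 \<le> Re (a v v)"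
    using form_coercive_bounded(1)[OF assms] alpha_pos
    by (meson less_imp_le mult_nonneg_nonneg order_trans zero_le_power2)
  have "Im (a v v) = 0" using form_cnj[OF assms assms] by (simp add: complex_eq_iff)
  then show "a v v = complex_of_real ((energy v)\<^sup>2)"
    using nn by (simp add: complex_eq_iff energy_norm_def)
  show "0 \<le> energy v" using nn by (simp add: energy_norm_def)
qed

lemma energy_lower:
  assumes "v \<in> H1p"
  shows "sqrt \<alpha>lo * H1_norm v \<le> energy v"
proof (rule power2_le_imp_le[OF _ form_self(2)[OF assms]])
  show "(sqrt \<alpha>lo * H1_norm v)\<^sup>2 \<le> (energy v)\<^sup>2"
    using form_coercive_bounded(1)[OF assms] form_self(1)[OF assms] alpha_pos
    by (simp add: power_mult_distrib)
qed

lemma energy_upper: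
  assumes "v \<in> H1p"
  shows "energy v \<le> sqrt \<alpha>hi * H1_norm v"
proof (rule power2_le_imp_le)
  show "(energy v)\<^sup>2 \<le> (sqrt \<alpha>hi * H1_norm v)\<^sup>2"
    using form_coercive_bounded(2)[OF assms] form_self(1)[OF assms] alpha_pos alpha_le
    by (simp add: power_mult_distrib)
  show "0 \<le> sqrt \<alpha>hi * H1_norm v"
    using alpha_pos alpha_le by (intro mult_nonneg_nonneg H1_norm_nonneg) simp
qed

text \<open>The discriminant argument along $u - t\, a(u,v)\, v$ with real $t$; the factor $a(u,v)$ makes the linear
term real.\<close>

lemma form_Cauchy_Schwarz:
  assumes u: "u \<in> H1p" and v: "v \<in> H1p"
  shows "cmod (a u v) \<le> energy u * energy v"
proof -
  define A where "A = (cmod (a u v))\<^sup>2"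
  define Eu where "Eu = (energy u)\<^sup>2"
  define Ev where "Ev = (energy v)\<^sup>2"
  have quad: "0 \<le> Eu - 2 * t * A + t\<^sup>2 * A * Ev" for t
  proof -
    define c where "c = complex_of_real t * a u v"
    note cv = H1p_cmult[OF v, of c]
    have z: "(\<lambda>x. u x - c * v x) \<in> H1p" by (rule H1p_diff[OF u cv])
    have aa: "a u v * cnj (a u v) = of_real A"
      unfolding A_def by (rule complex_norm_square[symmetric])
    have "a (\<lambda>x. u x - c * v x) (\<lambda>x. u x - c * v x)
        = a u u - cnj c * a u v - (c * a v u - c * (cnj c * a v v))"
      by (simp add: form_diff_left[OF u cv z] form_diff_right[OF u cv] form_cmult_left[OF v]
          form_cmult_right[OF v] u v cv right_diff_distrib)
    also have "\<dots> = of_real Eu - of_real t * of_real A - (of_real t * of_real A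
        - of_real t * of_real t * of_real A * of_real Ev)"
      unfolding form_cnj[OF u v] form_self(1)[OF u] form_self(1)[OF v] c_def aa[symmetric] Eu_def Ev_def
      by (simp add: mult_ac)
    also have "\<dots> = of_real (Eu - 2 * t * A + t\<^sup>2 * A * Ev)"
      by (simp add: power2_eq_square)
    finally have "(energy (\<lambda>x. u x - c * v x))\<^sup>2 = Eu - 2 * t * A + t\<^sup>2 * A * Ev"
      unfolding form_self(1)[OF z] by (simp only: of_real_eq_iff)
    then show ?thesis by (metis zero_le_power2)
  qed
  have "A \<le> Eu * Ev"
  proof (cases "Ev = 0")
    case True
    have "A = 0"
    proof (rule ccontr)
      assume "A \<noteq> 0"
      \<comment> \<open>the quadratic function of \<open>t\<close> degenerates to a linear one, which takes the value -1 here\<close>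
      then show False using quad[of "(Eu + 1) / (2 * A)"] True by simp
    qed
    then show ?thesis by (simp add: Eu_def Ev_def)
  next
    case False
    then have "Ev > 0" by (simp add: Ev_def)
    \<comment> \<open>the minimizer of the quadratic function\<close>
    then show ?thesis using quad[of "1 / Ev"] by (simp add: field_simps power2_eq_square)
  qed
  then have "(cmod (a u v))\<^sup>2 \<le> (energy u * energy v)\<^sup>2"
    by (simp add: A_def Eu_def Ev_def power_mult_distrib)
  then show ?thesis
    by (rule power2_le_imp_le) (intro mult_nonneg_nonneg form_self u v)
qed

text \<open>Optimality of Galerkin solutions: if $z$ is an error orthogonal to the trial space, and $y$ is the error of
a competitor, then $z - y$ lies in the trial space.\<close>

lemma energy_orthogonal_le:
  assumes z: "z \<in> H1p" and y: "y \<in> H1p" and orth: "a z (\<lambda>x. z x - y x) = 0"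
  shows "energy z \<le> energy y"
proof -
  have "a z z = a z y" using orth form_diff_right[OF z y z] by simp
  then have "a z y = complex_of_real ((energy z)\<^sup>2)" using form_self(1)[OF z] by simp
  then have "(energy z)\<^sup>2 = cmod (a z y)" by (simp only: norm_of_real abs_power2)
  then have "energy z * energy z \<le> energy z * energy y"
    using form_Cauchy_Schwarz[OF z y] by (simp add: power2_eq_square)
  then show ?thesis
    using form_self(2)[OF z] form_self(2)[OF y] by (cases "energy z = 0") auto
qed

lemma energy_Pythagoras:
  assumes z: "z \<in> H1p" and w: "w \<in> H1p" and orth: "a z w = 0"
  shows "(energy (\<lambda>x. z x + w x))\<^sup>2 = (energy z)\<^sup>2 + (energy w)\<^sup>2"
proof -
  have "a w z = 0" using form_cnj[OF z w] orth by simp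
  then have "a (\<lambda>x. z x + w x) (\<lambda>x. z x + w x) = a z z + a w w"
    using orth form_add_left[OF z w H1p_add[OF z w]] form_add_right[OF z w z] form_add_right[OF z w w]
    by simp
  then show ?thesis
    unfolding form_self(1)[OF z] form_self(1)[OF w] form_self(1)[OF H1p_add[OF z w]]
    by (simp only: of_real_add[symmetric] of_real_eq_iff)
qed

end

section \<open>Riesz coordinates\<close>

text \<open>The weights $c_k$ of the stiffness matrix.\<close>

definition sobolev_weight :: "int^'d \<Rightarrow> real" where
  "sobolev_weight k = sqrt (1 + (norm (lat k))\<^sup>2)"

text \<open>Coordinates in which the norm of $H^1_p$ and its dual norm become the $\ell^2$ norm.\<close>

definition primal_coords :: "(real^'d \<Rightarrow> complex) \<Rightarrow> int^'d \<Rightarrow> complex" where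
  "primal_coords v = (\<lambda>k. of_real (sobolev_weight k) * fcoeff v k)"

definition dual_coords :: "('d::finite) functional \<Rightarrow> int^'d \<Rightarrow> complex" where
  "dual_coords r = (\<lambda>k. r (phi k) / of_real (sobolev_weight k))"

text \<open>The trigonometric polynomial whose primal coordinates are those of $x$ on $N$ and zero elsewhere.\<close>

definition synthesis :: "(int^'d) set \<Rightarrow> (int^'d \<Rightarrow> complex) \<Rightarrow> real^'d \<Rightarrow> complex" where
  "synthesis N x = (\<lambda>y. \<Sum>k\<in>N. (x k / of_real (sobolev_weight k)) * phi k y)"

lemma sobolev_weight_pos: "0 < sobolev_weight k"
  by (simp add: sobolev_weight_def add_pos_nonneg)

lemma sobolev_weight_nonzero [simp]: "sobolev_weight k \<noteq> 0"
  using sobolev_weight_pos[of k] by simp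

lemma sobolev_weight_sq: "(sobolev_weight k)\<^sup>2 = 1 + (norm (lat k))\<^sup>2"
  by (simp add: sobolev_weight_def)

lemma cmod_primal_coords_sq: "(cmod (primal_coords v k))\<^sup>2 = (1 + (norm (lat k))\<^sup>2) * (cmod (fcoeff v k))\<^sup>2"
  unfolding primal_coords_def norm_mult norm_of_real power_mult_distrib power2_abs sobolev_weight_sq ..

lemma H1_norm_eq_ell2: "H1_norm v = ell2_norm (primal_coords v)"
  by (simp only: H1_norm_def ell2_norm_def cmod_primal_coords_sq)

lemma dual_norm_eq_ell2: "dual_norm r = ell2_norm (dual_coords r)"
proof -
  have "(cmod (dual_coords r k))\<^sup>2 = inverse (1 + (norm (lat k))\<^sup>2) * (cmod (r (phi k)))\<^sup>2" for k
    unfolding dual_coords_def norm_divide norm_of_real power_divide power2_abs sobolev_weight_sq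
    by (simp only: divide_inverse mult.commute)
  then show ?thesis by (simp only: dual_norm_def ell2_norm_def)
qed

lemma primal_coords_ell2:
  assumes "v \<in> H1p"
  shows "primal_coords v \<in> ell2"
  unfolding ell2_def mem_Collect_eq cmod_primal_coords_sq
  by (rule H1_norm_eq_gradient(1)[OF H1p_square_int[OF assms] weak_gradient_grad[OF assms]])

lemma synthesis_H1p: "synthesis N x \<in> H1p"
  unfolding synthesis_def by (rule H1p_trig)

lemma synthesis_trig_space:
  assumes "finite N" "N \<subseteq> \<Lambda>"
  shows "synthesis N x \<in> trig_space \<Lambda>"
  unfolding synthesis_def using assms by (rule trig_spaceI)

lemma primal_coords_synthesis:
  assumes "finite N"
  shows "primal_coords (synthesis N x) = (\<lambda>k. if k \<in> N then x k else 0)"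
  unfolding primal_coords_def synthesis_def fcoeff_trig[OF assms] by auto

lemma primal_coords_diff:
  assumes "v \<in> H1p" "w \<in> H1p"
  shows "primal_coords (\<lambda>x. v x - w x) = (\<lambda>k. primal_coords v k - primal_coords w k)"
  unfolding primal_coords_def
  by (rule ext) (simp add: fcoeff_diff assms H1p_square_int right_diff_distrib)

lemma trig_space_density:
  assumes "v \<in> H1p" "0 < e"
  obtains N where "finite N" "H1_norm (\<lambda>x. v x - synthesis N (primal_coords v) x) \<le> e"
proof -
  obtain N where N: "finite N"
    "ell2_norm (\<lambda>k. if k \<in> N then 0 else primal_coords v k) \<le> e"
    by (rule ell2_tail[OF primal_coords_ell2[OF assms(1)] assms(2)])
  have "primal_coords (\<lambda>x. v x - synthesis N (primal_coords v) x) = (\<lambda>k. if k \<in> N then 0 else primal_coords v k)"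
    unfolding primal_coords_diff[OF assms(1) synthesis_H1p] primal_coords_synthesis[OF N(1)] by auto
  then show ?thesis using N that by (simp add: H1_norm_eq_ell2)
qed

lemma le_if_le_affine:
  fixes x :: real
  assumes "\<And>\<delta>. 0 < \<delta> \<Longrightarrow> x \<le> y + b * \<delta>"
  shows "x \<le> y"
proof (rule field_le_epsilon)
  fix e :: real assume e: "0 < e"
  define \<delta> where "\<delta> = e / (\<bar>b\<bar> + 1)"
  have \<delta>: "0 < \<delta>" "(\<bar>b\<bar> + 1) * \<delta> = e" using e by (auto simp: \<delta>_def)
  have "b * \<delta> \<le> (\<bar>b\<bar> + 1) * \<delta>" using \<delta>(1) by (intro mult_right_mono) auto
  then show "x \<le> y + e" using assms[OF \<delta>(1)] \<delta>(2) by linarith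
qed

context elliptic_form
begin

abbreviation A where "A \<equiv> stiffness \<nu> \<sigma>"

lemma form_synthesis_right:
  assumes "e \<in> H1p"
  shows "a e (synthesis N x) = (\<Sum>k\<in>N. dual_coords (a e) k * cnj (x k))"
  unfolding synthesis_def form_trig_right[OF assms] dual_coords_def
  by (rule sum.cong) auto

text \<open>The sum $S$ of the squared dual coordinates over a finite set equals $a(e, V)$ for the trigonometric
polynomial $V$ with these coordinates, and $\|V\| = \sqrt S$. So Cauchy--Schwarz in the energy bounds
$\sqrt S$.\<close>

lemma dual_coords_form:
  assumes "e \<in> H1p"
  shows "dual_coords (a e) \<in> ell2" "ell2_norm (dual_coords (a e)) \<le> sqrt \<alpha>hi * energy e"
proof -
  let ?d = "dual_coords (a e)"
  have c: "0 \<le> sqrt \<alpha>hi * energy e"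
    using alpha_pos alpha_le form_self(2)[OF assms] by (intro mult_nonneg_nonneg) auto
  have bound: "(\<Sum>k\<in>F. (cmod (?d k))\<^sup>2) \<le> (sqrt \<alpha>hi * energy e)\<^sup>2" if F: "finite F" for F
  proof -
    define s where "s = (\<Sum>k\<in>F. (cmod (?d k))\<^sup>2)"
    define V where "V = synthesis F ?d"
    have V: "V \<in> H1p" unfolding V_def by (rule synthesis_H1p)
    have s0: "0 \<le> s" by (simp add: s_def sum_nonneg)
    have "(H1_norm V)\<^sup>2 = s"
      unfolding H1_norm_eq_ell2 V_def primal_coords_synthesis[OF F] s_def
      by (subst ell2_finite_support(2)[OF F]) auto
    then have nV: "H1_norm V = sqrt s" using H1_norm_nonneg[of V] by (metis real_sqrt_unique)
    have "a e V = complex_of_real s"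
      unfolding V_def form_synthesis_right[OF assms] s_def of_real_sum complex_norm_square ..
    then have "s = cmod (a e V)" using s0 by simp
    also have "\<dots> \<le> energy e * energy V" by (rule form_Cauchy_Schwarz[OF assms V])
    also have "\<dots> \<le> energy e * (sqrt \<alpha>hi * sqrt s)"
      using energy_upper[OF V] form_self(2)[OF assms] unfolding nV by (rule mult_left_mono)
    finally have *: "sqrt s * sqrt s \<le> (sqrt \<alpha>hi * energy e) * sqrt s" using s0 by (simp add: mult_ac)
    have "sqrt s \<le> sqrt \<alpha>hi * energy e"
    proof (cases "s = 0")
      case False
      then have "0 < sqrt s" using s0 by simp
      with * show ?thesis by (rule mult_right_le_imp_le)
    qed (use c in simp)
    then have "(sqrt s)\<^sup>2 \<le> (sqrt \<alpha>hi * energy e)\<^sup>2" using s0 by (intro power_mono) auto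
    then show ?thesis using s0 by (simp add: s_def)
  qed
  from ell2I[OF c bound] show "?d \<in> ell2" "ell2_norm ?d \<le> sqrt \<alpha>hi * energy e" by auto
qed

text \<open>For trigonometric polynomials this is the Cauchy--Schwarz inequality in $\ell^2$, and they are dense in
$H^1_p$.\<close>

lemma form_le_dual:
  assumes e: "e \<in> H1p" and v: "v \<in> H1p"
  shows "cmod (a e v) \<le> ell2_norm (dual_coords (a e)) * H1_norm v"
proof -
  define D where "D = ell2_norm (dual_coords (a e))"
  have "cmod (a e v) \<le> D * H1_norm v + energy e * (sqrt \<alpha>hi * \<delta>)" if \<delta>: "0 < \<delta>" for \<delta>
  proof -
    obtain N where N: "finite N" "H1_norm (\<lambda>x. v x - synthesis N (primal_coords v) x) \<le> \<delta>"
      using trig_space_density[OF v \<delta>] by blast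
    let ?S = "synthesis N (primal_coords v)"
    have S: "?S \<in> H1p" by (rule synthesis_H1p)
    note d = H1p_diff[OF v S]
    have "cmod (a e ?S) \<le> D * H1_norm v"
    proof -
      have "cmod (a e ?S) \<le> (\<Sum>k\<in>N. cmod (dual_coords (a e) k) * cmod (primal_coords v k))"
        unfolding form_synthesis_right[OF e]
        by (rule order_trans[OF norm_sum]) (simp add: norm_mult)
      also have "\<dots> \<le> D * H1_norm v"
        unfolding D_def H1_norm_eq_ell2
        by (rule ell2_mult_le[OF dual_coords_form(1)[OF e] primal_coords_ell2[OF v] N(1)])
      finally show ?thesis .
    qed
    moreover have "cmod (a e (\<lambda>x. v x - ?S x)) \<le> energy e * (sqrt \<alpha>hi * \<delta>)"
    proof (rule order_trans[OF form_Cauchy_Schwarz[OF e d]])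
      have "energy (\<lambda>x. v x - ?S x) \<le> sqrt \<alpha>hi * \<delta>"
        by (rule order_trans[OF energy_upper[OF d] mult_left_mono[OF N(2)]])
           (use alpha_pos alpha_le in simp)
      then show "energy e * energy (\<lambda>x. v x - ?S x) \<le> energy e * (sqrt \<alpha>hi * \<delta>)"
        using form_self(2)[OF e] by (rule mult_left_mono)
    qed
    moreover have "a e v = a e ?S + a e (\<lambda>x. v x - ?S x)" by (simp add: form_diff_right[OF v S e])
    ultimately show ?thesis
      using norm_triangle_ineq[of "a e ?S" "a e (\<lambda>x. v x - ?S x)"] by simp
  qed
  note step = this
  have "cmod (a e v) \<le> D * H1_norm v"
  proof (rule le_if_le_affine[where b="energy e * sqrt \<alpha>hi"])
    show "cmod (a e v) \<le> D * H1_norm v + energy e * sqrt \<alpha>hi * \<delta>" if "0 < \<delta>" for \<delta>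
      using step[OF that] by (simp only: mult.assoc)
  qed
  then show ?thesis by (simp add: D_def)
qed

text \<open>Take $v = e$ in the duality bound and compare the norm of $H^1_p$ with the energy norm.\<close>

lemma energy_le_dual:
  assumes e: "e \<in> H1p"
  shows "sqrt \<alpha>lo * energy e \<le> ell2_norm (dual_coords (a e))"
proof -
  let ?D = "ell2_norm (dual_coords (a e))"
  have "(energy e)\<^sup>2 = cmod (a e e)"
    unfolding form_self(1)[OF e] by (simp only: norm_of_real abs_power2)
  also have "\<dots> \<le> ?D * H1_norm e" by (rule form_le_dual[OF e e])
  finally have "sqrt \<alpha>lo * (energy e)\<^sup>2 \<le> sqrt \<alpha>lo * (?D * H1_norm e)"
    using alpha_pos by (intro mult_left_mono) auto
  also have "\<dots> = ?D * (sqrt \<alpha>lo * H1_norm e)" by simp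
  also have "\<dots> \<le> ?D * energy e" by (rule mult_left_mono[OF energy_lower[OF e]]) simp
  finally have "(sqrt \<alpha>lo * energy e) * energy e \<le> ?D * energy e"
    by (simp add: power2_eq_square mult_ac)
  then show ?thesis using form_self(2)[OF e] by (cases "energy e = 0") auto
qed

section \<open>The stiffness matrix\<close>

text \<open>The stiffness matrix maps the primal coordinates of a trigonometric polynomial to the dual coordinates of
its image under the elliptic operator. Boundedness and coercivity of its finite sections are therefore
those of the form.\<close>

lemma stiffness_apply:
  "(\<Sum>k\<in>N. A l k * z k) = dual_coords (a (synthesis N z)) l"
proof -
  have "a (synthesis N z) (phi l) = (\<Sum>k\<in>N. (z k / of_real (sobolev_weight k)) * a (phi k) (phi l))"
    unfolding synthesis_def by (rule form_trig_left[OF H1p_phi])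
  then show ?thesis
    unfolding dual_coords_def stiffness_def sobolev_weight_def[symmetric]
    by (simp only: of_real_mult sum_divide_distrib)
       (rule sum.cong, simp_all add: field_simps)
qed

lemma ell2_norm_synthesis:
  assumes "finite N"
  shows "(H1_norm (synthesis N z))\<^sup>2 = (\<Sum>k\<in>N. (cmod (z k))\<^sup>2)"
  unfolding H1_norm_eq_ell2 primal_coords_synthesis[OF assms]
  by (subst ell2_finite_support(2)[OF assms]) auto

lemma stiffness_finite_sections:
  assumes S: "finite S" and N: "finite N"
  shows "(\<Sum>l\<in>S. (cmod (\<Sum>k\<in>N. A l k * z k))\<^sup>2) \<le> \<alpha>hi\<^sup>2 * (\<Sum>k\<in>N. (cmod (z k))\<^sup>2)"
proof -
  let ?W = "synthesis N z"
  have W: "?W \<in> H1p" by (rule synthesis_H1p)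
  have "(\<Sum>l\<in>S. (cmod (\<Sum>k\<in>N. A l k * z k))\<^sup>2) \<le> (ell2_norm (dual_coords (a ?W)))\<^sup>2"
    unfolding stiffness_apply by (rule ell2_finite_sum_le[OF dual_coords_form(1)[OF W] S])
  also have "\<dots> \<le> (sqrt \<alpha>hi * (sqrt \<alpha>hi * H1_norm ?W))\<^sup>2"
  proof (rule power_mono[OF _ ell2_norm_nonneg])
    have "sqrt \<alpha>hi * energy ?W \<le> sqrt \<alpha>hi * (sqrt \<alpha>hi * H1_norm ?W)"
      using alpha_pos alpha_le by (intro mult_left_mono energy_upper W) auto
    then show "ell2_norm (dual_coords (a ?W)) \<le> sqrt \<alpha>hi * (sqrt \<alpha>hi * H1_norm ?W)"
      using dual_coords_form(2)[OF W] by linarith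
  qed
  also have "\<dots> = \<alpha>hi\<^sup>2 * (H1_norm ?W)\<^sup>2"
    using alpha_pos alpha_le by (simp add: power_mult_distrib power2_eq_square)
  finally show ?thesis by (simp only: ell2_norm_synthesis[OF N])
qed

lemma stiffness_coercive:
  assumes N: "finite N"
  shows "\<alpha>lo * (\<Sum>k\<in>N. (cmod (z k))\<^sup>2) \<le> Re (\<Sum>l\<in>N. (\<Sum>k\<in>N. A l k * z k) * cnj (z l))"
  unfolding stiffness_apply form_synthesis_right[OF synthesis_H1p, symmetric]
    ell2_norm_synthesis[OF N, symmetric]
  by (rule form_coercive_bounded(1)[OF synthesis_H1p])

lemma stiffness_bijective: "bij_betw (mat_apply A) ell2 ell2"
  by (rule coercive_matrix_bijective[OF alpha_pos alpha_le stiffness_finite_sections stiffness_coercive])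

lemma stiffness_bounded: "opnorm_le A \<alpha>hi"
  by (rule opnorm_leI_finite_sections[OF _ stiffness_finite_sections])
     (use alpha_pos alpha_le in auto)

section \<open>One step of the algorithm\<close>

lemma dual_coords_diff:
  assumes "e \<in> H1p" "w \<in> H1p"
  shows "dual_coords (a (\<lambda>x. e x - w x)) = (\<lambda>k. dual_coords (a e) k - dual_coords (a w) k)"
  unfolding dual_coords_def form_diff_left[OF assms H1p_phi] by (simp add: diff_divide_distrib)

lemma form_orthogonal_swap:
  assumes z: "z \<in> H1p" and orth: "\<And>v. v \<in> trig_space \<Lambda> \<Longrightarrow> a z v = 0" and v: "v \<in> trig_space \<Lambda>"
  shows "a v z = 0"
proof -
  have "v \<in> H1p" using v trig_space_H1p by blast
  from form_cnj[OF z this] orth[OF v] show ?thesis by simp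
qed

text \<open>Here $e$ is the error before the step and $z$ the error of the Galerkin solution in a space that contains
the modes of the enriched set. Let $x$ solve $\mathbf A x = r|_T$, where $r = \mathbf A e$ in coordinates.
A finite section $W$ of $x$ and its restriction $P$ to the trial space split the energy of $z$ as
$a(z,z) = a(e - W, z) + a(W - P, z)$, because $z$ is orthogonal to $e - z$ and to $P$. The first part is
controlled by the residual left outside $T$, the second by the part of $x$ outside the enriched set. The
length of the section is then sent to infinity, which amounts to $\delta \to 0$.\<close>

lemma predictor_error:
  assumes e: "e \<in> H1p" and z: "z \<in> H1p" and diff: "(\<lambda>x. e x - z x) \<in> trig_space \<Lambda>"
    and orth: "\<And>v. v \<in> trig_space \<Lambda> \<Longrightarrow> a z v = 0"
    and T: "finite T" "enrich T J \<subseteq> \<Lambda>"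
    and tail: "ell2_norm (\<lambda>k. if k \<in> T then 0 else dual_coords (a e) k) \<le> s * ell2_norm (dual_coords (a e))"
    and s: "0 \<le> s"
    and trunc: "opnorm_le (\<lambda>l k. inverse_mat A l k - truncate (inverse_mat A) J l k) \<epsilon>"
    and \<epsilon>: "\<epsilon> \<le> s / sqrt (\<alpha>lo * \<alpha>hi)"
  shows "energy z \<le> 2 * s / sqrt \<alpha>lo * ell2_norm (dual_coords (a e))"
proof -
  let ?d = "dual_coords (a e)"
  define D where "D = ell2_norm ?d"
  have D0: "0 \<le> D" by (simp add: D_def)
  have hi: "0 < \<alpha>hi" using alpha_pos alpha_le by linarith
  have d: "?d \<in> ell2" by (rule dual_coords_form(1)[OF e])
  define y where "y = (\<lambda>k. if k \<in> T then ?d k else 0)"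
  have yT: "\<And>k. k \<notin> T \<Longrightarrow> y k = 0" by (simp add: y_def)
  obtain x where x: "x \<in> ell2" "mat_apply A x = y"
    and xtail: "ell2_norm (\<lambda>l. if l \<in> enrich T J then 0 else x l) \<le> \<epsilon> * ell2_norm y"
    by (rule localized_inverse[OF stiffness_bijective stiffness_bounded trunc T(1) yT])
  have yD: "ell2_norm y \<le> D"
    unfolding D_def by (rule ell2_mono(2)[OF d]) (simp add: y_def)
  define \<epsilon>0 where "\<epsilon>0 = s / sqrt (\<alpha>lo * \<alpha>hi)"
  have xtail': "ell2_norm (\<lambda>l. if l \<in> enrich T J then 0 else x l) \<le> \<epsilon>0 * D"
  proof -
    have "0 \<le> \<epsilon>0" using s alpha_pos hi by (simp add: \<epsilon>0_def)
    then have "\<epsilon> * ell2_norm y \<le> \<epsilon>0 * D"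
      using \<epsilon> yD by (intro mult_mono) (auto simp: \<epsilon>0_def)
    with xtail show ?thesis by linarith
  qed
  have step: "energy z \<le> (s * D + \<alpha>hi * \<delta>) / sqrt \<alpha>lo + sqrt \<alpha>hi * (\<epsilon>0 * D)" if \<delta>: "0 < \<delta>" for \<delta>
  proof -
    obtain N where N: "finite N" and xN: "(\<lambda>k. if k \<in> N then 0 else x k) \<in> ell2"
      "ell2_norm (\<lambda>k. if k \<in> N then 0 else x k) \<le> \<delta>"
      by (rule ell2_tail[OF x(1) \<delta>])
    let ?xN = "\<lambda>k. if k \<in> N then x k else 0"
    define W where "W = synthesis N x"
    define P where "P = synthesis (N \<inter> \<Lambda>) x"
    have W: "W \<in> H1p" and P: "P \<in> H1p" unfolding W_def P_def by (rule synthesis_H1p)+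
    note eW = H1p_diff[OF e W] and WP = H1p_diff[OF W P]
    have Pt: "P \<in> trig_space \<Lambda>" unfolding P_def by (rule synthesis_trig_space) (use N in auto)
    have aP: "a P z = 0" by (rule form_orthogonal_swap[OF z orth Pt])
    have aez: "a (\<lambda>x. e x - z x) z = 0" by (rule form_orthogonal_swap[OF z orth diff])
    have xNl: "?xN \<in> ell2" by (rule ell2_mono(1)[OF x(1)]) simp
    have eN: "sqrt \<alpha>lo * energy (\<lambda>x. e x - W x) \<le> s * D + \<alpha>hi * \<delta>"
    proof -
      have dW: "dual_coords (a W) l = mat_apply A ?xN l" for l
      proof -
        have "mat_apply A ?xN l = (\<Sum>k\<in>N. A l k * ?xN k)"
          by (rule mat_apply_finite[OF N]) simp
        also have "\<dots> = (\<Sum>k\<in>N. A l k * x k)" by (rule sum.cong) auto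
        finally show ?thesis by (simp only: stiffness_apply W_def)
      qed
      have xd: "(\<lambda>k. x k - ?xN k) = (\<lambda>k. if k \<in> N then 0 else x k)" by auto
      have dy: "(\<lambda>k. ?d k - y k) = (\<lambda>k. if k \<in> T then 0 else ?d k)" by (auto simp: y_def)
      have yl: "y \<in> ell2" using opnorm_leD(2)[OF stiffness_bounded x(1)] x(2) by simp
      \<comment> \<open>the unmarked part of the residual plus the image of the tail of \<open>x\<close>\<close>
      have "dual_coords (a (\<lambda>x. e x - W x)) = (\<lambda>l. (?d l - y l) + mat_apply A (\<lambda>k. if k \<in> N then 0 else x k) l)"
        unfolding dual_coords_diff[OF e W] dW xd[symmetric] mat_apply_diff[OF stiffness_bounded x(1) xNl] x(2)
        by (rule ext) simp
      then have "ell2_norm (dual_coords (a (\<lambda>x. e x - W x)))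
          \<le> ell2_norm (\<lambda>l. ?d l - y l) + ell2_norm (mat_apply A (\<lambda>k. if k \<in> N then 0 else x k))"
        using ell2_add(2)[OF ell2_diff(1)[OF d yl] opnorm_leD(2)[OF stiffness_bounded xN(1)]] by simp
      also have "ell2_norm (\<lambda>l. ?d l - y l) \<le> s * D" unfolding dy D_def by (rule tail)
      also have "ell2_norm (mat_apply A (\<lambda>k. if k \<in> N then 0 else x k)) \<le> \<alpha>hi * \<delta>"
        by (rule order_trans[OF opnorm_leD(3)[OF stiffness_bounded xN(1)] mult_left_mono[OF xN(2)]])
           (use hi in simp)
      finally show ?thesis using energy_le_dual[OF eW] by simp
    qed
    have eP: "energy (\<lambda>x. W x - P x) \<le> sqrt \<alpha>hi * (\<epsilon>0 * D)"
    proof -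
      \<comment> \<open>only indices outside the trial space remain, hence outside the enriched set\<close>
      have "primal_coords (\<lambda>x. W x - P x) = (\<lambda>k. if k \<in> N - \<Lambda> then x k else 0)"
        unfolding primal_coords_diff[OF W P]
        unfolding W_def P_def primal_coords_synthesis[OF N]
          primal_coords_synthesis[OF finite_Int[OF disjI1[OF N]]] by auto
      then have "H1_norm (\<lambda>x. W x - P x) = ell2_norm (\<lambda>k. if k \<in> N - \<Lambda> then x k else 0)"
        by (simp only: H1_norm_eq_ell2)
      also have "\<dots> \<le> ell2_norm (\<lambda>l. if l \<in> enrich T J then 0 else x l)"
        by (rule ell2_mono(2)[OF ell2_mono(1)[OF x(1)]]) (use T(2) in auto)
      also have "\<dots> \<le> \<epsilon>0 * D" by (rule xtail')
      finally have "sqrt \<alpha>hi * H1_norm (\<lambda>x. W x - P x) \<le> sqrt \<alpha>hi * (\<epsilon>0 * D)"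
        by (rule mult_left_mono) (use hi in simp)
      with energy_upper[OF WP] show ?thesis by linarith
    qed
    have split: "a z z = a (\<lambda>x. e x - W x) z + a (\<lambda>x. W x - P x) z"
      using aez aP form_diff_left[OF e z z] form_diff_left[OF e W z] form_diff_left[OF W P z] by simp
    have "(energy z)\<^sup>2 = cmod (a z z)"
      unfolding form_self(1)[OF z] by (simp only: norm_of_real abs_power2)
    also have "\<dots> = cmod (a (\<lambda>x. e x - W x) z + a (\<lambda>x. W x - P x) z)"
      by (simp only: split)
    also have "\<dots> \<le> cmod (a (\<lambda>x. e x - W x) z) + cmod (a (\<lambda>x. W x - P x) z)"
      by (rule norm_triangle_ineq)
    also have "\<dots> \<le> energy (\<lambda>x. e x - W x) * energy z + energy (\<lambda>x. W x - P x) * energy z"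
      by (intro add_mono form_Cauchy_Schwarz eW WP z)
    finally have *: "energy z * energy z \<le> (energy (\<lambda>x. e x - W x) + energy (\<lambda>x. W x - P x)) * energy z"
      by (simp add: power2_eq_square distrib_right)
    have "energy z \<le> energy (\<lambda>x. e x - W x) + energy (\<lambda>x. W x - P x)"
    proof (cases "energy z = 0")
      case True
      then show ?thesis using form_self(2)[OF eW] form_self(2)[OF WP] by simp
    next
      case False
      then have "0 < energy z" using form_self(2)[OF z] by simp
      with * show ?thesis by (rule mult_right_le_imp_le)
    qed
    moreover have "energy (\<lambda>x. e x - W x) \<le> (s * D + \<alpha>hi * \<delta>) / sqrt \<alpha>lo"
      using eN alpha_pos by (simp add: le_divide_eq mult.commute)
    ultimately show ?thesis using eP by linarith
  qed
  have "energy z \<le> s * D / sqrt \<alpha>lo + sqrt \<alpha>hi * (\<epsilon>0 * D)"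
  proof (rule le_if_le_affine[where b="\<alpha>hi / sqrt \<alpha>lo"])
    show "energy z \<le> s * D / sqrt \<alpha>lo + sqrt \<alpha>hi * (\<epsilon>0 * D) + \<alpha>hi / sqrt \<alpha>lo * \<delta>" if "0 < \<delta>" for \<delta>
      using step[OF that] by (simp add: add_divide_distrib)
  qed
  also have "\<dots> = 2 * s / sqrt \<alpha>lo * D"
    using alpha_pos hi by (simp add: \<epsilon>0_def real_sqrt_mult field_simps)
  finally show ?thesis by (simp add: D_def)
qed

text \<open>The error before coarsening is orthogonal to the difference of the two Galerkin solutions, which lies in
the larger trial space; this gives a sum of squares. The coarse solution is also the Galerkin projection
of the fine one, so that the second summand is bounded by the energy of the discarded part.\<close>

lemma coarsening_error:
  assumes u: "u \<in> H1p" and sub: "\<Lambda>' \<subseteq> \<Lambda>" and fin: "finite \<Lambda>'"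
    and what: "what \<in> trig_space \<Lambda>" "\<And>v. v \<in> trig_space \<Lambda> \<Longrightarrow> a (\<lambda>x. u x - what x) v = 0"
    and w: "w \<in> trig_space \<Lambda>'" "\<And>v. v \<in> trig_space \<Lambda>' \<Longrightarrow> a (\<lambda>x. u x - w x) v = 0"
    and c: "H1_norm (\<lambda>x. what x - proj \<Lambda>' what x) \<le> c"
  shows "(energy (\<lambda>x. u x - w x))\<^sup>2 \<le> (energy (\<lambda>x. u x - what x))\<^sup>2 + (sqrt \<alpha>hi * c)\<^sup>2"
proof -
  have H: "what \<in> H1p" "w \<in> H1p" using what(1) w(1) trig_space_H1p by blast+
  note uh = H1p_diff[OF u H(1)] and uw = H1p_diff[OF u H(2)] and hw = H1p_diff[OF H]
  let ?p = "proj \<Lambda>' what"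
  have pt: "?p \<in> trig_space \<Lambda>'" unfolding proj_def by (rule trig_spaceI[OF fin subset_refl])
  have p: "?p \<in> H1p" using pt trig_space_H1p by blast
  note hp = H1p_diff[OF H(1) p]
  have hi: "0 \<le> sqrt \<alpha>hi" using alpha_pos alpha_le by simp
  have "w \<in> trig_space \<Lambda>" using w(1) trig_space_mono[OF sub] by blast
  then have "(\<lambda>x. what x - w x) \<in> trig_space \<Lambda>" by (rule trig_space_diff[OF what(1)])
  then have "a (\<lambda>x. u x - what x) (\<lambda>x. what x - w x) = 0" by (rule what(2))
  from energy_Pythagoras[OF uh hw this]
  have pyth: "(energy (\<lambda>x. u x - w x))\<^sup>2 = (energy (\<lambda>x. u x - what x))\<^sup>2 + (energy (\<lambda>x. what x - w x))\<^sup>2"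
    by simp
  have orth: "a (\<lambda>x. what x - w x) v = 0" if v: "v \<in> trig_space \<Lambda>'" for v
  proof -
    have "v \<in> trig_space \<Lambda>" "v \<in> H1p" using v trig_space_mono[OF sub] trig_space_H1p by blast+
    then show ?thesis
      using what(2)[of v] w(2)[OF v] by (simp add: form_diff_left u H)
  qed
  have "energy (\<lambda>x. what x - w x) \<le> energy (\<lambda>x. what x - ?p x)"
  proof (rule energy_orthogonal_le[OF hw hp])
    have "(\<lambda>x. ?p x - w x) \<in> trig_space \<Lambda>'" by (rule trig_space_diff[OF pt w(1)])
    from orth[OF this] show "a (\<lambda>x. what x - w x) (\<lambda>x. what x - w x - (what x - ?p x)) = 0" by simp
  qed
  also have "\<dots> \<le> sqrt \<alpha>hi * H1_norm (\<lambda>x. what x - ?p x)" by (rule energy_upper[OF hp])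
  also have "\<dots> \<le> sqrt \<alpha>hi * c" by (rule mult_left_mono[OF c hi])
  finally have "(energy (\<lambda>x. what x - w x))\<^sup>2 \<le> (sqrt \<alpha>hi * c)\<^sup>2"
    by (intro power_mono form_self hw)
  then show ?thesis by (simp add: pyth)
qed

text \<open>With $\kappa = \alpha^* / \alpha_* \ge 1$ the two squares add up to
$4 (\kappa + \kappa^2) (s R)^2 / \alpha^* \le 8 \kappa^2 (s R)^2 / \alpha^*$, and $8 \le 3^2$.\<close>

lemma contraction_arithmetic:
  assumes "0 \<le> s" "0 \<le> R" "0 \<le> E"
    and E: "E\<^sup>2 \<le> (2 * s / sqrt \<alpha>lo * R)\<^sup>2 + (sqrt \<alpha>hi * (2 * (1 / \<alpha>lo * s * R)))\<^sup>2"
    and R: "R \<le> sqrt \<alpha>hi * E0" and E0: "0 \<le> E0"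
  shows "sqrt \<alpha>hi * E \<le> 3 * (\<alpha>hi / \<alpha>lo) * s * R" "E \<le> 3 * (\<alpha>hi / \<alpha>lo) * s * E0"
proof -
  define \<kappa> where "\<kappa> = \<alpha>hi / \<alpha>lo"
  have hi: "0 < \<alpha>hi" using alpha_pos alpha_le by linarith
  have \<kappa>: "1 \<le> \<kappa>" using alpha_pos alpha_le by (simp add: \<kappa>_def)
  have "\<alpha>hi * ((2 * s / sqrt \<alpha>lo * R)\<^sup>2 + (sqrt \<alpha>hi * (2 * (1 / \<alpha>lo * s * R)))\<^sup>2)
      = 4 * (\<kappa> + \<kappa>\<^sup>2) * (s * R)\<^sup>2"
    using alpha_pos hi by (simp add: \<kappa>_def power_mult_distrib power_divide field_simps power2_eq_square)
  moreover have "\<alpha>hi * E\<^sup>2 \<le> \<alpha>hi * ((2 * s / sqrt \<alpha>lo * R)\<^sup>2 + (sqrt \<alpha>hi * (2 * (1 / \<alpha>lo * s * R)))\<^sup>2)"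
    using E hi by (intro mult_left_mono) auto
  moreover have "4 * (\<kappa> + \<kappa>\<^sup>2) * (s * R)\<^sup>2 \<le> 9 * \<kappa>\<^sup>2 * (s * R)\<^sup>2"
  proof (rule mult_right_mono)
    have "\<kappa> \<le> \<kappa>\<^sup>2" using \<kappa> by (simp add: power2_eq_square)
    then have "4 * (\<kappa> + \<kappa>\<^sup>2) \<le> 4 * (\<kappa>\<^sup>2 + \<kappa>\<^sup>2)" by (intro mult_left_mono add_right_mono) auto
    also have "\<dots> = 8 * \<kappa>\<^sup>2" by simp
    also have "\<dots> \<le> 9 * \<kappa>\<^sup>2" by (rule mult_right_mono) auto
    finally show "4 * (\<kappa> + \<kappa>\<^sup>2) \<le> 9 * \<kappa>\<^sup>2" .
  qed simp
  ultimately have "\<alpha>hi * E\<^sup>2 \<le> 9 * \<kappa>\<^sup>2 * (s * R)\<^sup>2" by linarith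
  then have "(sqrt \<alpha>hi * E)\<^sup>2 \<le> (3 * \<kappa> * s * R)\<^sup>2"
    using hi by (simp add: power_mult_distrib mult.assoc)
  moreover have nn: "0 \<le> 3 * \<kappa> * s" using \<kappa> assms(1) by simp
  moreover have "0 \<le> 3 * \<kappa> * s * R" by (rule mult_nonneg_nonneg[OF nn assms(2)])
  ultimately have 1: "sqrt \<alpha>hi * E \<le> 3 * \<kappa> * s * R"
    by (meson power2_le_imp_le)
  then show "sqrt \<alpha>hi * E \<le> 3 * (\<alpha>hi / \<alpha>lo) * s * R" by (simp only: \<kappa>_def)
  have "sqrt \<alpha>hi * E \<le> 3 * \<kappa> * s * (sqrt \<alpha>hi * E0)"
    using 1 mult_left_mono[OF R nn] by linarith
  then have "E * sqrt \<alpha>hi \<le> (3 * \<kappa> * s * E0) * sqrt \<alpha>hi" by (simp add: mult_ac)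
  then have "E \<le> 3 * \<kappa> * s * E0" by (rule mult_right_le_imp_le) (use hi in simp)
  then show "E \<le> 3 * (\<alpha>hi / \<alpha>lo) * s * E0" by (simp only: \<kappa>_def)
qed

end

section \<open>The marking procedure\<close>

lemma dual_coords_proj_dual:
  assumes "finite T"
  shows "dual_coords (proj_dual T r) = (\<lambda>k. if k \<in> T then dual_coords r k else 0)"
proof
  fix k
  have "proj_dual T r (phi k) = (\<Sum>j\<in>T. if j = k then r (phi j) else 0)"
    unfolding proj_dual_def using assms
    by (simp only: infsum_finite) (rule sum.cong, auto simp: fcoeff_phi)
  then show "dual_coords (proj_dual T r) k = (if k \<in> T then dual_coords r k else 0)"
    using assms by (simp add: dual_coords_def)
qed

text \<open>The marked and the unmarked part of the residual are orthogonal.\<close>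

lemma doerfler_tail:
  assumes r: "dual_coords r \<in> ell2" and D: "doerfler r \<theta> T" and \<theta>: "0 < \<theta>" "\<theta> < 1"
  shows "finite T"
    "ell2_norm (\<lambda>k. if k \<in> T then 0 else dual_coords r k) \<le> sqrt (1 - \<theta>\<^sup>2) * ell2_norm (dual_coords r)"
proof -
  let ?d = "dual_coords r"
  have T: "finite T" and mark: "\<theta> * ell2_norm ?d \<le> ell2_norm (\<lambda>k. if k \<in> T then ?d k else 0)"
    using D by (auto simp: doerfler_def is_arg_min_def dual_norm_eq_ell2 dual_coords_proj_dual)
  show "finite T" by (fact T)
  have \<theta>2: "0 \<le> 1 - \<theta>\<^sup>2" using \<theta> by (simp add: power_le_one)
  have "(\<theta> * ell2_norm ?d)\<^sup>2 \<le> (ell2_norm (\<lambda>k. if k \<in> T then ?d k else 0))\<^sup>2"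
    using mark \<theta> by (intro power_mono) auto
  also have "\<dots> = (\<Sum>k\<in>T. (cmod (?d k))\<^sup>2)"
    by (subst ell2_finite_support(2)[OF T]) auto
  finally have on: "\<theta>\<^sup>2 * (ell2_norm ?d)\<^sup>2 \<le> (\<Sum>k\<in>T. (cmod (?d k))\<^sup>2)" by (simp add: power_mult_distrib)
  have "(\<Sum>k\<in>F. (cmod (if k \<in> T then 0 else ?d k))\<^sup>2) \<le> (sqrt (1 - \<theta>\<^sup>2) * ell2_norm ?d)\<^sup>2"
    if F: "finite F" for F
  proof -
    have "(\<Sum>k\<in>F. (cmod (if k \<in> T then 0 else ?d k))\<^sup>2) = (\<Sum>k\<in>F - T. (cmod (?d k))\<^sup>2)"
      by (rule sum.mono_neutral_cong_right) (use F in auto)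
    also have "\<dots> = (\<Sum>k\<in>(F - T) \<union> T. (cmod (?d k))\<^sup>2) - (\<Sum>k\<in>T. (cmod (?d k))\<^sup>2)"
      using F T by (subst sum.union_disjoint) auto
    also have "\<dots> \<le> (ell2_norm ?d)\<^sup>2 - \<theta>\<^sup>2 * (ell2_norm ?d)\<^sup>2"
      using F T by (intro diff_mono ell2_finite_sum_le[OF r] on) auto
    also have "\<dots> = (sqrt (1 - \<theta>\<^sup>2) * ell2_norm ?d)\<^sup>2"
      using \<theta>2 by (simp add: power_mult_distrib left_diff_distrib)
    finally show ?thesis .
  qed
  from ell2I(2)[OF _ this]
  show "ell2_norm (\<lambda>k. if k \<in> T then 0 else ?d k) \<le> sqrt (1 - \<theta>\<^sup>2) * ell2_norm ?d"
    using \<theta>2 by simp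
qed

text \<open>A ball contains finitely many lattice points.\<close>

lemma finite_enrich:
  assumes "finite T"
  shows "finite (enrich T J)"
proof -
  have "enrich T J \<subseteq> (\<Union>l\<in>T. (\<lambda>m. l + m) ` {m. norm (lat m) \<le> real J})"
  proof
    fix k assume "k \<in> enrich T J"
    then obtain l where "l \<in> T" "norm (lat (k - l)) \<le> real J" by (auto simp: enrich_def)
    moreover have "k = l + (k - l)" by simp
    ultimately show "k \<in> (\<Union>l\<in>T. (\<lambda>m. l + m) ` {m. norm (lat m) \<le> real J})" by blast
  qed
  moreover have "finite {m :: int^'a. norm (lat m) \<le> real J}"
  proof (rule finite_subset)
    let ?S = "PiE (UNIV :: 'a set) (\<lambda>_. {- int J .. int J})"
    show "{m :: int^'a. norm (lat m) \<le> real J} \<subseteq> vec_lambda ` ?S"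
    proof
      fix m :: "int^'a" assume "m \<in> {m. norm (lat m) \<le> real J}"
      then have "\<bar>lat m $ i\<bar> \<le> real J" for i
        using component_le_norm_cart[of "lat m" i] by simp
      then have "real_of_int \<bar>m $ i\<bar> \<le> real_of_int (int J)" for i by simp
      then have "\<bar>m $ i\<bar> \<le> int J" for i by (simp only: of_int_le_iff)
      then have "- int J \<le> m $ i \<and> m $ i \<le> int J" for i by (simp add: abs_le_iff minus_le_iff)
      then have "vec_nth m \<in> ?S" by (simp add: PiE_def)
      then have "vec_lambda (vec_nth m) \<in> vec_lambda ` ?S" by (rule imageI)
      then show "m \<in> vec_lambda ` ?S" by (simp only: vec_nth_inverse)
    qed
    show "finite (vec_lambda ` ?S)" by (intro finite_imageI finite_PiE) auto
  qed
  ultimately show ?thesis using assms by (meson finite_UN_I finite_imageI finite_subset)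
qed

section \<open>Contraction of the algorithm\<close>

context elliptic_form
begin

lemma galerkin_orthogonal:
  assumes u: "weak_solution \<nu> \<sigma> f u" and w: "galerkin \<nu> \<sigma> f \<Lambda> w" and v: "v \<in> trig_space \<Lambda>"
  shows "a (\<lambda>x. u x - w x) v = 0"
proof -
  have H: "u \<in> H1p" "w \<in> H1p" "v \<in> H1p"
    using u w v trig_space_H1p unfolding weak_solution_def galerkin_def by blast+
  have "a u v = f v" "a w v = f v"
    using u w v H unfolding weak_solution_def galerkin_def by blast+
  then show ?thesis by (simp add: form_diff_left[OF H])
qed

lemma residual_coords:
  assumes u: "weak_solution \<nu> \<sigma> f u" and w: "w \<in> H1p"
  shows "dual_coords (residual \<nu> \<sigma> f w) = dual_coords (a (\<lambda>x. u x - w x))"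
proof -
  have "u \<in> H1p" "\<And>k. a u (phi k) = f (phi k)"
    using u H1p_phi unfolding weak_solution_def by blast+
  then show ?thesis
    by (simp add: dual_coords_def residual_def form_diff_left w H1p_phi)
qed

text \<open>The first three conclusions are the invariant that allows the step to be iterated: the residual functional
is used only through its values on the modes, where it agrees with $a(u - w, \cdot)$.\<close>

lemma pc_step_contraction:
  assumes u: "weak_solution \<nu> \<sigma> f u"
    and \<Lambda>: "finite \<Lambda>" "w \<in> trig_space \<Lambda>"
    and r: "dual_coords r = dual_coords (a (\<lambda>x. u x - w x))"
    and step: "pc_step \<nu> \<sigma> f \<alpha>lo \<theta> J \<Lambda> r \<Lambda>' w' r'"
    and \<theta>: "0 < \<theta>" "\<theta> < 1"
    and trunc: "opnorm_le (\<lambda>l k. inverse_mat A l k - truncate (inverse_mat A) J l k) \<epsilon>"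
    and \<epsilon>: "\<epsilon> \<le> sqrt ((1 - \<theta>\<^sup>2) / (\<alpha>lo * \<alpha>hi))"
  shows "finite \<Lambda>'" "w' \<in> trig_space \<Lambda>'" "dual_coords r' = dual_coords (a (\<lambda>x. u x - w' x))"
    "dual_norm r' \<le> 3 * (\<alpha>hi / \<alpha>lo) * sqrt (1 - \<theta>\<^sup>2) * dual_norm r"
    "energy (\<lambda>x. u x - w' x) \<le> 3 * (\<alpha>hi / \<alpha>lo) * sqrt (1 - \<theta>\<^sup>2) * energy (\<lambda>x. u x - w x)"
proof -
  obtain T \<Lambda>hat what where T: "doerfler r \<theta> T" and hat: "\<Lambda>hat = \<Lambda> \<union> enrich T J"
    and what: "galerkin \<nu> \<sigma> f \<Lambda>hat what"
    and coarse: "coarse \<Lambda>hat what (1 / \<alpha>lo * sqrt (1 - \<theta>\<^sup>2) * dual_norm r) \<Lambda>'"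
    and w': "galerkin \<nu> \<sigma> f \<Lambda>' w'" and r': "r' = residual \<nu> \<sigma> f w'"
    using step unfolding pc_step_def e_doerfler_def by blast
  define s where "s = sqrt (1 - \<theta>\<^sup>2)"
  have s: "0 \<le> s" using \<theta> by (simp add: s_def power_le_one)
  have whatt: "what \<in> trig_space \<Lambda>hat" and wt': "w' \<in> trig_space \<Lambda>'"
    using what w' by (auto simp: galerkin_def)
  have wt: "w \<in> trig_space \<Lambda>hat" using \<Lambda>(2) trig_space_mono[of \<Lambda> \<Lambda>hat] hat by blast
  have H: "u \<in> H1p" "w \<in> H1p" "what \<in> H1p" "w' \<in> H1p"
    using u wt whatt wt' trig_space_H1p unfolding weak_solution_def by blast+
  note e = H1p_diff[OF H(1,2)] and z = H1p_diff[OF H(1,3)] and e' = H1p_diff[OF H(1,4)]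
  have rl: "dual_coords r \<in> ell2" unfolding r by (rule dual_coords_form(1)[OF e])
  note tail = doerfler_tail[OF rl T \<theta>, folded s_def]
  have sub: "\<Lambda>' \<subseteq> \<Lambda>hat" and close: "H1_norm (\<lambda>x. what x - proj \<Lambda>' what x) \<le> 2 * (1 / \<alpha>lo * s * dual_norm r)"
    using coarse by (auto simp: coarse_def is_arg_min_def s_def)
  have "finite \<Lambda>hat" unfolding hat using \<Lambda>(1) finite_enrich[OF tail(1)] by simp
  then show fin: "finite \<Lambda>'" using sub by (rule rev_finite_subset)
  show "w' \<in> trig_space \<Lambda>'" by (rule wt')
  show r'c: "dual_coords r' = dual_coords (a (\<lambda>x. u x - w' x))"
    unfolding r' by (rule residual_coords[OF u H(4)])
  have pred: "energy (\<lambda>x. u x - what x) \<le> 2 * s / sqrt \<alpha>lo * dual_norm r"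
    unfolding dual_norm_eq_ell2 r
  proof (rule predictor_error[OF e z _ _ tail(1) _ tail(2)[unfolded r] s trunc])
    show "(\<lambda>x. u x - w x - (u x - what x)) \<in> trig_space \<Lambda>hat"
      using trig_space_diff[OF whatt wt] by simp
    show "a (\<lambda>x. u x - what x) v = 0" if "v \<in> trig_space \<Lambda>hat" for v
      by (rule galerkin_orthogonal[OF u what that])
    show "enrich T J \<subseteq> \<Lambda>hat" using hat by blast
    show "\<epsilon> \<le> s / sqrt (\<alpha>lo * \<alpha>hi)" using \<epsilon> by (simp add: s_def real_sqrt_divide)
  qed
  have "(energy (\<lambda>x. u x - w' x))\<^sup>2
      \<le> (energy (\<lambda>x. u x - what x))\<^sup>2 + (sqrt \<alpha>hi * (2 * (1 / \<alpha>lo * s * dual_norm r)))\<^sup>2"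
    by (rule coarsening_error[OF H(1) sub fin whatt galerkin_orthogonal[OF u what]
          wt' galerkin_orthogonal[OF u w'] close])
  moreover have "(energy (\<lambda>x. u x - what x))\<^sup>2 \<le> (2 * s / sqrt \<alpha>lo * dual_norm r)\<^sup>2"
    by (rule power_mono[OF pred form_self(2)[OF z]])
  ultimately have E: "(energy (\<lambda>x. u x - w' x))\<^sup>2
      \<le> (2 * s / sqrt \<alpha>lo * dual_norm r)\<^sup>2 + (sqrt \<alpha>hi * (2 * (1 / \<alpha>lo * s * dual_norm r)))\<^sup>2"
    by linarith
  have R: "dual_norm r \<le> sqrt \<alpha>hi * energy (\<lambda>x. u x - w x)"
    unfolding dual_norm_eq_ell2 r by (rule dual_coords_form(2)[OF e])
  have R0: "0 \<le> dual_norm r" by (simp add: dual_norm_eq_ell2)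
  note fin_step = contraction_arithmetic[OF s R0 form_self(2)[OF e'] E R form_self(2)[OF e]]
  show "energy (\<lambda>x. u x - w' x) \<le> 3 * (\<alpha>hi / \<alpha>lo) * sqrt (1 - \<theta>\<^sup>2) * energy (\<lambda>x. u x - w x)"
    using fin_step(2) by (simp only: s_def)
  have "dual_norm r' \<le> sqrt \<alpha>hi * energy (\<lambda>x. u x - w' x)"
    unfolding dual_norm_eq_ell2 r'c by (rule dual_coords_form(2)[OF e'])
  then show "dual_norm r' \<le> 3 * (\<alpha>hi / \<alpha>lo) * sqrt (1 - \<theta>\<^sup>2) * dual_norm r"
    using fin_step(1) unfolding s_def by linarith
qed

lemma pc_adfour_invariant:
  assumes u: "weak_solution \<nu> \<sigma> f u"
    and run: "pc_adfour \<nu> \<sigma> f \<alpha>lo \<theta> tol J \<Lambda> w r"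
    and \<theta>: "0 < \<theta>" "\<theta> < 1"
    and trunc: "opnorm_le (\<lambda>l k. inverse_mat A l k - truncate (inverse_mat A) J l k) \<epsilon>"
    and \<epsilon>: "\<epsilon> \<le> sqrt ((1 - \<theta>\<^sup>2) / (\<alpha>lo * \<alpha>hi))"
  shows "finite (\<Lambda> n) \<and> w n \<in> trig_space (\<Lambda> n) \<and> dual_coords (r n) = dual_coords (a (\<lambda>x. u x - w n x))"
proof (induction n)
  case 0
  have "a u (phi k) = f (phi k)" for k
    using u H1p_phi[of k] unfolding weak_solution_def by blast
  then have "dual_coords f = dual_coords (a u)" by (simp add: dual_coords_def)
  then show ?case using run trig_space_zero by (simp add: pc_adfour_def)
next
  case (Suc n)
  show ?case
  proof (cases "performed tol r n")
    case True
    then have "pc_step \<nu> \<sigma> f \<alpha>lo \<theta> J (\<Lambda> n) (r n) (\<Lambda> (Suc n)) (w (Suc n)) (r (Suc n))"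
      using run by (simp add: pc_adfour_def)
    from pc_step_contraction(1-3)[OF u _ _ _ this \<theta> trunc \<epsilon>] Suc show ?thesis by blast
  next
    case False
    then have "\<Lambda> (Suc n) = \<Lambda> n" "w (Suc n) = w n" "r (Suc n) = r n"
      using run by (simp_all add: pc_adfour_def)
    then show ?thesis using Suc by simp
  qed
qed

lemma pc_adfour_contraction:
  assumes u: "weak_solution \<nu> \<sigma> f u"
    and run: "pc_adfour \<nu> \<sigma> f \<alpha>lo \<theta> tol J \<Lambda> w r"
    and \<theta>: "0 < \<theta>" "\<theta> < 1"
    and trunc: "opnorm_le (\<lambda>l k. inverse_mat A l k - truncate (inverse_mat A) J l k) \<epsilon>"
    and \<epsilon>: "\<epsilon> \<le> sqrt ((1 - \<theta>\<^sup>2) / (\<alpha>lo * \<alpha>hi))"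
    and n: "performed tol r n"
  shows "dual_norm (r (Suc n)) \<le> 3 * (\<alpha>hi / \<alpha>lo) * sqrt (1 - \<theta>\<^sup>2) * dual_norm (r n)"
    "energy (\<lambda>x. u x - w (Suc n) x) \<le> 3 * (\<alpha>hi / \<alpha>lo) * sqrt (1 - \<theta>\<^sup>2) * energy (\<lambda>x. u x - w n x)"
proof -
  have "pc_step \<nu> \<sigma> f \<alpha>lo \<theta> J (\<Lambda> n) (r n) (\<Lambda> (Suc n)) (w (Suc n)) (r (Suc n))"
    using run n by (simp add: pc_adfour_def)
  from pc_step_contraction(4,5)[OF u _ _ _ this \<theta> trunc \<epsilon>] pc_adfour_invariant[OF u run \<theta> trunc \<epsilon>, of n]
  show "dual_norm (r (Suc n)) \<le> 3 * (\<alpha>hi / \<alpha>lo) * sqrt (1 - \<theta>\<^sup>2) * dual_norm (r n)"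
    "energy (\<lambda>x. u x - w (Suc n) x) \<le> 3 * (\<alpha>hi / \<alpha>lo) * sqrt (1 - \<theta>\<^sup>2) * energy (\<lambda>x. u x - w n x)"
    by blast+
qed

lemma H1_norm_le_dual:
  assumes "e \<in> H1p"
  shows "\<alpha>lo * H1_norm e \<le> ell2_norm (dual_coords (a e))"
proof -
  have "sqrt \<alpha>lo * (sqrt \<alpha>lo * H1_norm e) \<le> sqrt \<alpha>lo * energy e"
    using alpha_pos by (intro mult_left_mono energy_lower assms) simp
  then show ?thesis
    using energy_le_dual[OF assms] alpha_pos by (simp add: mult.assoc[symmetric])
qed

end

section \<open>Consequences of geometric decay\<close>

lemma dual_norm_nonneg: "0 \<le> dual_norm r"
  by (simp add: dual_norm_eq_ell2)

text \<open>The sequences are constant after termination, so the residual that met the stopping test persists.\<close>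

lemma not_performed_le:
  assumes run: "pc_adfour \<nu> \<sigma> f \<alpha> \<theta> tol J \<Lambda> w r" and "\<not> performed tol r n"
  shows "dual_norm (r n) \<le> tol"
  using assms(2)
proof (induction n)
  case 0
  then show ?case by (simp add: performed_def)
next
  case (Suc n)
  show ?case
  proof (cases "performed tol r n")
    case True
    then show ?thesis using Suc.prems unfolding performed_def
      by (metis le_Suc_eq not_le)
  next
    case False
    then have "r (Suc n) = r n" using run by (simp add: pc_adfour_def)
    then show ?thesis using Suc.IH[OF False] by simp
  qed
qed

lemma geometric_decay:
  fixes x :: "nat \<Rightarrow> real"
  assumes "0 \<le> \<rho>" "\<rho> < 1" "\<And>n. 0 \<le> x n" and step: "\<And>n. x (Suc n) \<le> \<rho> * x n"
  shows "x \<longlonglongrightarrow> 0"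
proof (rule tendsto_sandwich[OF _ _ tendsto_const])
  have "x n \<le> \<rho> ^ n * x 0" for n
  proof (induction n)
    case (Suc n)
    then show ?case using step[of n] mult_left_mono[OF Suc assms(1)] by simp
  qed simp
  then show "\<forall>\<^sub>F n in sequentially. x n \<le> \<rho> ^ n * x 0" by simp
  show "(\<lambda>n. \<rho> ^ n * x 0) \<longlonglongrightarrow> 0"
    using assms(1,2) by (auto intro!: tendsto_eq_intros LIMSEQ_power_zero)
qed (simp add: assms(3))

lemma geometric_residuals_terminate:
  assumes tol: "0 < tol" and \<rho>: "0 \<le> \<rho>" "\<rho> < 1"
    and step: "\<And>n. performed tol r n \<Longrightarrow> dual_norm (r (Suc n)) \<le> \<rho> * dual_norm (r n)"
  shows "terminates tol r"
proof (rule ccontr)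
  assume "\<not> terminates tol r"
  then have perf: "performed tol r n" for n by (simp add: terminates_def)
  have "(\<lambda>n. dual_norm (r n)) \<longlonglongrightarrow> 0"
    by (rule geometric_decay[OF \<rho>]) (rule dual_norm_nonneg, rule step[OF perf])
  from order_tendstoD(2)[OF this tol] obtain N where N: "\<And>n. n \<ge> N \<Longrightarrow> dual_norm (r n) < tol"
    by (auto simp: eventually_sequentially)
  have "tol < dual_norm (r (Suc N))" using perf[of "Suc N"] unfolding performed_def by simp
  with N[of "Suc N"] show False by simp
qed

text \<open>For tolerance zero an iteration that is not performed has zero residual, so that the geometric bound
persists after termination.\<close>

lemma geometric_residuals_tendsto_0:
  assumes run: "pc_adfour \<nu> \<sigma> f \<alpha> \<theta> 0 J \<Lambda> w r" and \<rho>: "0 \<le> \<rho>" "\<rho> < 1"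
    and step: "\<And>n. performed 0 r n \<Longrightarrow> dual_norm (r (Suc n)) \<le> \<rho> * dual_norm (r n)"
  shows "(\<lambda>n. dual_norm (r n)) \<longlonglongrightarrow> 0"
proof (rule geometric_decay[OF \<rho>])
  show "dual_norm (r (Suc n)) \<le> \<rho> * dual_norm (r n)" for n
  proof (cases "performed 0 r n")
    case False
    then have "dual_norm (r n) = 0" using not_performed_le[OF run False] dual_norm_nonneg[of "r n"] by simp
    moreover have "r (Suc n) = r n" using run False by (simp add: pc_adfour_def)
    ultimately show ?thesis by simp
  qed (rule step)
qed (rule dual_norm_nonneg)

lemma psi_alg_tendsto_0:
  assumes "real d < \<eta>"
  shows "psi_alg d C \<eta> \<longlonglongrightarrow> 0"
proof -
  have "filterlim (\<lambda>j. real j + 1) at_top sequentially"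
    by (rule filterlim_at_top_mono[OF filterlim_real_sequentially]) simp
  then have "(\<lambda>j. (real j + 1) powr (- (\<eta> - real d))) \<longlonglongrightarrow> 0"
    using assms by (intro tendsto_neg_powr) auto
  from tendsto_mult_left[OF this, of C] show ?thesis by (simp add: psi_alg_def[abs_def])
qed

lemma psi_exp_tendsto_0:
  assumes "0 < \<eta>"
  shows "psi_exp d C \<eta> \<longlonglongrightarrow> 0"
proof -
  \<comment> \<open>the constant left over after the substitution \<open>\<eta> * (j + 1)\<close> for the variable\<close>
  define c where "c = C * exp \<eta> / \<eta> ^ (d - 1)"
  have "filterlim (\<lambda>j. real j + 1) at_top sequentially"
    by (rule filterlim_at_top_mono[OF filterlim_real_sequentially]) simp
  then have "filterlim (\<lambda>j. \<eta> * (real j + 1)) at_top sequentially"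
    by (rule filterlim_tendsto_pos_mult_at_top[OF tendsto_const assms])
  from filterlim_compose[OF tendsto_power_div_exp_0 this]
  have "(\<lambda>j. c * ((\<eta> * (real j + 1)) ^ (d - 1) / exp (\<eta> * (real j + 1)))) \<longlonglongrightarrow> c * 0"
    by (intro tendsto_mult_left)
  moreover have "c * ((\<eta> * (real j + 1)) ^ (d - 1) / exp (\<eta> * (real j + 1))) = psi_exp d C \<eta> j" for j
  proof -
    have "exp (\<eta> * (real j + 1)) = exp (\<eta> * real j) * exp \<eta>"
      by (simp add: exp_add distrib_left)
    then show ?thesis
      using assms unfolding c_def psi_exp_def power_mult_distrib
      by (simp add: exp_minus divide_simps)
  qed
  ultimately show ?thesis by simp
qed

text \<open>Since $\psi$ tends to zero, some index satisfies the condition, so the least one exists and satisfies it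
too.\<close>

lemma Least_index_below:
  fixes \<psi> :: "nat \<Rightarrow> real"
  assumes "\<psi> \<longlonglongrightarrow> 0" "0 < t"
  shows "\<psi> (LEAST j. 1 \<le> j \<and> \<psi> j \<le> t) \<le> t"
proof -
  obtain N where "\<And>n. n \<ge> N \<Longrightarrow> \<psi> n < t"
    using order_tendstoD(2)[OF assms] by (auto simp: eventually_sequentially)
  then have "1 \<le> Suc N \<and> \<psi> (Suc N) \<le> t" by (simp add: less_imp_le)
  then have "1 \<le> (LEAST j. 1 \<le> j \<and> \<psi> j \<le> t) \<and> \<psi> (LEAST j. 1 \<le> j \<and> \<psi> j \<le> t) \<le> t"
    by (rule LeastI)
  then show ?thesis by blast
qed

theorem theorem3p5:
  fixes \<nu> \<sigma> :: "real^'d \<Rightarrow> real"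
    and \<nu>lo \<nu>hi \<sigma>lo \<sigma>hi \<alpha>lo \<alpha>hi :: real
    and f :: "'d functional"
    and u :: "real^'d \<Rightarrow> complex"
    and \<eta>L \<eta>bar cL C \<theta> \<rho> :: real
    and \<psi> :: "nat \<Rightarrow> real"
    and J :: nat
  assumes coeff_smooth: "continuous_on UNIV \<nu>" "continuous_on UNIV \<sigma>"
    and coeff_periodic: "periodic \<nu>" "periodic \<sigma>"
    and nu_bounds: "0 < \<nu>lo" "\<forall>x. \<nu>lo \<le> \<nu> x \<and> \<nu> x \<le> \<nu>hi"
    and sigma_bounds: "0 < \<sigma>lo" "\<forall>x. \<sigma>lo \<le> \<sigma> x \<and> \<sigma> x \<le> \<sigma>hi"
    and alpha: "\<alpha>lo = min \<nu>lo \<sigma>lo" "\<alpha>hi = max \<nu>hi \<sigma>hi"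
    and f: "f \<in> H1p_dual"
    and u: "weak_solution \<nu> \<sigma> f u"
    and decay:
      "(in_Da (stiffness \<nu> \<sigma>) \<eta>L \<and> \<eta>L > real CARD('d) \<and> ell2_invertible (stiffness \<nu> \<sigma>) \<and>
          \<eta>bar = \<eta>L \<and> \<psi> = psi_alg CARD('d) C \<eta>bar) \<or>
       (in_De (stiffness \<nu> \<sigma>) \<eta>L cL \<and>
          cL < 1 / 2 * (exp \<eta>L - 1) * (INF l. Re (stiffness \<nu> \<sigma> l l)) \<and>
          exp_rate \<eta>L cL \<eta>bar \<and> \<psi> = psi_exp CARD('d) C \<eta>bar)"
    and C: "\<forall>j. opnorm_le (\<lambda>l k. inverse_mat (stiffness \<nu> \<sigma>) l k
                   - truncate (inverse_mat (stiffness \<nu> \<sigma>)) j l k) (\<psi> j)"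
    and theta: "0 < \<theta>" "\<theta> < 1"
    and J: "J = (LEAST j. 1 \<le> j \<and> \<psi> j \<le> sqrt ((1 - \<theta>\<^sup>2) / (\<alpha>lo * \<alpha>hi)))"
    and rho: "\<rho> = 3 * (\<alpha>hi / \<alpha>lo) * sqrt (1 - \<theta>\<^sup>2)"
  shows
    "(\<forall>tol \<Lambda> w r. 0 \<le> tol \<and> tol < 1 \<and> pc_adfour \<nu> \<sigma> f \<alpha>lo \<theta> tol J \<Lambda> w r \<longrightarrow>
        (\<forall>n. performed tol r n \<longrightarrow>
           dual_norm (r (Suc n)) \<le> \<rho> * dual_norm (r n) \<and>
           energy_norm \<nu> \<sigma> (\<lambda>x. u x - w (Suc n) x) \<le> \<rho> * energy_norm \<nu> \<sigma> (\<lambda>x. u x - w n x))) \<and>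
     (\<rho> < 1 \<longrightarrow>
        (\<forall>tol \<Lambda> w r. 0 < tol \<and> pc_adfour \<nu> \<sigma> f \<alpha>lo \<theta> tol J \<Lambda> w r \<longrightarrow> terminates tol r) \<and>
        (\<forall>\<Lambda> w r. pc_adfour \<nu> \<sigma> f \<alpha>lo \<theta> 0 J \<Lambda> w r \<longrightarrow>
           (\<lambda>n. H1_norm (\<lambda>x. u x - w n x)) \<longlonglongrightarrow> 0))"
proof -
  interpret elliptic_form \<nu> \<sigma> \<alpha>lo \<alpha>hi
  proof
    show "\<alpha>lo \<le> \<nu> x \<and> \<nu> x \<le> \<alpha>hi" "\<alpha>lo \<le> \<sigma> x \<and> \<sigma> x \<le> \<alpha>hi" for x
      using nu_bounds(2) sigma_bounds(2) alpha by (auto simp: min_le_iff_disj le_max_iff_disj)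
    show "0 < \<alpha>lo" using nu_bounds(1) sigma_bounds(1) alpha by simp
  qed (rule coeff_smooth)+
  have \<psi>0: "\<psi> \<longlonglongrightarrow> 0"
    using decay
  proof
    assume "in_Da A \<eta>L \<and> \<eta>L > real CARD('d) \<and> ell2_invertible A \<and>
          \<eta>bar = \<eta>L \<and> \<psi> = psi_alg CARD('d) C \<eta>bar"
    then show ?thesis using psi_alg_tendsto_0[of "CARD('d)" \<eta>L C] by simp
  next
    assume "in_De A \<eta>L cL \<and> cL < 1 / 2 * (exp \<eta>L - 1) * (INF l. Re (A l l)) \<and>
          exp_rate \<eta>L cL \<eta>bar \<and> \<psi> = psi_exp CARD('d) C \<eta>bar"
    then show ?thesis using psi_exp_tendsto_0[of \<eta>bar "CARD('d)" C] by (simp add: exp_rate_def)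
  qed
  have hi: "0 < \<alpha>hi" using alpha_pos alpha_le by linarith
  have \<theta>2: "0 < 1 - \<theta>\<^sup>2" using theta by (simp add: power_strict_decreasing[of 0 2, simplified] abs_square_less_1)
  have "0 < sqrt ((1 - \<theta>\<^sup>2) / (\<alpha>lo * \<alpha>hi))" using \<theta>2 hi alpha_pos by simp
  from Least_index_below[OF \<psi>0 this]
  have \<epsilon>: "\<psi> J \<le> sqrt ((1 - \<theta>\<^sup>2) / (\<alpha>lo * \<alpha>hi))" by (simp only: J)
  have trunc: "opnorm_le (\<lambda>l k. inverse_mat A l k - truncate (inverse_mat A) J l k) (\<psi> J)"
    using C by blast
  have \<rho>0: "0 \<le> \<rho>" using hi alpha_pos \<theta>2 by (simp add: rho)
  note contraction = pc_adfour_contraction[OF u _ theta trunc \<epsilon>, folded rho]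
  show ?thesis
  proof (intro conjI allI impI)
    fix tol \<Lambda> w r n
    assume "0 \<le> tol \<and> tol < 1 \<and> pc_adfour \<nu> \<sigma> f \<alpha>lo \<theta> tol J \<Lambda> w r" and n: "performed tol r n"
    then have run: "pc_adfour \<nu> \<sigma> f \<alpha>lo \<theta> tol J \<Lambda> w r" by blast
    show "dual_norm (r (Suc n)) \<le> \<rho> * dual_norm (r n)"
      "energy (\<lambda>x. u x - w (Suc n) x) \<le> \<rho> * energy (\<lambda>x. u x - w n x)"
      by (rule contraction[OF run n])+
  next
    fix tol \<Lambda> w r
    assume \<rho>: "\<rho> < 1" and "0 < tol \<and> pc_adfour \<nu> \<sigma> f \<alpha>lo \<theta> tol J \<Lambda> w r"
    then have tol: "0 < tol" and run: "pc_adfour \<nu> \<sigma> f \<alpha>lo \<theta> tol J \<Lambda> w r" by blast+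
    show "terminates tol r"
      by (rule geometric_residuals_terminate[OF tol \<rho>0 \<rho>]) (rule contraction(1)[OF run])
  next
    fix \<Lambda> w r
    assume \<rho>: "\<rho> < 1" and run: "pc_adfour \<nu> \<sigma> f \<alpha>lo \<theta> 0 J \<Lambda> w r"
    have lim: "(\<lambda>n. dual_norm (r n) / \<alpha>lo) \<longlonglongrightarrow> 0 / \<alpha>lo"
      using alpha_pos
      by (intro tendsto_divide tendsto_const geometric_residuals_tendsto_0[OF run \<rho>0 \<rho> contraction(1)[OF run]]) auto
    have bound: "H1_norm (\<lambda>x. u x - w n x) \<le> dual_norm (r n) / \<alpha>lo" for n
    proof -
      have inv: "w n \<in> trig_space (\<Lambda> n)" "dual_coords (r n) = dual_coords (a (\<lambda>x. u x - w n x))"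
        using pc_adfour_invariant[OF u run theta trunc \<epsilon>, of n] by blast+
      have "u \<in> H1p" "w n \<in> H1p" using u inv(1) trig_space_H1p unfolding weak_solution_def by blast+
      from H1_norm_le_dual[OF H1p_diff[OF this]]
      have "\<alpha>lo * H1_norm (\<lambda>x. u x - w n x) \<le> dual_norm (r n)"
        by (simp only: dual_norm_eq_ell2 inv(2))
      then show ?thesis using alpha_pos by (simp add: le_divide_eq mult.commute)
    qed
    show "(\<lambda>n. H1_norm (\<lambda>x. u x - w n x)) \<longlonglongrightarrow> 0"
      by (rule tendsto_sandwich[OF _ _ tendsto_const lim[simplified]])
         (intro always_eventually allI H1_norm_nonneg bound)+
  qed
qed

end
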